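(* Let $\Bbbk$ be an algebraically closed field of characteristic zero, $G$ a finite abelian group and $\Phi$ a normalized $3$-cocycle on $G$. Let $V\in {}_{\Bbbk G}^{\Bbbk G}\mathcal{YD}^{\Phi}$ be a simple twisted Yetter-Drinfeld module with $\dim(V)\geq 2$, and let $g\in G$ be the $G$-degree of $V$. Then the Nichols algebra $B(V)$ has finite Gelfand-Kirillov dimension if and only if $V$ is of one of the following types: (T1) $g\triangleright v=v$ for all $v\in V$; (T2) $g\triangleright v=-v$ for all $v\in V$; (T3) $g\triangleright v=\zeta_3 v$ for all $v\in V$ and $\dim(V)=2$, where $\zeta_3$ is a primitive third root of unity.
   Context: A normalized $3$-cocycle on $G$ is a map $\Phi:G^3\to\Bbbk^*$ with $\Phi(ef,g,h)\Phi(e,f,gh)=\Phi(e,f,g)\Phi(e,fg,h)\Phi(f,g,h)$ and $\Phi(f,1,g)=1$. For $g\in G$ put $\Phi_g(x,y)=\frac{\Phi(g,x,y)\Phi(x,y,g)}{\Phi(x,g,y)}$, a $2$-cocycle on $G$. The category ${}_{\Bbbk G}^{\Bbbk G}\mathcal{YD}^{\Phi}$ of twisted Yetter-Drinfeld modules: objects are $G$-graded vector spaces $V=\bigoplus_{g\in G}V_g$ where each $V_g$ is a projective $G$-representation with respect to $\Phi_g$, i.e. $e\triangleright(f\triangleright v)=\Phi_g(e,f)\,(ef)\triangleright v$ and $1\triangleright v=v$ for $v\in V_g$; morphisms are linear maps preserving grading and action. The tensor product has the product grading and $e\triangleright(X\otimes Y)=\Phi_e(g,h)(e\triangleright X)\otimes(e\triangleright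 Y)$ for $X,Y$ of degrees $g,h$. For $X,Y,Z$ of degrees $e,f,g$ the associativity constraint is $(X\otimes Y)\otimes Z\mapsto\Phi(e,f,g)^{-1}X\otimes(Y\otimes Z)$ and the braiding is $\mathcal R(X\otimes Y)=(e\triangleright Y)\otimes X$. Algebras and braided Hopf algebras are taken in this braided monoidal category. A simple object $V$ is concentrated in a single degree, called its $G$-degree. For a finite-dimensional object $V$, $T(V)=\bigoplus_{n\ge0}V^{\otimes n}$ (tensor powers bracketed to the left) is the tensor algebra in the category; it is an $\mathbb N_0$-graded braided Hopf algebra in which the elements of $V$ are primitive. The Nichols algebra is $B(V)=T(V)/I(V)$, where $I(V)$ is the maximal $\mathbb N_0$-homogeneous Hopf ideal contained in $\bigoplus_{n\ge2}V^{\otimes n}$. Gelfand-Kirillov dimension: for an algebra $A$ generated by a finite-dimensional subobject $U$, put $A_n=\sum_{0\le i\le n}U^i$ ($U^i$ is the span of $i$-fold products; the bracketing is immaterial since rebracketing homogeneous factors changes a product by a nonzero scalar), and $\operatorname{GKdim}(A)=\limsup_{n\to\infty}\log_n\dim(A_n)$. *)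

theory Defs
  imports
    "HOL-Algebra.QuotRing"
    "HOL-Algebra.Module"
    "HOL-Computational_Algebra.Polynomial"
    "HOL-Library.Extended_Real"
begin

section \<open>Normalized 3-cocycles and twisted Yetter-Drinfeld modules\<close>

definition normalized_3_cocycle ::
    "('g, 'm) monoid_scheme \<Rightarrow> ('g \<Rightarrow> 'g \<Rightarrow> 'g \<Rightarrow> 'k::field) \<Rightarrow> bool" where
  "normalized_3_cocycle G \<Phi> \<longleftrightarrow>
     (\<forall>f\<in>carrier G. \<forall>g\<in>carrier G. \<forall>h\<in>carrier G. \<Phi> f g h \<noteq> 0) \<and>
     (\<forall>e\<in>carrier G. \<forall>f\<in>carrier G. \<forall>g\<in>carrier G. \<forall>h\<in>carrier G.
        \<Phi> (e \<otimes>\<^bsub>G\<^esub> f) g h * \<Phi> e f (g \<otimes>\<^bsub>G\<^esub> h) = \<Phi> e f g * \<Phi> e (f \<otimes>\<^bsub>G\<^esub> g) h * \<Phi> f g h) \<and>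
     (\<forall>f\<in>carrier G. \<forall>g\<in>carrier G. \<Phi> f \<one>\<^bsub>G\<^esub> g = 1)"

definition slice :: "('g \<Rightarrow> 'g \<Rightarrow> 'g \<Rightarrow> 'k::field) \<Rightarrow> 'g \<Rightarrow> 'g \<Rightarrow> 'g \<Rightarrow> 'k" where
  "slice \<Phi> g x y = \<Phi> g x y * \<Phi> x y g / \<Phi> x g y"

text \<open>The underlying vector space is the whole type \<open>'v\<close>.\<close>

record ('k, 'g, 'v) yd_module =
  scal :: "'k \<Rightarrow> 'v \<Rightarrow> 'v"
  comp :: "'g \<Rightarrow> 'v set"
  act  :: "'g \<Rightarrow> 'v \<Rightarrow> 'v"

definition twisted_yd_module ::
    "('g, 'm) monoid_scheme \<Rightarrow> ('g \<Rightarrow> 'g \<Rightarrow> 'g \<Rightarrow> 'k::field) \<Rightarrow>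
     ('k, 'g, 'v::ab_group_add) yd_module \<Rightarrow> bool" where
  "twisted_yd_module G \<Phi> V \<longleftrightarrow>
     vector_space (scal V) \<and>
     (\<forall>g\<in>carrier G. module.subspace (scal V) (comp V g)) \<and>
     (\<forall>v. \<exists>!f. f \<in> (\<Pi>\<^sub>E g\<in>carrier G. comp V g) \<and> v = (\<Sum>g\<in>carrier G. f g)) \<and>
     (\<forall>e\<in>carrier G. Vector_Spaces.linear (scal V) (scal V) (act V e)) \<and>
     (\<forall>e\<in>carrier G. \<forall>g\<in>carrier G. act V e ` comp V g \<subseteq> comp V g) \<and>
     (\<forall>e\<in>carrier G. \<forall>f\<in>carrier G. \<forall>g\<in>carrier G. \<forall>v\<in>comp V g.
        act V e (act V f v) = scal V (slice \<Phi> g e f) (act V (e \<otimes>\<^bsub>G\<^esub> f) v)) \<and>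
     (\<forall>v. act V \<one>\<^bsub>G\<^esub> v = v)"

definition yd_subobject ::
    "('g, 'm) monoid_scheme \<Rightarrow> ('k::field, 'g, 'v::ab_group_add) yd_module \<Rightarrow> 'v set \<Rightarrow> bool" where
  "yd_subobject G V U \<longleftrightarrow>
     module.subspace (scal V) U \<and>
     U = module.span (scal V) (\<Union>g\<in>carrier G. U \<inter> comp V g) \<and>
     (\<forall>e\<in>carrier G. act V e ` U \<subseteq> U)"

definition yd_simple ::
    "('g, 'm) monoid_scheme \<Rightarrow> ('k::field, 'g, 'v::ab_group_add) yd_module \<Rightarrow> bool" where
  "yd_simple G V \<longleftrightarrow>
     (UNIV :: 'v set) \<noteq> {0} \<and> (\<forall>U. yd_subobject G V U \<longrightarrow> U = {0} \<or> U = UNIV)"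

definition concentrated_in_degree :: "('k, 'g, 'v) yd_module \<Rightarrow> 'g \<Rightarrow> bool" where
  "concentrated_in_degree V g \<longleftrightarrow> comp V g = UNIV"

text \<open>The library's \<open>dim\<close> is \<open>0\<close> on infinite-dimensional spaces, so \<open>yd_dim V \<ge> 2\<close> includes
  finite-dimensionality (which is automatic for a simple object over a finite group).\<close>

definition yd_dim :: "('k::field, 'g, 'v::ab_group_add) yd_module \<Rightarrow> nat" where
  "yd_dim V = vector_space.dim (scal V) UNIV"


section \<open>Not necessarily associative algebras over a field type\<close>

text \<open>Algebras are HOL-Algebra \<open>module\<close> records whose scalars form a field type. The tensor and
  Nichols algebras below are in general not associative in the ordinary sense, only in the
  monoidal category, so none of the library's ring locales applies.\<close>

inductive_set lin_span :: "('k, 'a, 'm) module_scheme \<Rightarrow> 'a set \<Rightarrow> 'a set"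
  for A :: "('k, 'a, 'm) module_scheme" (structure) and S :: "'a set" where
  zero: "\<zero> \<in> lin_span A S"
| base: "x \<in> S \<Longrightarrow> x \<in> lin_span A S"
| add: "x \<in> lin_span A S \<Longrightarrow> y \<in> lin_span A S \<Longrightarrow> x \<oplus> y \<in> lin_span A S"
| smult: "x \<in> lin_span A S \<Longrightarrow> c \<odot> x \<in> lin_span A S"

text \<open>Minimal size of a spanning set; only meaningful for finite-dimensional \<open>U\<close>.\<close>

definition lin_dim :: "('k, 'a, 'm) module_scheme \<Rightarrow> 'a set \<Rightarrow> nat" where
  "lin_dim A U = (LEAST n. \<exists>B\<subseteq>U. finite B \<and> card B = n \<and> lin_span A B = U)"

definition quotient_algebra :: "('k, 'a) module \<Rightarrow> 'a set \<Rightarrow> ('k, 'a set) module" where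
  "quotient_algebra A I = ring.extend (A Quot I)
     (module.fields (\<lambda>c X. \<Union>x\<in>X. I +>\<^bsub>A\<^esub> (c \<odot>\<^bsub>A\<^esub> x)))"

primrec power_span :: "('k, 'a, 'm) module_scheme \<Rightarrow> 'a set \<Rightarrow> nat \<Rightarrow> 'a set" where
  "power_span A U 0 = lin_span A {\<one>\<^bsub>A\<^esub>}"
| "power_span A U (Suc n) = lin_span A {x \<otimes>\<^bsub>A\<^esub> u | x u. x \<in> power_span A U n \<and> u \<in> U}"

definition power_filtration :: "('k, 'a, 'm) module_scheme \<Rightarrow> 'a set \<Rightarrow> nat \<Rightarrow> 'a set" where
  "power_filtration A U n = lin_span A (\<Union>i\<le>n. power_span A U i)"

text \<open>\<open>U\<close> is a finite-dimensional generating subspace; the junk values of \<open>log\<close> in base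
  \<open>0\<close> and \<open>1\<close> do not affect the limes superior.\<close>

definition GKdim :: "('k, 'a, 'm) module_scheme \<Rightarrow> 'a set \<Rightarrow> ereal" where
  "GKdim A U = limsup (\<lambda>n. ereal (log (real n) (real (lin_dim A (power_filtration A U n)))))"


section \<open>Tensor powers\<close>

text \<open>A word \<open>[(g\<^sub>1,v\<^sub>1),\<dots>,(g\<^sub>n,v\<^sub>n)]\<close> with \<open>v\<^sub>i \<in> V\<^bsub>g\<^sub>i\<^esub>\<close> stands for the left-bracketed
  tensor \<open>(\<dots>(v\<^sub>1 \<otimes> v\<^sub>2)\<dots>) \<otimes> v\<^sub>n\<close>. Multilinear forms separate the elements of a tensor product of
  vector spaces, so \<open>T(V)\<close> is realized as the space of functionals on multilinear forms
  spanned by the evaluations at words, and \<open>T(V) \<otimes> T(V)\<close> likewise by the evaluations at pairs of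
  words. Functionals take the value \<open>0\<close> on functions that are not multilinear.
  Linear maps are described by their effect on words: if \<open>x \<in> T(V)\<close> is the sum of
  \<open>c\<^sub>i\<close> times the word \<open>w\<^sub>i\<close>, then \<open>x f\<close> is the sum of all \<open>c\<^sub>i * f w\<^sub>i\<close>.\<close>

type_synonym ('g, 'v) word = "('g \<times> 'v) list"
type_synonym ('g, 'v, 'k) tens = "(('g, 'v) word \<Rightarrow> 'k) \<Rightarrow> 'k"
type_synonym ('g, 'v, 'k) tens2 = "(('g, 'v) word \<times> ('g, 'v) word \<Rightarrow> 'k) \<Rightarrow> 'k"

definition words :: "('g, 'm) monoid_scheme \<Rightarrow> ('k, 'g, 'v) yd_module \<Rightarrow> ('g, 'v) word set" where
  "words G V = {w. \<forall>(g, v)\<in>set w. g \<in> carrier G \<and> v \<in> comp V g}"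

definition wdeg :: "('g, 'm) monoid_scheme \<Rightarrow> ('g, 'v) word \<Rightarrow> 'g" where
  "wdeg G w = foldl (\<lambda>h p. h \<otimes>\<^bsub>G\<^esub> fst p) \<one>\<^bsub>G\<^esub> w"

definition multilinear_forms ::
    "('g, 'm) monoid_scheme \<Rightarrow> ('k::field, 'g, 'v::ab_group_add) yd_module \<Rightarrow>
     (('g, 'v) word \<Rightarrow> 'k) set" where
  "multilinear_forms G V = {\<phi>. \<forall>u\<in>words G V. \<forall>w\<in>words G V. \<forall>g\<in>carrier G.
     (\<forall>x\<in>comp V g. \<forall>y\<in>comp V g.
        \<phi> (u @ (g, x + y) # w) = \<phi> (u @ (g, x) # w) + \<phi> (u @ (g, y) # w)) \<and>
     (\<forall>c. \<forall>x\<in>comp V g. \<phi> (u @ (g, scal V c x) # w) = c * \<phi> (u @ (g, x) # w))}"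

definition bimultilinear_forms ::
    "('g, 'm) monoid_scheme \<Rightarrow> ('k::field, 'g, 'v::ab_group_add) yd_module \<Rightarrow>
     (('g, 'v) word \<times> ('g, 'v) word \<Rightarrow> 'k) set" where
  "bimultilinear_forms G V = {\<psi>.
     (\<forall>b\<in>words G V. (\<lambda>a. \<psi> (a, b)) \<in> multilinear_forms G V) \<and>
     (\<forall>a\<in>words G V. (\<lambda>b. \<psi> (a, b)) \<in> multilinear_forms G V)}"

definition functional_on :: "'f set \<Rightarrow> ('f \<Rightarrow> 'k::zero) \<Rightarrow> 'f \<Rightarrow> 'k" where
  "functional_on M x = (\<lambda>\<phi>. if \<phi> \<in> M then x \<phi> else 0)"

definition functional_algebra ::
    "('f \<Rightarrow> 'k::field) set \<Rightarrow> (('f \<Rightarrow> 'k) \<Rightarrow> ('f \<Rightarrow> 'k) \<Rightarrow> ('f \<Rightarrow> 'k)) \<Rightarrow> ('f \<Rightarrow> 'k) \<Rightarrow>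
     ('k, 'f \<Rightarrow> 'k) module" where
  "functional_algebra S m e =
     (let A = \<lparr>carrier = UNIV, monoid.mult = m, one = e, zero = (\<lambda>\<phi>. 0),
               add = (\<lambda>x y \<phi>. x \<phi> + y \<phi>), module.smult = (\<lambda>c x \<phi>. c * x \<phi>)\<rparr>
      in A\<lparr>carrier := lin_span A S\<rparr>)"


section \<open>The tensor algebra as a braided Hopf algebra\<close>

context
  fixes G :: "('g, 'm) monoid_scheme" (structure)
    and \<Phi> :: "'g \<Rightarrow> 'g \<Rightarrow> 'g \<Rightarrow> 'k::field"
    and V :: "('k, 'g, 'v::ab_group_add) yd_module"
begin

text \<open>Moving the brackets of \<open>u \<otimes> (w' \<otimes> z)\<close> to \<open>(u \<otimes> w') \<otimes> z\<close> contributes the inverse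
  associator \<open>\<Phi>(deg u, deg w', deg z)\<close>; iterate over the letters \<open>z\<close> of \<open>w\<close>.\<close>

definition concat_coeff :: "('g, 'v) word \<Rightarrow> ('g, 'v) word \<Rightarrow> 'k" where
  "concat_coeff u w = (\<Prod>i<length w. \<Phi> (wdeg G u) (wdeg G (take i w)) (fst (w ! i)))"

text \<open>Likewise iterate \<open>e \<triangleright> (w' \<otimes> z) = \<Phi>\<^sub>e(deg w', deg z) (e \<triangleright> w') \<otimes> (e \<triangleright> z)\<close>.\<close>

definition act_coeff :: "'g \<Rightarrow> ('g, 'v) word \<Rightarrow> 'k" where
  "act_coeff e w = (\<Prod>i<length w. slice \<Phi> e (wdeg G (take i w)) (fst (w ! i)))"

definition act_word :: "'g \<Rightarrow> ('g, 'v) word \<Rightarrow> ('g, 'v) word" where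
  "act_word e w = map (\<lambda>(g, v). (g, act V e v)) w"

definition tword :: "('g, 'v) word \<Rightarrow> ('g, 'v, 'k) tens" where
  "tword w = functional_on (multilinear_forms G V) (\<lambda>\<phi>. \<phi> w)"

definition tmult :: "('g, 'v, 'k) tens \<Rightarrow> ('g, 'v, 'k) tens \<Rightarrow> ('g, 'v, 'k) tens" where
  "tmult x y = functional_on (multilinear_forms G V)
     (\<lambda>\<phi>. x (\<lambda>u. y (\<lambda>w. concat_coeff u w * \<phi> (u @ w))))"

definition tensor_algebra :: "('k, ('g, 'v, 'k) tens) module" where
  "tensor_algebra = functional_algebra (tword ` words G V) tmult (tword [])"

definition tact :: "'g \<Rightarrow> ('g, 'v, 'k) tens \<Rightarrow> ('g, 'v, 'k) tens" where
  "tact e x = functional_on (multilinear_forms G V)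
     (\<lambda>\<phi>. x (\<lambda>w. act_coeff e w * \<phi> (act_word e w)))"

definition tgroup_comp :: "'g \<Rightarrow> ('g, 'v, 'k) tens set" where
  "tgroup_comp g = lin_span tensor_algebra (tword ` {w \<in> words G V. wdeg G w = g})"

definition tpower :: "nat \<Rightarrow> ('g, 'v, 'k) tens set" where
  "tpower n = lin_span tensor_algebra (tword ` {w \<in> words G V. length w = n})"

definition pure_tensor :: "('g, 'v, 'k) tens \<Rightarrow> ('g, 'v, 'k) tens \<Rightarrow> ('g, 'v, 'k) tens2" where
  "pure_tensor x y = functional_on (bimultilinear_forms G V) (\<lambda>\<psi>. x (\<lambda>a. y (\<lambda>b. \<psi> (a, b))))"

text \<open>The braided product \<open>(a \<otimes> b)(c \<otimes> d)\<close> on \<open>T(V) \<otimes> T(V)\<close>: the braiding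
  \<open>b \<otimes> c \<mapsto> (deg b \<triangleright> c) \<otimes> b\<close> in the middle, and the four associators (in degrees
  \<open>\<alpha>, \<beta>, \<gamma>, \<delta>\<close>) of the chain
  \<open>(A B)(C D) \<rightarrow> ((A B) C) D \<rightarrow> (A (B C)) D \<rightarrow> (A (C B)) D \<rightarrow> ((A C) B) D \<rightarrow> (A C)(B D)\<close>.\<close>

definition interchange_coeff :: "'g \<Rightarrow> 'g \<Rightarrow> 'g \<Rightarrow> 'g \<Rightarrow> 'k" where
  "interchange_coeff \<alpha> \<beta> \<gamma> \<delta> =
     \<Phi> (\<alpha> \<otimes> \<beta>) \<gamma> \<delta> * inverse (\<Phi> \<alpha> \<beta> \<gamma>) * \<Phi> \<alpha> \<gamma> \<beta> * inverse (\<Phi> (\<alpha> \<otimes> \<gamma>) \<beta> \<delta>)"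

definition tmult2 :: "('g, 'v, 'k) tens2 \<Rightarrow> ('g, 'v, 'k) tens2 \<Rightarrow> ('g, 'v, 'k) tens2" where
  "tmult2 X Y = functional_on (bimultilinear_forms G V)
     (\<lambda>\<psi>. X (\<lambda>(a, b). Y (\<lambda>(c, d).
        interchange_coeff (wdeg G a) (wdeg G b) (wdeg G c) (wdeg G d) *
        act_coeff (wdeg G b) c *
        concat_coeff a (act_word (wdeg G b) c) * concat_coeff b d *
        \<psi> (a @ act_word (wdeg G b) c, b @ d))))"

definition tensor_algebra2 :: "('k, ('g, 'v, 'k) tens2) module" where
  "tensor_algebra2 = functional_algebra
     {pure_tensor (tword a) (tword b) | a b. a \<in> words G V \<and> b \<in> words G V}
     tmult2 (pure_tensor (tword []) (tword []))"

text \<open>The comultiplication is the algebra morphism for which the letters are primitive.\<close>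

definition comult_word :: "('g, 'v) word \<Rightarrow> ('g, 'v, 'k) tens2" where
  "comult_word w = foldl
     (\<lambda>X p. tmult2 X (pure_tensor (tword [p]) (tword []) \<oplus>\<^bsub>tensor_algebra2\<^esub>
                      pure_tensor (tword []) (tword [p])))
     (pure_tensor (tword []) (tword [])) w"

definition comult :: "('g, 'v, 'k) tens \<Rightarrow> ('g, 'v, 'k) tens2" where
  "comult x = functional_on (bimultilinear_forms G V) (\<lambda>\<psi>. x (\<lambda>w. comult_word w \<psi>))"

definition counit :: "('g, 'v, 'k) tens \<Rightarrow> 'k" where
  "counit x = x (\<lambda>w. if w = [] then 1 else 0)"

text \<open>\<open>convolution f h\<close> is the multiplication after \<open>f \<otimes> h\<close> after the comultiplication.\<close>

definition convolution ::
    "(('g, 'v, 'k) tens \<Rightarrow> ('g, 'v, 'k) tens) \<Rightarrow> (('g, 'v, 'k) tens \<Rightarrow> ('g, 'v, 'k) tens) \<Rightarrow>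
     ('g, 'v, 'k) tens \<Rightarrow> ('g, 'v, 'k) tens" where
  "convolution f h x = functional_on (multilinear_forms G V)
     (\<lambda>\<phi>. comult x (\<lambda>(a, b). tmult (f (tword a)) (h (tword b)) \<phi>))"

definition tensor_endomorphism :: "(('g, 'v, 'k) tens \<Rightarrow> ('g, 'v, 'k) tens) \<Rightarrow> bool" where
  "tensor_endomorphism f \<longleftrightarrow>
     (\<forall>x\<in>carrier tensor_algebra. \<forall>y\<in>carrier tensor_algebra.
        f (x \<oplus>\<^bsub>tensor_algebra\<^esub> y) = f x \<oplus>\<^bsub>tensor_algebra\<^esub> f y) \<and>
     (\<forall>c. \<forall>x\<in>carrier tensor_algebra.
        f (c \<odot>\<^bsub>tensor_algebra\<^esub> x) = c \<odot>\<^bsub>tensor_algebra\<^esub> f x) \<and>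
     (\<forall>g\<in>carrier G. f ` tgroup_comp g \<subseteq> tgroup_comp g) \<and>
     (\<forall>e\<in>carrier G. \<forall>x\<in>carrier tensor_algebra. f (tact e x) = tact e (f x))"

definition antipode :: "(('g, 'v, 'k) tens \<Rightarrow> ('g, 'v, 'k) tens) \<Rightarrow> bool" where
  "antipode S \<longleftrightarrow> tensor_endomorphism S \<and>
     (\<forall>x\<in>carrier tensor_algebra.
        convolution S (\<lambda>y. y) x = counit x \<odot>\<^bsub>tensor_algebra\<^esub> \<one>\<^bsub>tensor_algebra\<^esub> \<and>
        convolution (\<lambda>y. y) S x = counit x \<odot>\<^bsub>tensor_algebra\<^esub> \<one>\<^bsub>tensor_algebra\<^esub>)"

definition tensor_subobject :: "('g, 'v, 'k) tens set \<Rightarrow> bool" where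
  "tensor_subobject I \<longleftrightarrow>
     I \<subseteq> carrier tensor_algebra \<and>
     I = lin_span tensor_algebra (\<Union>g\<in>carrier G. I \<inter> tgroup_comp g) \<and>
     (\<forall>e\<in>carrier G. tact e ` I \<subseteq> I)"

text \<open>Convolution inverses are unique, so \<open>S\<close> below is the antipode of \<open>T(V)\<close>.\<close>

definition hopf_ideal :: "('g, 'v, 'k) tens set \<Rightarrow> bool" where
  "hopf_ideal I \<longleftrightarrow>
     tensor_subobject I \<and>
     (\<forall>x\<in>carrier tensor_algebra. \<forall>y\<in>I. tmult x y \<in> I \<and> tmult y x \<in> I) \<and>
     (\<forall>x\<in>I. comult x \<in> lin_span tensor_algebra2
        ({pure_tensor y z | y z. y \<in> I \<and> z \<in> carrier tensor_algebra} \<union>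
         {pure_tensor y z | y z. y \<in> carrier tensor_algebra \<and> z \<in> I})) \<and>
     (\<forall>x\<in>I. counit x = 0) \<and>
     (\<exists>S. antipode S \<and> S ` I \<subseteq> I)"

definition nat_homogeneous :: "('g, 'v, 'k) tens set \<Rightarrow> bool" where
  "nat_homogeneous I \<longleftrightarrow> I = lin_span tensor_algebra (\<Union>n. I \<inter> tpower n)"

definition nichols_ideal :: "('g, 'v, 'k) tens set" where
  "nichols_ideal = (GREATEST I. hopf_ideal I \<and> nat_homogeneous I \<and>
     I \<subseteq> lin_span tensor_algebra (\<Union>n\<in>{2..}. tpower n))"

definition nichols_algebra :: "('k, ('g, 'v, 'k) tens set) module" where
  "nichols_algebra = quotient_algebra tensor_algebra nichols_ideal"

definition nichols_generators :: "('g, 'v, 'k) tens set set" where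
  "nichols_generators = (\<lambda>x. nichols_ideal +>\<^bsub>tensor_algebra\<^esub> x) ` tpower 1"

end

end

theory Submission
  imports Defs "HOL-Library.Poly_Mapping" "HOL-Library.Function_Algebras"
begin

text \<open>
  By Schur's lemma the degree \<open>g\<close> acts on \<open>V\<close> by a scalar \<open>q\<close>, so up to scalars coming from \<open>\<Phi>\<close>
  the braiding of \<open>V\<close> is \<open>q\<close> times the flip. These scalars cancel between the product and the
  coproduct of \<open>T(V)\<close>: if the product of words of lengths \<open>m\<close> and \<open>n\<close> is \<open>\<gamma>(m,n)\<close> times their
  concatenation, then the \<open>(m,n)\<close>-component of the coproduct is the \<open>q\<close>-unshuffle divided by
  \<open>\<gamma>(m,n)\<close>. Hence the maximal Hopf ideal is the radical of the free algebra on \<open>V\<close>, that is the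
  common kernel of the functionals \<open>\<epsilon> D\<^sub>f D\<^sub>h \<dots>\<close>, where \<open>D\<^sub>f\<close> is the skew derivation of a linear form.

  If \<open>q\<^sup>2 = 1\<close>, the radical contains all \<open>x y - q y x\<close>; if \<open>q\<close> is a primitive third root of unity,
  it contains the sums over all orders of three letters. In the first case, and in the second if
  \<open>dim V = 2\<close>, polynomially many words of length at most \<open>n\<close> span modulo the radical.

  In all other cases there are elements \<open>r\<^sub>0, r\<^sub>1, \<dots>\<close> with \<open>deg r\<^sub>m = O(m)\<close> and compositions \<open>\<Omega>\<^sub>m\<close> of skew
  derivations such that, for \<open>v\<close> a product of elements \<open>r\<^sub>n\<close> with \<open>n > m\<close>, one has \<open>\<Omega>\<^sub>m v = 0\<close> while
  \<open>\<Omega>\<^sub>m (r\<^sub>m v)\<close> is a nonzero multiple of \<open>v\<close>. The \<open>2\<^sup>m\<close> ordered subproducts of \<open>r\<^sub>0, \<dots>, r\<^sub>m\<^sub>-\<^sub>1\<close> are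
  then independent in degree \<open>O(m\<^sup>2)\<close>, so the growth is not polynomial. With \<open>z\<^sub>0 = y\<close> and
  \<open>z\<^sub>i\<^sub>+\<^sub>1 = x z\<^sub>i - q\<^sup>i\<^sup>+\<^sup>1 z\<^sub>i x\<close> one takes \<open>r\<^sub>n = z\<^sub>n\<close> if \<open>q\<close> is not a root of unity. If \<open>q\<close> has order \<open>N\<close>, the
  \<open>r\<^sub>n\<close> are iterated skew commutators with a fixed \<open>t\<close>: for \<open>N\<close> even, \<open>t = z\<^sub>b\<^sub>+\<^sub>1\<close> and \<open>r\<^sub>0 = z\<^sub>b\<close> with
  \<open>b = N/2 - 2\<close>; for \<open>N \<ge> 5\<close> odd, \<open>r\<^sub>0 = z\<^sub>b\<close> and \<open>t\<close> is a skew commutator of \<open>z\<^sub>b\<^sub>+\<^sub>1\<close> and \<open>z\<^sub>b\<close> with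
  \<open>b = (N - 3)/2\<close>; for \<open>N = 3\<close> one needs a third letter \<open>w\<close>, and \<open>t\<close> is built from \<open>x\<close>, \<open>w\<close>, \<open>y\<close>.
\<close>

section \<open>Free algebras\<close>

text \<open>One has \<open>Dx (z (i + 1)) = lam (i + 1) z i\<close> with
  \<open>lam i = [i]_q (1 - q^(i+1))\<close>. If \<open>q\<close> has order \<open>N > 1\<close>,
  then \<open>lam (N - 1) = 0\<close>, so \<open>z (N - 1)\<close> is killed by both derivations and
  the chain of the \<open>z i\<close> breaks off. This is why infinitely many independent elements
  must come from iterated commutators. The index \<open>b\<close> is chosen such that
  \<open>t\<close> and the operator \<open>E\<close> that lowers the new chain have the same degree,
  \<open>N/2\<close> or \<open>N\<close>: on a suitable subspace \<open>E\<close> is then a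
  derivation up to signs, or an ordinary one, and the two terms of the commutator in which
  \<open>E\<close> is spent on \<open>t\<close> cancel. What remains is one constant per case that
  must not vanish. For odd \<open>N\<close> it contains \<open>1 + \<sigma> + \<sigma>^2\<close>
  with \<open>\<sigma>^4 = q\<close>; this factor is zero for \<open>N = 3\<close>, which is how
  dimension two becomes exceptional there.

  The letters of the free algebra are all vectors of \<open>V\<close>, not the members of a basis.
  Linear relations between vectors are invisible to linear forms, so they lie in the radical anyway,
  and the radical can be studied before any tensor product is formed.\<close>

datatype 'l fmon = FM (letters: "'l list")

instantiation fmon :: (type) monoid_add
begin

definition zero_fmon :: "'l fmon" where "zero_fmon = FM []"

definition plus_fmon :: "'l fmon \<Rightarrow> 'l fmon \<Rightarrow> 'l fmon" where
  "plus_fmon u w = FM (letters u @ letters w)"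

instance
  by standard (simp_all add: zero_fmon_def plus_fmon_def)

end

text \<open>\<open>Poly_Mapping\<close> multiplies by convolution over an additive monoid. With
  concatenation as the non-commutative addition of \<open>fmon\<close>, this type is the free
  associative algebra on \<open>'l\<close>.\<close>

type_synonym ('l, 'k) falg = "'l fmon \<Rightarrow>\<^sub>0 'k"

definition wrd :: "'l list \<Rightarrow> ('l, 'k::field) falg" where
  "wrd w = Poly_Mapping.single (FM w) 1"

definition sc :: "'k::field \<Rightarrow> ('l, 'k) falg \<Rightarrow> ('l, 'k) falg" where
  "sc c p = Poly_Mapping.single 0 c * p"

lemma wrd_Nil: "wrd [] = 1"
  by (simp add: wrd_def zero_fmon_def[symmetric])

lemma wrd_append: "wrd (u @ w) = wrd u * wrd w"
  by (simp add: wrd_def mult_single plus_fmon_def)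

lemma wrd_Cons: "wrd (x # w) = wrd [x] * wrd w"
  by (simp add: wrd_append[symmetric])

lemma lookup_sc [simp]: "Poly_Mapping.lookup (sc c p) m = c * Poly_Mapping.lookup p m"
proof -
  have "sc c p = Poly_Mapping.map ((*) c) p" by (simp add: sc_def mult_map_scale_conv_mult)
  then show ?thesis by (simp add: Poly_Mapping.map.rep_eq when_def del: mult_map_scale_conv_mult)
qed

lemma sc_add: "sc c (p + r) = sc c p + sc c r"
  by (simp add: sc_def algebra_simps)

lemma sc_diff: "sc c (p - r) = sc c p - sc c r"
  by (simp add: sc_def algebra_simps)

lemma sc_add_left: "sc (c + d) p = sc c p + sc d p"
  by (simp add: sc_def single_add algebra_simps)

lemma sc_diff_left: "sc (c - d) p = sc c p - sc d p"
  by (simp add: sc_def single_diff algebra_simps)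

lemma sc_sc [simp]: "sc c (sc d p) = sc (c * d) p"
  by (simp add: sc_def mult_single mult.assoc[symmetric])

lemma sc_1 [simp]: "sc 1 p = p"
  by (simp add: sc_def)

lemma sc_0 [simp]: "sc 0 p = 0" "sc c 0 = 0"
  by (simp_all add: sc_def)

lemma sc_mult_left [simp]: "sc c p * r = sc c (p * r)"
  by (simp add: sc_def mult.assoc)

lemma sc_sum: "sc c (sum f A) = (\<Sum>x\<in>A. sc c (f x))"
  by (simp add: sc_def sum_distrib_left)

lemma sc_sum_left: "sc (sum f A) p = (\<Sum>x\<in>A. sc (f x) p)"
  by (induction A rule: infinite_finite_induct) (simp_all add: sc_add_left)

lemma sc_minus_left: "sc (- c) p = - sc c p"
  by (simp add: sc_def single_uminus)

lemma falg_expand: "p = (\<Sum>m\<in>Poly_Mapping.keys p. sc (Poly_Mapping.lookup p m) (wrd (letters m)))"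
proof (rule poly_mapping_eqI)
  fix m
  have "Poly_Mapping.lookup (\<Sum>n\<in>Poly_Mapping.keys p. sc (Poly_Mapping.lookup p n) (wrd (letters n))) m
      = (\<Sum>n\<in>Poly_Mapping.keys p. if n = m then Poly_Mapping.lookup p n else 0)"
    by (simp add: lookup_sum wrd_def lookup_single when_def if_distrib cong: if_cong)
  also have "\<dots> = Poly_Mapping.lookup p m" by (simp add: in_keys_iff)
  finally show "Poly_Mapping.lookup p m = Poly_Mapping.lookup (\<Sum>n\<in>Poly_Mapping.keys p. sc (Poly_Mapping.lookup p n) (wrd (letters n))) m" by simp
qed

lemma falg_sum_induct: "P 0 \<Longrightarrow> (\<And>p r. P p \<Longrightarrow> P r \<Longrightarrow> P (p + r)) \<Longrightarrow> (\<And>x. x \<in> A \<Longrightarrow> P (f x))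
    \<Longrightarrow> P (sum f A)"
  by (induction A rule: infinite_finite_induct) auto

lemma falg_induct [case_names zero wrd add]:
  assumes "P 0" "\<And>c w. P (sc c (wrd w))" "\<And>p r. P p \<Longrightarrow> P r \<Longrightarrow> P (p + r)"
  shows "P p"
  by (subst falg_expand, rule falg_sum_induct) (use assms in auto)

lemma mult_sc [simp]: "p * sc c r = sc c (p * r)"
proof -
  have "p * Poly_Mapping.single 0 c = Poly_Mapping.single 0 c * p"
  proof (induction p rule: falg_induct)
    case (wrd d w)
    then show ?case
      by (simp add: sc_def wrd_def mult_single mult.assoc zero_fmon_def plus_fmon_def mult.commute)
  qed (simp_all add: algebra_simps)
  then show ?thesis by (simp add: sc_def mult.assoc[symmetric])
qed

text \<open>Linear extension of a scalar function on words; \<open>bind\<close> is the counterpart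
  with values in a free algebra. The linear maps below are given in this way by their values on
  words.\<close>

definition ap :: "('l, 'k::field) falg \<Rightarrow> ('l list \<Rightarrow> 'k) \<Rightarrow> 'k" where
  "ap p f = (\<Sum>m\<in>Poly_Mapping.keys p. Poly_Mapping.lookup p m * f (letters m))"

definition bind :: "('l, 'k::field) falg \<Rightarrow> ('l list \<Rightarrow> ('n, 'k) falg) \<Rightarrow> ('n, 'k) falg" where
  "bind p h = (\<Sum>m\<in>Poly_Mapping.keys p. sc (Poly_Mapping.lookup p m) (h (letters m)))"

lemma ap_superset: "finite A \<Longrightarrow> Poly_Mapping.keys p \<subseteq> A \<Longrightarrow> ap p f = (\<Sum>m\<in>A. Poly_Mapping.lookup p m * f (letters m))"
  unfolding ap_def by (rule sum.mono_neutral_left) (auto simp: in_keys_iff)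

lemma bind_superset: "finite A \<Longrightarrow> Poly_Mapping.keys p \<subseteq> A \<Longrightarrow> bind p h = (\<Sum>m\<in>A. sc (Poly_Mapping.lookup p m) (h (letters m)))"
  unfolding bind_def by (rule sum.mono_neutral_left) (auto simp: in_keys_iff)

lemma ap_0 [simp]: "ap 0 f = 0" by (simp add: ap_def)
lemma bind_0 [simp]: "bind 0 h = 0" by (simp add: bind_def)

lemma ap_add: "ap (p + r) f = ap p f + ap r f"
proof -
  have "Poly_Mapping.keys (p + r) \<subseteq> Poly_Mapping.keys p \<union> Poly_Mapping.keys r" by (rule keys_add)
  then show ?thesis
    by (simp add: ap_superset[where A = "Poly_Mapping.keys p \<union> Poly_Mapping.keys r"] lookup_add algebra_simps sum.distrib)
qed

lemma bind_add: "bind (p + r) h = bind p h + bind r h"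
proof -
  have "Poly_Mapping.keys (p + r) \<subseteq> Poly_Mapping.keys p \<union> Poly_Mapping.keys r" by (rule keys_add)
  then show ?thesis
    by (simp add: bind_superset[where A = "Poly_Mapping.keys p \<union> Poly_Mapping.keys r"] lookup_add sc_add_left sum.distrib)
qed

lemma keys_sc: "Poly_Mapping.keys (sc c p) \<subseteq> Poly_Mapping.keys p"
  by (auto simp: in_keys_iff)

lemma ap_sc: "ap (sc c p) f = c * ap p f"
  by (subst ap_superset[OF finite_keys keys_sc]) (simp add: ap_def sum_distrib_left mult.assoc)

lemma bind_sc: "bind (sc c p) h = sc c (bind p h)"
  by (subst bind_superset[OF finite_keys keys_sc]) (simp add: bind_def sc_sum)

lemma ap_wrd [simp]: "ap (wrd w) f = f w"
  by (simp add: ap_def wrd_def)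

lemma bind_wrd [simp]: "bind (wrd w) h = h w"
  by (simp add: bind_def wrd_def)

lemma ap_1 [simp]: "ap 1 f = f []"
  by (metis ap_wrd wrd_Nil)

lemma ap_diff: "ap (p - r) f = ap p f - ap r f"
  using ap_add[of "p - r" r f] by simp

lemma bind_diff: "bind (p - r) h = bind p h - bind r h"
  using bind_add[of "p - r" r h] by simp

lemma ap_sum: "ap (sum p A) f = (\<Sum>x\<in>A. ap (p x) f)"
  by (induction A rule: infinite_finite_induct) (simp_all add: ap_add)

lemma bind_sum: "bind (sum p A) f = (\<Sum>x\<in>A. bind (p x) f)"
  by (induction A rule: infinite_finite_induct) (simp_all add: bind_add)

lemma ap_fun_add: "ap p (\<lambda>w. f w + h w) = ap p f + ap p h"
  by (simp add: ap_def algebra_simps sum.distrib)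

lemma ap_fun_scale: "ap p (\<lambda>w. c * f w) = c * ap p f"
  by (simp add: ap_def sum_distrib_left algebra_simps)

lemma ap_fun_0 [simp]: "ap p (\<lambda>w. 0) = 0"
  by (simp add: ap_def)

lemma ap_bind: "ap (bind p h) f = ap p (\<lambda>w. ap (h w) f)"
  by (simp add: bind_def ap_sum ap_sc ap_def[of p])

lemma ap_mult: "ap (p * r) f = ap p (\<lambda>u. ap r (\<lambda>w. f (u @ w)))"
proof (induction p rule: falg_induct)
  case (wrd c u)
  show ?case
  proof (induction r rule: falg_induct)
    case (wrd d w)
    then show ?case by (simp add: ap_sc wrd_append[symmetric])
  qed (auto simp add: distrib_left ap_add sc_add ap_sc ap_fun_add)
qed (simp_all add: distrib_right ap_add)

definition hdeg :: "nat \<Rightarrow> ('l, 'k::field) falg \<Rightarrow> bool" where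
  "hdeg n p \<longleftrightarrow> (\<forall>m\<in>Poly_Mapping.keys p. length (letters m) = n)"

lemma hdeg_wrd: "hdeg (length w) (wrd w)"
  by (simp add: hdeg_def wrd_def)

lemma hdeg_0 [simp]: "hdeg n 0"
  by (simp add: hdeg_def)

lemma hdeg_add: "hdeg n p \<Longrightarrow> hdeg n r \<Longrightarrow> hdeg n (p + r)"
  unfolding hdeg_def using keys_add[of p r] by blast

lemma hdeg_sc: "hdeg n p \<Longrightarrow> hdeg n (sc c p)"
  unfolding hdeg_def using keys_sc[of c p] by blast

lemma hdeg_diff: "hdeg n p \<Longrightarrow> hdeg n r \<Longrightarrow> hdeg n (p - r)"
  using hdeg_add[of n p "sc (-1) r"] hdeg_sc[of n r "-1"] by (simp add: sc_minus_left)

lemma hdeg_mult: "hdeg n p \<Longrightarrow> hdeg m r \<Longrightarrow> hdeg (n + m) (p * r)"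
  unfolding hdeg_def using keys_mult[of p r] by (fastforce simp: plus_fmon_def)

lemma hdeg_mult': "hdeg n p \<Longrightarrow> hdeg m r \<Longrightarrow> n + m = k \<Longrightarrow> hdeg k (p * r)"
  using hdeg_mult by metis

section \<open>Skew derivations and unshuffles\<close>

locale skew =
  fixes q :: "'k::field"
begin

text \<open>Each letter is deleted in turn, weighted by its value under \<open>f\<close> and by one
  factor \<open>q\<close> for every letter that \<open>f\<close> has passed: the braided derivation
  for \<open>q\<close> times the flip.\<close>

fun delw :: "('l \<Rightarrow> 'k) \<Rightarrow> 'l list \<Rightarrow> ('l, 'k) falg" where
  "delw f [] = 0"
| "delw f (x # w) = sc (f x) (wrd w) + sc q (wrd [x] * delw f w)"

definition D :: "('l \<Rightarrow> 'k) \<Rightarrow> ('l, 'k) falg \<Rightarrow> ('l, 'k) falg" where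
  "D f p = bind p (delw f)"

text \<open>The algebra automorphism that is \<open>q\<close> on letters; it is the twist in the
  Leibniz rule \<open>D_mult\<close>.\<close>

definition grad :: "('l, 'k) falg \<Rightarrow> ('l, 'k) falg" where
  "grad p = bind p (\<lambda>w. sc (q ^ length w) (wrd w))"

lemma delw_append: "delw f (u @ w) = delw f u * wrd w + sc (q ^ length u) (wrd u * delw f w)"
proof (induction u)
  case (Cons a u)
  then show ?case
    by (simp add: distrib_right distrib_left wrd_append sc_add mult.assoc) (metis wrd_Cons mult.assoc)
qed (simp add: wrd_Nil)

lemma D_0 [simp]: "D f 0 = 0" by (simp add: D_def)
lemma D_add: "D f (p + r) = D f p + D f r" by (simp add: D_def bind_add)
lemma D_diff: "D f (p - r) = D f p - D f r" by (simp add: D_def bind_diff)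
lemma D_sc: "D f (sc c p) = sc c (D f p)" by (simp add: D_def bind_sc)
lemma D_wrd: "D f (wrd w) = delw f w" by (simp add: D_def)
lemma D_1 [simp]: "D f 1 = 0" by (metis D_wrd delw.simps(1) wrd_Nil)
lemma D_letter: "D f (wrd [x]) = sc (f x) 1" by (simp add: D_wrd wrd_Nil)
lemma D_sum: "D f (sum p A) = (\<Sum>x\<in>A. D f (p x))" by (simp add: D_def bind_sum)

lemma D_mult: "D f (p * r) = D f p * r + grad p * D f r"
proof (induction p rule: falg_induct)
  case (wrd c u)
  show ?case
  proof (induction r rule: falg_induct)
    case (wrd d w)
    then show ?case
      by (simp add: D_sc D_wrd wrd_append[symmetric] delw_append grad_def bind_sc sc_add mult_ac)
  qed (simp_all add: distrib_left D_add sc_add D_sc)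
qed (simp_all add: distrib_right D_add grad_def bind_add)

lemma grad_hdeg:
  assumes "hdeg n p"
  shows "grad p = sc (q ^ n) p"
proof -
  have "grad p = (\<Sum>m\<in>Poly_Mapping.keys p. sc (q ^ n) (sc (Poly_Mapping.lookup p m) (wrd (letters m))))"
    unfolding grad_def bind_def using assms by (intro sum.cong) (auto simp: hdeg_def mult.commute)
  also have "\<dots> = sc (q ^ n) p"
    by (subst (3) falg_expand) (simp only: sc_sum)
  finally show ?thesis .
qed

lemma D_mult_hdeg: "hdeg n p \<Longrightarrow> D f (p * r) = D f p * r + sc (q ^ n) (p * D f r)"
  by (simp add: D_mult grad_hdeg)

lemma hdeg_delw: "hdeg (length w - 1) (delw f w)"
proof (induction w)
  case (Cons x w)
  have "hdeg (length w) (wrd [x] * delw f w)"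
  proof (cases w)
    case (Cons y v)
    then show ?thesis using hdeg_mult[OF hdeg_wrd[of "[x]"] Cons.IH] by simp
  qed simp
  then show ?case by (simp add: hdeg_add hdeg_sc hdeg_wrd)
qed simp

lemma hdeg_D: "hdeg n p \<Longrightarrow> hdeg (n - 1) (D f p)"
  unfolding D_def bind_def
proof (rule falg_sum_induct)
  fix m assume "hdeg n p" "m \<in> Poly_Mapping.keys p"
  then have "length (letters m) = n" by (simp add: hdeg_def)
  then show "hdeg (n - 1) (sc (Poly_Mapping.lookup p m) (delw f (letters m)))"
    using hdeg_delw[of "letters m" f] by (simp add: hdeg_sc)
qed (auto intro: hdeg_add)

primrec DF :: "('l \<Rightarrow> 'k) list \<Rightarrow> ('l, 'k) falg \<Rightarrow> ('l, 'k) falg" where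
  "DF [] p = p"
| "DF (f # F) p = DF F (D f p)"

lemma DF_0 [simp]: "DF F 0 = 0" by (induction F) simp_all
lemma DF_add: "DF F (p + r) = DF F p + DF F r" by (induction F arbitrary: p r) (simp_all add: D_add)
lemma DF_sc: "DF F (sc c p) = sc c (DF F p)" by (induction F arbitrary: p) (simp_all add: D_sc)
lemma DF_append: "DF (F @ H) p = DF H (DF F p)" by (induction F arbitrary: p) simp_all

text \<open>Pairing of a word of forms with a word of letters. For equal lengths it is the sum over
  all permutations of the products of matched values, weighted by \<open>q\<close> to the number of
  inversions, that is the matrix of the quantum symmetrizer.\<close>

definition phi :: "('l \<Rightarrow> 'k) list \<Rightarrow> 'l list \<Rightarrow> 'k" where
  "phi F w = Poly_Mapping.lookup (DF F (wrd w)) 0"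

lemma ap_phi: "ap p (phi F) = Poly_Mapping.lookup (DF F p) 0"
  by (induction p rule: falg_induct) (simp_all add: ap_add ap_sc phi_def DF_add DF_sc lookup_add)

lemma phi_Nil: "phi [] w = (if w = [] then 1 else 0)"
  by (simp add: phi_def wrd_def lookup_single when_def zero_fmon_def)

lemma phi_Cons: "phi (f # F) w = ap (delw f w) (phi F)"
  by (simp add: ap_phi) (simp add: phi_def D_wrd)

lemma ap_phi_Cons: "ap p (phi (f # F)) = ap (D f p) (phi F)"
  by (simp add: ap_phi)

lemma ap_delw_Cons: "ap (delw f (x # w)) \<phi> = f x * \<phi> w + q * ap (delw f w) (\<lambda>u. \<phi> (x # u))"
  by (simp add: ap_add ap_sc ap_mult)

declare delw.simps(2) [simp del]

lemma ap_delw_append: "ap (delw f (u @ w)) \<phi> =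
    ap (delw f u) (\<lambda>u'. \<phi> (u' @ w)) + q ^ length u * ap (delw f w) (\<lambda>w'. \<phi> (u @ w'))"
  by (simp add: delw_append ap_add ap_sc ap_mult)

lemma ap_cong_hdeg: "hdeg n p \<Longrightarrow> (\<And>w. length w = n \<Longrightarrow> f w = h w) \<Longrightarrow> ap p f = ap p h"
  unfolding ap_def hdeg_def by (intro sum.cong) auto

lemma phi_length: "length F \<noteq> length w \<Longrightarrow> phi F w = 0"
proof (induction F arbitrary: w)
  case (Cons f F)
  show ?case
  proof (cases w)
    case (Cons x v)
    then have "ap (delw f w) (phi F) = ap (delw f w) (\<lambda>_. 0)"
      using Cons.prems by (intro ap_cong_hdeg[OF hdeg_delw] Cons.IH) auto
    then show ?thesis by (simp add: phi_Cons)
  qed (simp add: phi_Cons)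
qed (simp add: phi_Nil)

text \<open>The \<open>q\<close>-unshuffle coproduct of a word, paired with \<open>\<psi>\<close>.\<close>

primrec sh :: "'a list \<Rightarrow> ('a list \<Rightarrow> 'a list \<Rightarrow> 'k) \<Rightarrow> 'k" where
  "sh [] \<psi> = \<psi> [] []"
| "sh (c # w) \<psi> = sh w (\<lambda>a b. \<psi> (c # a) b + q ^ length a * \<psi> a (c # b))"

lemma sh_add: "sh w (\<lambda>a b. \<psi> a b + \<chi> a b) = sh w \<psi> + sh w \<chi>"
proof (induction w arbitrary: \<psi> \<chi>)
  case (Cons c w)
  have "sh (c # w) (\<lambda>a b. \<psi> a b + \<chi> a b) =
      sh w (\<lambda>a b. (\<psi> (c # a) b + q ^ length a * \<psi> a (c # b)) + (\<chi> (c # a) b + q ^ length a * \<chi> a (c # b)))"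
    by (simp add: algebra_simps)
  also have "\<dots> = sh (c # w) \<psi> + sh (c # w) \<chi>" by (subst Cons.IH) simp
  finally show ?case .
qed simp

lemma sh_scale: "sh w (\<lambda>a b. t * \<psi> a b) = t * sh w \<psi>"
proof (induction w arbitrary: \<psi>)
  case (Cons c w)
  have "sh (c # w) (\<lambda>a b. t * \<psi> a b) = sh w (\<lambda>a b. t * (\<psi> (c # a) b + q ^ length a * \<psi> a (c # b)))"
    by (simp add: algebra_simps)
  then show ?case by (simp add: Cons.IH)
qed simp

lemma sh_cong:
  "(\<And>a b. length a + length b = length w \<Longrightarrow> \<psi> a b = \<chi> a b) \<Longrightarrow> sh w \<psi> = sh w \<chi>"
proof (induction w arbitrary: \<psi> \<chi>)
  case (Cons c w)
  have "sh w (\<lambda>a b. \<psi> (c # a) b + q ^ length a * \<psi> a (c # b)) = sh w (\<lambda>a b. \<chi> (c # a) b + q ^ length a * \<chi> a (c # b))"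
    by (rule Cons.IH) (simp add: Cons.prems)
  then show ?case by simp
qed simp

lemma sh_0 [simp]: "sh w (\<lambda>a b. 0) = 0"
  using sh_scale[of w 0 "\<lambda>a b. 0"] by simp

text \<open>Mirror image of the defining recursion: a last letter that goes to the left factor
  passes every letter of the right one.\<close>

lemma sh_snoc: "sh (w @ [c]) \<psi> = sh w (\<lambda>a b. q ^ length b * \<psi> (a @ [c]) b + \<psi> a (b @ [c]))"
  by (induction w arbitrary: \<psi>) (simp_all add: algebra_simps)

text \<open>The pairing turns concatenation of letters into unshuffling of forms: each derivation
  acts in \<open>u\<close>, or passes \<open>u\<close> at the price \<open>q ^ length u\<close>.
  Only splittings with \<open>length F1 = length u\<close> survive, so this price is the one that
  \<open>sh\<close> charges.\<close>

lemma phi_append: "phi F (u @ w) = sh F (\<lambda>F1 F2. phi F1 u * phi F2 w)"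
proof (induction F arbitrary: u w)
  case (Cons f F)
  have swap: "ap p (\<lambda>u'. sh F (\<lambda>F1 F2. \<psi> F1 F2 u')) = sh F (\<lambda>F1 F2. ap p (\<psi> F1 F2))"
    for p :: "('a, 'k) falg" and \<psi> :: "('a \<Rightarrow> 'k) list \<Rightarrow> ('a \<Rightarrow> 'k) list \<Rightarrow> 'a list \<Rightarrow> 'k"
    by (induction p rule: falg_induct) (simp_all add: ap_add sh_add ap_sc sh_scale)
  have "phi (f # F) (u @ w) = sh F (\<lambda>F1 F2. ap (delw f u) (\<lambda>u'. phi F1 u' * phi F2 w))
      + q ^ length u * sh F (\<lambda>F1 F2. ap (delw f w) (\<lambda>w'. phi F1 u * phi F2 w'))"
    by (simp add: phi_Cons ap_delw_append Cons.IH swap)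
  also have "\<dots> = sh F (\<lambda>F1 F2. phi (f # F1) u * phi F2 w + q ^ length u * (phi F1 u * phi (f # F2) w))"
    by (simp add: sh_add sh_scale phi_Cons ap_fun_scale mult.commute[of _ "phi _ w"])
  also have "\<dots> = sh (f # F) (\<lambda>F1 F2. phi F1 u * phi F2 w)"
  proof -
    have "phi F1 u = 0 \<or> length u = length F1" for F1 using phi_length[of F1 u] by auto
    then show ?thesis by (auto intro!: sh_cong) (metis mult_zero_left)
  qed
  finally show ?case .
qed (auto simp: phi_Nil)

text \<open>Coassociativity: \<open>D f\<close> is the contraction of the left leg of the coproduct
  with \<open>f\<close>, so it may be applied before or after a further coproduct.\<close>

lemma sh_delw: "sh v (\<lambda>a b. ap (delw f a) (\<lambda>a'. \<psi> a' b)) = ap (delw f v) (\<lambda>v'. sh v' \<psi>)"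
proof (induction v arbitrary: \<psi>)
  case (Cons c v)
  have "sh (c # v) (\<lambda>a b. ap (delw f a) (\<lambda>a'. \<psi> a' b)) =
     sh v (\<lambda>a b. f c * \<psi> a b + (q * ap (delw f a) (\<lambda>u. \<psi> (c # u) b) + q ^ length a * ap (delw f a) (\<lambda>a'. \<psi> a' (c # b))))"
    by (simp add: ap_delw_Cons add_ac)
  also have "\<dots> = sh v (\<lambda>a b. f c * \<psi> a b + q * ap (delw f a) (\<lambda>u. \<psi> (c # u) b + q ^ length u * \<psi> u (c # b)))"
  proof (rule sh_cong)
    fix a b :: "'a list"
    show "f c * \<psi> a b + (q * ap (delw f a) (\<lambda>u. \<psi> (c # u) b) + q ^ length a * ap (delw f a) (\<lambda>a'. \<psi> a' (c # b)))
      = f c * \<psi> a b + q * ap (delw f a) (\<lambda>u. \<psi> (c # u) b + q ^ length u * \<psi> u (c # b))"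
    proof (cases a)
      case (Cons y w)
      have "ap (delw f a) (\<lambda>u. q ^ length u * \<psi> u (c # b)) = ap (delw f a) (\<lambda>u. q ^ length w * \<psi> u (c # b))"
        by (rule ap_cong_hdeg[OF hdeg_delw]) (simp add: Cons)
      then show ?thesis using Cons by (simp add: ap_fun_add ap_fun_scale algebra_simps)
    qed simp
  qed
  also have "\<dots> = ap (delw f (c # v)) (\<lambda>v'. sh v' \<psi>)"
    by (simp add: sh_add sh_scale Cons.IH ap_delw_Cons)
  finally show ?case .
qed simp

lemma sh_Nil_left: "sh v (\<lambda>a b. if a = [] then \<psi> b else 0) = \<psi> v"
proof (induction v arbitrary: \<psi>)
  case (Cons c v)
  have "sh (c # v) (\<lambda>a b. if a = [] then \<psi> b else 0) = sh v (\<lambda>a b. if a = [] then \<psi> (c # b) else 0)"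
    by (auto intro!: sh_cong)
  also have "\<dots> = \<psi> (c # v)" by (rule Cons.IH)
  finally show ?case .
qed simp

text \<open>By \<open>sh_delw\<close>, contracting the left leg with the whole word \<open>F\<close>
  amounts to applying its derivations one after the other.\<close>

lemma sh_phi_left: "sh v (\<lambda>a b. phi F a * \<psi> b) = ap (DF F (wrd v)) \<psi>"
proof -
  have "ap p (\<lambda>v. sh v (\<lambda>a b. phi F a * \<psi> b)) = ap (DF F p) \<psi>" for p
  proof (induction F arbitrary: p)
    case Nil
    have "sh v (\<lambda>a b. phi [] a * \<psi> b) = sh v (\<lambda>a b. if a = [] then \<psi> b else 0)" for v
      by (auto intro!: sh_cong simp: phi_Nil)
    then show ?case by (simp only: sh_Nil_left DF.simps)
  next
    case (Cons f F)
    have "sh v (\<lambda>a b. phi (f # F) a * \<psi> b) = ap (delw f v) (\<lambda>v'. sh v' (\<lambda>a b. phi F a * \<psi> b))" for v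
      by (simp add: sh_delw[symmetric] phi_Cons mult.commute[of _ "\<psi> _"] ap_fun_scale)
    then have "ap p (\<lambda>v. sh v (\<lambda>a b. phi (f # F) a * \<psi> b)) = ap (D f p) (\<lambda>v'. sh v' (\<lambda>a b. phi F a * \<psi> b))"
      by (simp only: D_def ap_bind)
    also have "\<dots> = ap (DF (f # F) p) \<psi>" by (simp only: Cons.IH DF.simps)
    finally show ?case .
  qed
  from this[of "wrd v"] show ?thesis by simp
qed

lemma sh_phi: "sh v (\<lambda>a b. phi F a * phi H b) = phi (F @ H) v"
  unfolding sh_phi_left ap_phi by (simp add: phi_def DF_append)

lemma sh_rev: "sh (rev v) \<psi> = sh v (\<lambda>a b. \<psi> (rev b) (rev a))"
  by (induction v arbitrary: \<psi>) (simp_all add: sh_snoc add.commute)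

text \<open>Reversing both words preserves inversions. This symmetry makes the radical stable under
  the antipode, which reverses words.\<close>

lemma phi_rev: "phi (rev F) (rev w) = phi F w"
proof (induction F arbitrary: w)
  case (Cons f F)
  have 1: "phi [f] (rev a) = phi [f] a" for a
  proof (cases "length a = 1")
    case True
    then obtain x where "a = [x]" by (auto simp: length_Suc_conv)
    then show ?thesis by simp
  next
    case False
    then show ?thesis by (simp add: phi_length)
  qed
  have "phi (rev (f # F)) (rev w) = sh w (\<lambda>a b. phi (rev F) (rev b) * phi [f] (rev a))"
    by (simp add: sh_phi[symmetric] sh_rev)
  also have "\<dots> = sh w (\<lambda>a b. phi [f] a * phi F b)"
    by (simp add: Cons.IH 1 mult.commute)
  also have "\<dots> = phi (f # F) w" by (simp add: sh_phi)
  finally show ?case .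
qed (simp add: phi_Nil)

section \<open>The radical\<close>

text \<open>In the application the letters are the vectors of \<open>V\<close> and \<open>L\<close>
  is the set of linear forms.\<close>

definition rad :: "('l \<Rightarrow> 'k) set \<Rightarrow> ('l, 'k) falg set" where
  "rad L = {p. \<forall>F. set F \<subseteq> L \<longrightarrow> ap p (phi F) = 0}"

lemma rad_0: "0 \<in> rad L" by (simp add: rad_def)
lemma rad_add: "p \<in> rad L \<Longrightarrow> r \<in> rad L \<Longrightarrow> p + r \<in> rad L" by (simp add: rad_def ap_add)
lemma rad_sc: "p \<in> rad L \<Longrightarrow> sc c p \<in> rad L" by (simp add: rad_def ap_sc)
lemma rad_D: "p \<in> rad L \<Longrightarrow> f \<in> L \<Longrightarrow> D f p \<in> rad L"
  by (auto simp: rad_def ap_phi_Cons[symmetric])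

inductive_set dops :: "('l \<Rightarrow> 'k) set \<Rightarrow> (('l, 'k) falg \<Rightarrow> ('l, 'k) falg) set"
  for L :: "('l \<Rightarrow> 'k) set" where
  dops_id: "(\<lambda>p. p) \<in> dops L"
| dops_D: "\<Omega> \<in> dops L \<Longrightarrow> f \<in> L \<Longrightarrow> (\<lambda>p. D f (\<Omega> p)) \<in> dops L"

lemma dops_linear:
  assumes "\<Omega> \<in> dops L"
  shows dops_0: "\<Omega> 0 = 0" and dops_add: "\<Omega> (p + r) = \<Omega> p + \<Omega> r"
    and dops_sc: "\<Omega> (sc c p) = sc c (\<Omega> p)" and dops_rad: "p \<in> rad L \<Longrightarrow> \<Omega> p \<in> rad L"
  using assms by (induction rule: dops.induct) (auto simp: D_add D_sc rad_D)

lemma dops_diff: "\<Omega> \<in> dops L \<Longrightarrow> \<Omega> (p - r) = \<Omega> p - \<Omega> r"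
  using dops_add[of \<Omega> L p "sc (-1) r"] dops_sc[of \<Omega> L "-1" r] by (simp add: sc_minus_left)

lemma dops_comp: "\<Omega> \<in> dops L \<Longrightarrow> \<Theta> \<in> dops L \<Longrightarrow> (\<lambda>p. \<Omega> (\<Theta> p)) \<in> dops L"
  by (induction rule: dops.induct) (auto intro: dops.intros)

lemma dops_funpow: "\<Omega> \<in> dops L \<Longrightarrow> (\<lambda>p. (\<Omega> ^^ n) p) \<in> dops L"
proof (induction n)
  case 0
  then show ?case using dops_id by (simp add: id_def)
next
  case (Suc n)
  then show ?case using dops_comp[of \<Omega> L "\<Omega> ^^ n"] by (simp add: o_def)
qed

primrec subprod :: "(nat \<Rightarrow> ('l, 'k) falg) \<Rightarrow> nat \<Rightarrow> bool list \<Rightarrow> ('l, 'k) falg" where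
  "subprod r k [] = 1"
| "subprod r k (b # bs) = (if b then r k * subprod r (Suc k) bs else subprod r (Suc k) bs)"

text \<open>The coefficients are indexed by bit lists and not by the products themselves, so
  coincidences among the subproducts are excluded as well.\<close>

definition rich :: "('l \<Rightarrow> 'k) set \<Rightarrow> (nat \<Rightarrow> ('l, 'k) falg) \<Rightarrow> bool" where
  "rich L r \<longleftrightarrow> (\<forall>n c. (\<Sum>bs | length bs = n. sc (c bs) (subprod r 0 bs)) \<in> rad L
     \<longrightarrow> (\<forall>bs. length bs = n \<longrightarrow> c bs = 0))"

text \<open>Closure under left multiplication suffices, since \<open>subprod\<close> is built up
  from its right end.\<close>

inductive_set tail_span :: "(nat \<Rightarrow> ('l, 'k) falg) \<Rightarrow> nat \<Rightarrow> ('l, 'k) falg set"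
  for r :: "nat \<Rightarrow> ('l, 'k) falg" and k :: nat where
  tail_span_1: "1 \<in> tail_span r k"
| tail_span_add: "u \<in> tail_span r k \<Longrightarrow> v \<in> tail_span r k \<Longrightarrow> u + v \<in> tail_span r k"
| tail_span_sc: "u \<in> tail_span r k \<Longrightarrow> sc c u \<in> tail_span r k"
| tail_span_mult: "u \<in> tail_span r k \<Longrightarrow> n \<ge> k \<Longrightarrow> r n * u \<in> tail_span r k"

lemma tail_span_mono: "u \<in> tail_span r k \<Longrightarrow> j \<le> k \<Longrightarrow> u \<in> tail_span r j"
  by (induction rule: tail_span.induct) (auto intro: tail_span.intros)

lemma tail_span_0: "0 \<in> tail_span r k"
  using tail_span_sc[OF tail_span_1, of 0] by simp

lemma subprod_tail_span: "j \<le> k \<Longrightarrow> subprod r k bs \<in> tail_span r j"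
  by (induction bs arbitrary: k) (auto intro: tail_span.intros)

lemma sum_bool_lists:
  fixes g :: "bool list \<Rightarrow> 'a::comm_monoid_add"
  shows "(\<Sum>bs | length bs = Suc n. g bs)
    = (\<Sum>bs | length bs = n. g (True # bs)) + (\<Sum>bs | length bs = n. g (False # bs))"
proof -
  have fin: "finite {bs :: bool list. length bs = n}"
    using finite_lists_length_eq[of "UNIV :: bool set" n] by simp
  have "{bs :: bool list. length bs = Suc n} = Cons True ` {bs. length bs = n} \<union> Cons False ` {bs. length bs = n}"
    by (auto simp: length_Suc_conv)
  then have "(\<Sum>bs | length bs = Suc n. g bs) = sum g (Cons True ` {bs. length bs = n}) + sum g (Cons False ` {bs. length bs = n})"
    by (simp, subst sum.union_disjoint) (auto simp: fin)
  then show ?thesis by (simp add: sum.reindex)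
qed

text \<open>Triangularity: applied to a combination in the radical, \<open>\<Omega> k\<close> kills
  the subproducts without \<open>r k\<close> and strips \<open>r k\<close> from the others. Their
  coefficients vanish by induction on the number of factors, and then a shorter combination is
  left.\<close>

lemma richI:
  assumes \<Omega>: "\<And>m. \<Omega> m \<in> dops L"
    and kill: "\<And>m v. v \<in> tail_span r (Suc m) \<Longrightarrow> \<Omega> m v = 0"
    and lead: "\<And>m. c m \<noteq> 0" "\<And>m v. v \<in> tail_span r (Suc m) \<Longrightarrow> \<Omega> m (r m * v) = sc (c m) v"
  shows "rich L r"
proof -
  have "(\<Sum>bs | length bs = n. sc (d bs) (subprod r k bs)) \<in> rad L \<Longrightarrow> length bs = n \<Longrightarrow> d bs = 0" for n k d bs
  proof (induction n arbitrary: k d bs)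
    case 0
    then have "sc (d []) 1 \<in> rad L" by simp
    then have "d [] = 0" by (auto simp: rad_def ap_sc phi_Nil dest: spec[of _ "[]"])
    then show ?case using 0 by simp
  next
    case (Suc n)
    let ?S = "\<lambda>b. \<Sum>bs | length bs = n. sc (d (b # bs)) (subprod r (Suc k) bs)"
    have sum_tail_span: "(\<Sum>bs | length bs = n. sc (e bs) (subprod r (Suc k) bs)) \<in> tail_span r (Suc k)" for e
      by (rule falg_sum_induct) (auto intro: tail_span.intros tail_span_0 subprod_tail_span)
    have eq: "(\<Sum>bs | length bs = Suc n. sc (d bs) (subprod r k bs)) = r k * ?S True + ?S False"
      by (simp add: sum_bool_lists sum_distrib_left)
    have "\<Omega> k (r k * ?S True + ?S False) \<in> rad L"
      using Suc.prems(1) dops_rad[OF \<Omega>] by (simp only: eq)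
    then have "sc (c k) (?S True) \<in> rad L"
      by (simp add: dops_add[OF \<Omega>] kill[OF sum_tail_span] lead(2)[OF sum_tail_span])
    then have "sc (inverse (c k)) (sc (c k) (?S True)) \<in> rad L" by (rule rad_sc)
    then have "?S True \<in> rad L" using lead(1)[of k] by simp
    then have T: "d (True # bs) = 0" if "length bs = n" for bs
      using Suc.IH[of "\<lambda>bs. d (True # bs)" "Suc k"] that by blast
    then have "?S True = 0" by simp
    then have "?S False \<in> rad L" using Suc.prems(1) by (simp add: eq)
    then have "d (False # bs) = 0" if "length bs = n" for bs
      using Suc.IH[of "\<lambda>bs. d (False # bs)" "Suc k"] that by blast
    then show ?case using T Suc.prems(2) by (cases bs) (auto, metis (full_types))
  qed
  then show ?thesis unfolding rich_def by blast
qed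

text \<open>Here \<open>\<Omega> m\<close> is \<open>\<delta>\<close> after \<open>m\<close> steps
  of \<open>E\<close>. A step lowers one index by one, so the only way to get from
  \<open>r m * v\<close>, with all indices in \<open>v\<close> above \<open>m\<close>, to
  \<open>r 0\<close> in \<open>m\<close> steps is to spend them all on \<open>r m\<close>; this
  yields the product of the factors \<kappa>.\<close>

lemma rich_chain:
  assumes E: "E \<in> dops L" and \<delta>: "\<delta> \<in> dops L"
    and F1: "1 \<in> F" and F_add: "\<And>u v. u \<in> F \<Longrightarrow> v \<in> F \<Longrightarrow> u + v \<in> F"
    and F_sc: "\<And>u c. u \<in> F \<Longrightarrow> sc c u \<in> F" and F_mult: "\<And>u n. u \<in> F \<Longrightarrow> r (Suc n) * u \<in> F"
    and E1: "E 1 = 0"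
    and E_mult: "\<And>u n. u \<in> F \<Longrightarrow> E (r (Suc n) * u) = sc (\<kappa> n) (r n * u) + sc (\<eta> n) (r (Suc n) * E u)"
    and \<delta>_F: "\<And>u. u \<in> F \<Longrightarrow> \<delta> u = 0"
    and \<delta>_lead: "\<And>u. u \<in> F \<Longrightarrow> \<delta> (r 0 * u) = sc cz u"
    and nz: "cz \<noteq> 0" "\<And>n. \<kappa> n \<noteq> 0"
  shows "rich L r"
proof -
  have tail_span_F: "u \<in> tail_span r (Suc 0) \<Longrightarrow> u \<in> F" for u
  proof (induction rule: tail_span.induct)
    case (tail_span_mult u n)
    then show ?case using F_mult[of u "n - 1"] by simp
  qed (auto intro: F1 F_add F_sc)
  have E_tail_span: "u \<in> tail_span r (Suc k) \<Longrightarrow> E u \<in> tail_span r k" for u k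
  proof (induction rule: tail_span.induct)
    case (tail_span_mult u n)
    then obtain m where m: "n = Suc m" "m \<ge> k" by (cases n) auto
    have "u \<in> F" using tail_span_mult tail_span_mono tail_span_F by (metis Suc_le_mono le0)
    then show ?case using tail_span_mult m tail_span_mono[of u r "Suc k" k]
      by (auto simp: E_mult intro!: tail_span.intros)
  qed (auto simp: E1 tail_span_0 dops_add[OF E] dops_sc[OF E] intro: tail_span.intros)
  have E_pow: "u \<in> tail_span r (k + j) \<Longrightarrow> (E ^^ j) u \<in> tail_span r k" for u k j
    by (induction j arbitrary: k) (auto intro: E_tail_span simp: add_Suc[symmetric] simp del: add_Suc)
  let ?\<Omega> = "\<lambda>m p. \<delta> ((E ^^ m) p)"
  let ?c = "\<lambda>m. (\<Prod>i<m. \<kappa> i) * cz"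
  have kill: "?\<Omega> m v = 0" if "v \<in> tail_span r (Suc m)" for m v
    using E_pow[of v "Suc 0" m] that by (simp add: tail_span_F \<delta>_F)
  \<comment> \<open>\<open>X\<close> collects the terms in which some step was spent on
    \<open>v\<close>. All their factors keep an index above \<open>m - j\<close>, so for
    \<open>j = m\<close> they are killed by \<delta>.\<close>
  have lead: "\<exists>X\<in>tail_span r (Suc (m - j)). (E ^^ j) (r m * v) = sc (\<Prod>i\<in>{m-j..<m}. \<kappa> i) (r (m - j) * v) + X"
    if "v \<in> tail_span r (Suc m)" "j \<le> m" for m j v
    using that(2)
  proof (induction j)
    case 0
    then show ?case using tail_span_0 by auto
  next
    case (Suc j)
    then obtain X where X: "X \<in> tail_span r (Suc (m - j))"
      "(E ^^ j) (r m * v) = sc (\<Prod>i\<in>{m-j..<m}. \<kappa> i) (r (m - j) * v) + X" by auto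
    have mj: "m - j = Suc (m - Suc j)" using Suc.prems by simp
    have vF: "v \<in> F" using that(1) tail_span_mono tail_span_F by (metis Suc_le_mono le0)
    have EX: "E X \<in> tail_span r (m - j)" using X(1) by (rule E_tail_span)
    have Ev: "E v \<in> tail_span r (m - j)" using E_tail_span[OF that(1)] tail_span_mono by (metis diff_le_self)
    let ?c = "\<Prod>i\<in>{m-j..<m}. \<kappa> i"
    have cc: "?c * \<kappa> (m - Suc j) = (\<Prod>i\<in>{m - Suc j..<m}. \<kappa> i)"
    proof -
      have "{m - Suc j..<m} = insert (m - Suc j) {m-j..<m}" using Suc.prems by auto
      then show ?thesis using mj by (simp add: mult.commute)
    qed
    have "(E ^^ Suc j) (r m * v) = E (sc ?c (r (Suc (m - Suc j)) * v) + X)"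
      using X(2) mj by simp
    also have "\<dots> = sc (\<Prod>i\<in>{m - Suc j..<m}. \<kappa> i) (r (m - Suc j) * v)
        + (sc (?c * \<eta> (m - Suc j)) (r (m - j) * E v) + E X)"
      unfolding dops_add[OF E] dops_sc[OF E] E_mult[OF vF] using cc mj by (simp add: sc_add add.assoc)
    finally show ?case
      using EX Ev by (intro bexI[of _ "sc (?c * \<eta> (m - Suc j)) (r (m - j) * E v) + E X"])
        (auto simp: mj intro!: tail_span.intros)
  qed
  show ?thesis
  proof (rule richI[where \<Omega> = ?\<Omega> and c = ?c])
    fix m show "?\<Omega> m \<in> dops L" by (rule dops_comp[OF \<delta> dops_funpow[OF E]])
    show "?c m \<noteq> 0" using nz by simp
  next
    fix m v assume v: "v \<in> tail_span r (Suc m)"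
    show "?\<Omega> m v = 0" by (rule kill[OF v])
    obtain X where X: "X \<in> tail_span r (Suc 0)" "(E ^^ m) (r m * v) = sc (\<Prod>i\<in>{0..<m}. \<kappa> i) (r 0 * v) + X"
      using lead[OF v order_refl] by auto
    have vF: "v \<in> F" using v tail_span_mono tail_span_F by (metis Suc_le_mono le0)
    show "?\<Omega> m (r m * v) = sc (?c m) v"
      using X vF by (simp add: dops_add[OF \<delta>] dops_sc[OF \<delta>] \<delta>_F tail_span_F \<delta>_lead atLeast0LessThan)
  qed
qed

lemma subprod_hdeg:
  assumes "\<And>i. \<exists>d\<le>l * Suc i. hdeg d (r i)"
  shows "\<exists>d\<le>l * (k + length bs) * length bs. hdeg d (subprod r k bs)"
proof (induction bs arbitrary: k)
  case Nil
  then show ?case using hdeg_wrd[of "[]"] by (simp add: wrd_Nil)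
next
  case (Cons b bs)
  obtain d where d: "d \<le> l * (Suc k + length bs) * length bs" "hdeg d (subprod r (Suc k) bs)"
    using Cons.IH by blast
  obtain e where e: "e \<le> l * Suc k" "hdeg e (r k)" using assms by blast
  have "l * Suc k \<le> l * (Suc k + length bs)" by simp
  then have "e + d \<le> l * (k + length (b # bs)) * length (b # bs)" using d(1) e(1)
    by (simp add: algebra_simps)
  moreover have "hdeg (e + d) (r k * subprod r (Suc k) bs)" using d e by (intro hdeg_mult)
  ultimately show ?case using d
    by (cases b) (auto intro: exI[of _ "e + d"], metis add_leE)
qed

section \<open>Elements with exponentially many independent subproducts\<close>

text \<open>The \<open>q\<close>-integer \<open>[n]_q\<close>.\<close>

definition qi :: "nat \<Rightarrow> 'k" where
  "qi n = (\<Sum>i<n. q ^ i)"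

lemma qi_0 [simp]: "qi 0 = 0" by (simp add: qi_def)
lemma qi_Suc: "qi (Suc n) = 1 + q * qi n"
  unfolding qi_def by (subst sum.lessThan_Suc_shift) (simp add: sum_distrib_left)

lemma qi_geometric: "(1 - q) * qi n = 1 - q ^ n"
proof (induction n)
  case (Suc n)
  have "(1 - q) * qi (Suc n) = (1 - q) + q * ((1 - q) * qi n)" by (simp add: qi_Suc algebra_simps)
  then show ?case by (simp only: Suc) (simp add: algebra_simps)
qed simp

lemma qi_nz: "q ^ n \<noteq> 1 \<Longrightarrow> qi n \<noteq> 0"
  using qi_geometric[of n] by auto

text \<open>The factor by which \<open>Dx\<close> takes \<open>z n\<close> to
  \<open>z (n - 1)\<close>. If \<open>q\<close> has order \<open>N > 1\<close>, its first zero with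
  \<open>n \<ge> 1\<close> is \<open>n = N - 1\<close>.\<close>

definition lam :: "nat \<Rightarrow> 'k" where
  "lam n = qi n * (1 - q ^ Suc n)"

text \<open>The recursion that the Leibniz rule produces in \<open>Dx_z\<close>; the closed form
  \<open>lam\<close> is its solution.\<close>

lemma lam_Suc: "lam (Suc n) = 1 - q ^ (2 * Suc n) + q * lam n"
proof -
  have "lam (Suc n) - (1 - q ^ (2 * Suc n) + q * lam n) = q ^ (n + 2) * ((1 - q) * qi n - (1 - q ^ n))"
    by (simp add: lam_def qi_Suc algebra_simps power_add power_mult power2_eq_square)
  then show ?thesis by (simp add: qi_geometric)
qed

definition Lam :: "nat \<Rightarrow> 'k" where
  "Lam n = (\<Prod>i<n. lam (Suc i))"

lemma Lam_0 [simp]: "Lam 0 = 1" by (simp add: Lam_def)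
lemma Lam_Suc: "Lam (Suc n) = lam (Suc n) * Lam n" by (simp add: Lam_def mult.commute)

lemma Lam_nz:
  assumes "\<And>i. 0 < i \<Longrightarrow> i \<le> Suc n \<Longrightarrow> q ^ i \<noteq> 1"
  shows "Lam n \<noteq> 0"
proof -
  have "lam i \<noteq> 0" if "0 < i" "i \<le> n" for i
    using assms[of i] assms[of "Suc i"] that qi_nz[of i] by (simp add: lam_def)
  then show ?thesis by (simp add: Lam_def)
qed

lemma sc_eqI: "c = d \<Longrightarrow> sc c p = sc d p" by simp

end

section \<open>Two letters with dual forms: the elements \<open>z i\<close> and the operators that
  detect them\<close>

locale two_letters = skew q for q :: "'k::field" +
  fixes x y :: 'l and fx fy :: "'l \<Rightarrow> 'k" and L :: "('l \<Rightarrow> 'k) set"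
  assumes fL: "fx \<in> L" "fy \<in> L"
    and dual: "fx x = 1" "fx y = 0" "fy x = 0" "fy y = 1"
begin

abbreviation "X \<equiv> wrd [x] :: ('l, 'k) falg"
abbreviation "Y \<equiv> wrd [y] :: ('l, 'k) falg"
abbreviation "Dx \<equiv> D fx"
abbreviation "Dy \<equiv> D fy"

lemma hdeg_X: "hdeg 1 X" and hdeg_Y: "hdeg 1 Y"
  using hdeg_wrd[of "[x]"] hdeg_wrd[of "[y]"] by simp_all

lemma D_XY [simp]: "Dx X = 1" "Dx Y = 0" "Dy X = 0" "Dy Y = 1"
  by (simp_all add: D_letter dual)

fun z :: "nat \<Rightarrow> ('l, 'k) falg" where
  "z 0 = Y"
| "z (Suc i) = X * z i - sc (q ^ Suc i) (z i * X)"

lemma hdeg_z: "hdeg (Suc i) (z i)"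
proof (induction i)
  case (Suc i)
  show ?case using hdeg_mult[OF hdeg_X Suc] hdeg_mult[OF Suc hdeg_X]
    by (auto intro!: hdeg_diff hdeg_sc)
qed (use hdeg_Y in simp)

lemma Dx_Xmult: "Dx (X * p) = p + sc q (X * Dx p)"
  by (simp add: D_mult_hdeg[OF hdeg_X])

lemma Dy_Xmult: "Dy (X * p) = sc q (X * Dy p)"
  by (simp add: D_mult_hdeg[OF hdeg_X])

lemma Dx_z: "Dx (z (Suc i)) = sc (lam (Suc i)) (z i)"
proof (induction i)
  case 0
  show ?case
    by (simp add: D_diff D_sc Dx_Xmult D_mult_hdeg[OF hdeg_Y, simplified] sc_diff_left lam_def qi_Suc power2_eq_square)
next
  case (Suc i)
  let ?l = "lam (Suc i)"
  \<comment> \<open>Once \<open>X * z i\<close> is eliminated, the two multiples of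
    \<open>z i * X\<close> cancel; the exponents in the definition of \<open>z\<close> are made for
    this.\<close>
  have X: "X * z i = z (Suc i) + sc (q ^ Suc i) (z i * X)" by simp
  have "Dx (z (Suc (Suc i))) = z (Suc i) + sc (q * ?l) (X * z i)
      - sc (q ^ (i + 2)) (sc ?l (z i * X) + sc (q ^ (i + 2)) (z (Suc i)))"
    using D_mult_hdeg[OF hdeg_z[of "Suc i"], of fx X]
    by (simp add: D_diff D_sc Dx_Xmult Suc del: z.simps(2)) (simp add: z.simps(2)[of "Suc i"] D_diff D_sc Dx_Xmult Suc del: z.simps)
  also have "\<dots> = z (Suc i) + sc (q * ?l) (z (Suc i)) + sc (q * ?l * q ^ Suc i) (z i * X)
      - sc (q ^ (i + 2) * ?l) (z i * X) - sc (q ^ (i + 2) * q ^ (i + 2)) (z (Suc i))"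
    unfolding X sc_add sc_sc by (simp add: algebra_simps del: z.simps)
  also have "\<dots> = z (Suc i) + sc (q * ?l) (z (Suc i)) - sc (q ^ (i + 2) * q ^ (i + 2)) (z (Suc i))"
    by (simp add: mult_ac del: z.simps)
  also have "\<dots> = sc (1 + q * ?l - q ^ (i + 2) * q ^ (i + 2)) (z (Suc i))"
    by (simp only: sc_diff_left sc_add_left sc_1)
  also have "\<dots> = sc (lam (Suc (Suc i))) (z (Suc i))"
    by (rule sc_eqI) (subst lam_Suc, simp add: power_add[symmetric] mult_2)
  finally show ?case .
qed

lemma Dy_z: "Dy (z (Suc i)) = 0"
proof (induction i)
  case 0
  show ?case using D_mult_hdeg[OF hdeg_Y, of fy X] by (simp add: D_diff D_sc Dy_Xmult)
next
  case (Suc i)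
  show ?case
    using D_mult_hdeg[OF hdeg_z[of "Suc i"], of fy X] Suc
    by (simp add: z.simps(2)[of "Suc i"] D_diff D_sc Dy_Xmult del: z.simps)
qed

text \<open>\<open>Dy\<close> after \<open>k\<close> applications of \<open>Dx\<close>. By
  \<open>Dn_z\<close> these operators are dual to the \<open>z i\<close> up to the scalars
  \<open>Lam k\<close>.\<close>

primrec Dn :: "nat \<Rightarrow> ('l, 'k) falg \<Rightarrow> ('l, 'k) falg" where
  "Dn 0 u = Dy u"
| "Dn (Suc k) u = Dn k (Dx u)"

lemma Dn_add: "Dn k (u + v) = Dn k u + Dn k v" by (induction k arbitrary: u v) (simp_all add: D_add)
lemma Dn_sc: "Dn k (sc c u) = sc c (Dn k u)" by (induction k arbitrary: u) (simp_all add: D_sc)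
lemma Dn_diff: "Dn k (u - v) = Dn k u - Dn k v" by (induction k arbitrary: u v) (simp_all add: D_diff)
lemma Dn_0 [simp]: "Dn k 0 = 0" by (induction k) simp_all
lemma Dn_1 [simp]: "Dn k 1 = 0" by (cases k) simp_all

lemma Dn_dops: "Dn k \<in> dops L"
proof -
  have "(\<lambda>p. D f p) \<in> dops L" if "f \<in> L" for f using dops_D[OF dops_id that] by simp
  then have D: "D f \<in> dops L" if "f \<in> L" for f using that by metis
  show ?thesis
  proof (induction k)
    case 0
    have "Dn 0 = Dy" by (rule ext) simp
    then show ?case using D fL by simp
  next
    case (Suc k)
    have "Dn (Suc k) = (\<lambda>p. Dn k (Dx p))" by (rule ext) simp
    then show ?case using dops_comp[OF Suc D[OF fL(1)]] by simp
  qed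
qed

lemma Dn_z: "Dn k (z i) = (if i = k then sc (Lam k) 1 else 0)"
proof (induction k arbitrary: i)
  case 0
  then show ?case by (cases i) (simp_all add: Dy_z del: z.simps(2))
next
  case (Suc k)
  then show ?case by (cases i) (simp_all add: Dx_z Dn_sc Lam_Suc del: z.simps(2))
qed

definition Fil :: "nat \<Rightarrow> ('l, 'k) falg set" where
  "Fil k = {u. \<forall>i<k. Dn i u = 0}"

lemma FilD: "u \<in> Fil k \<Longrightarrow> i < k \<Longrightarrow> Dn i u = 0" by (simp add: Fil_def)
lemma Fil_0 [simp]: "u \<in> Fil 0" by (simp add: Fil_def)
lemma Fil_zero [simp]: "0 \<in> Fil k" by (simp add: Fil_def)
lemma Fil_1 [simp]: "1 \<in> Fil k" by (simp add: Fil_def)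
lemma Fil_add: "u \<in> Fil k \<Longrightarrow> v \<in> Fil k \<Longrightarrow> u + v \<in> Fil k" by (simp add: Fil_def Dn_add)
lemma Fil_diff: "u \<in> Fil k \<Longrightarrow> v \<in> Fil k \<Longrightarrow> u - v \<in> Fil k" by (simp add: Fil_def Dn_diff)
lemma Fil_sc: "u \<in> Fil k \<Longrightarrow> sc c u \<in> Fil k" by (simp add: Fil_def Dn_sc)
lemma Fil_mono: "u \<in> Fil k \<Longrightarrow> j \<le> k \<Longrightarrow> u \<in> Fil j" by (simp add: Fil_def)
lemma Fil_Dx: "u \<in> Fil (Suc k) \<Longrightarrow> Dx u \<in> Fil k" by (auto simp: Fil_def dest: spec[of _ "Suc _"])
lemma Fil_z: "k \<le> i \<Longrightarrow> z i \<in> Fil k" by (simp add: Fil_def Dn_z del: z.simps)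
lemma Fil_Suc: "u \<in> Fil (Suc k) \<longleftrightarrow> u \<in> Fil k \<and> Dn k u = 0" by (auto simp: Fil_def less_Suc_eq)

text \<open>Every mixed term contains some \<open>Dn i u\<close> or \<open>Dn i v\<close> with
  \<open>i < k\<close> and vanishes. Hence all \<open>k + 1\<close> derivations act on the same
  factor, and each pays \<open>q ^ n\<close> for passing \<open>u\<close>.\<close>

lemma Dn_mult:
  "hdeg n u \<Longrightarrow> u \<in> Fil k \<Longrightarrow> v \<in> Fil k \<Longrightarrow> Dn k (u * v) = Dn k u * v + sc (q ^ (Suc k * n)) (u * Dn k v)"
proof (induction k arbitrary: u v n)
  case 0
  then show ?case by (simp add: D_mult_hdeg)
next
  case (Suc k)
  have 1: "Dn k (Dx u * v) = Dn k (Dx u) * v"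
    using Suc.IH[OF hdeg_D[OF Suc.prems(1)] Fil_Dx[OF Suc.prems(2)] Fil_mono[OF Suc.prems(3)]] FilD[OF Suc.prems(3)]
    by simp
  have 2: "Dn k (u * Dx v) = sc (q ^ (Suc k * n)) (u * Dn k (Dx v))"
    using Suc.IH[OF Suc.prems(1) Fil_mono[OF Suc.prems(2)] Fil_Dx[OF Suc.prems(3)]] FilD[OF Suc.prems(2)]
    by simp
  show ?case using Suc.prems(1) by (simp add: D_mult_hdeg Dn_add Dn_sc 1 2 power_add)
qed

lemma Fil_mult: "hdeg n u \<Longrightarrow> u \<in> Fil k \<Longrightarrow> v \<in> Fil k \<Longrightarrow> u * v \<in> Fil k"
proof (induction k)
  case (Suc k)
  then show ?case using Dn_mult[of n u k v] by (simp add: Fil_Suc)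
qed simp

text \<open>\<open>z k\<close> misses \<open>Fil (Suc k)\<close> by one step: one \<open>Dx\<close>
  may act on \<open>u\<close> while the remaining \<open>k + 1\<close> derivations reduce
  \<open>z k\<close> to \<open>Lam k\<close>. The \<open>k + 1\<close> choices of this
  \<open>Dx\<close> add up to the \<open>q\<close>-integer.\<close>

lemma Dn_mult_z:
  "hdeg n u \<Longrightarrow> u \<in> Fil (Suc k) \<Longrightarrow>
    Dn (Suc k) (u * z k) = Dn (Suc k) u * z k + sc (Lam k * q ^ (Suc k * (n - 1)) * qi (Suc k)) (Dx u)"
proof (induction k)
  case 0
  have "hdeg (n - 1) (Dx u)" using 0 by (intro hdeg_D)
  then show ?case using 0 by (simp add: D_mult_hdeg qi_Suc)
next
  case (Suc k)
  let ?u = "Dx u"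
  \<comment> \<open>For \<open>n = 0\<close> the exponent \<open>n - 1\<close> is truncated; this is
    harmless because \<open>Dx\<close> kills constants.\<close>
  have n: "n \<noteq> 0 \<or> ?u = 0"
  proof (cases "n = 0")
    case True
    have "?u = 0"
    proof (rule poly_mapping_eqI)
      fix m
      have "u = (\<Sum>m\<in>Poly_Mapping.keys u. sc (Poly_Mapping.lookup u m) (wrd (letters m)))" by (rule falg_expand)
      also have "Dx \<dots> = 0" using Suc.prems(1) True by (simp add: D_sum D_sc hdeg_def wrd_Nil)
      finally show "Poly_Mapping.lookup ?u m = Poly_Mapping.lookup 0 m" by simp
    qed
    then show ?thesis by simp
  qed simp
  have 1: "Dn (Suc k) (?u * z (Suc k)) = Dn (Suc k) ?u * z (Suc k)
      + sc (Lam (Suc k) * q ^ (Suc (Suc k) * (n - 1))) ?u"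
    using Dn_mult[OF hdeg_D[OF Suc.prems(1)] Fil_Dx[OF Suc.prems(2)] Fil_z[OF order_refl]]
    by (simp add: Dn_z mult.commute del: z.simps Dn.simps)
  have 2: "Dn (Suc k) (u * z k) = sc (Lam k * q ^ (Suc k * (n - 1)) * qi (Suc k)) ?u"
    using Suc.IH[OF Suc.prems(1) Fil_mono[OF Suc.prems(2)]] FilD[OF Suc.prems(2), of "Suc k"] by simp
  have "Dn (Suc (Suc k)) (u * z (Suc k)) = Dn (Suc k) (?u * z (Suc k) + sc (q ^ n) (u * Dx (z (Suc k))))"
    using Suc.prems(1) by (simp add: D_mult_hdeg del: z.simps)
  also have "\<dots> = Dn (Suc k) (?u * z (Suc k)) + sc (q ^ n * lam (Suc k)) (Dn (Suc k) (u * z k))"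
    by (simp add: Dx_z Dn_add Dn_sc del: z.simps Dn.simps)
  also have "\<dots> = Dn (Suc (Suc k)) u * z (Suc k)
     + (sc (Lam (Suc k) * q ^ (Suc (Suc k) * (n - 1))) ?u
       + sc (q ^ n * lam (Suc k) * (Lam k * q ^ (Suc k * (n - 1)) * qi (Suc k))) ?u)"
    unfolding 1 2 by (simp add: add.assoc del: z.simps)
  also have "sc (Lam (Suc k) * q ^ (Suc (Suc k) * (n - 1))) ?u
       + sc (q ^ n * lam (Suc k) * (Lam k * q ^ (Suc k * (n - 1)) * qi (Suc k))) ?u
      = sc (Lam (Suc k) * q ^ (Suc (Suc k) * (n - 1)) * qi (Suc (Suc k))) ?u"
    using n by (cases n) (auto simp: sc_add_left[symmetric] Lam_Suc qi_Suc[of "Suc k"] algebra_simps power_add intro!: sc_eqI)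
  finally show ?case .
qed

text \<open>The mirror image, with the element outside \<open>Fil (Suc k)\<close> on the
  left.\<close>

lemma Dn_z_mult:
  "u \<in> Fil (Suc k) \<Longrightarrow>
    Dn (Suc k) (z k * u) = sc (q ^ (Suc (Suc k) * Suc k)) (z k * Dn (Suc k) u) + sc (Lam k * q * qi (Suc k)) (Dx u)"
proof (induction k)
  case 0
  then show ?case
    by (simp add: D_mult_hdeg[OF hdeg_Y] D_sc D_add sc_add qi_Suc power2_eq_square)
next
  case (Suc k)
  let ?u = "Dx u"
  have 1: "Dn (Suc k) (z (Suc k) * ?u) = sc (Lam (Suc k)) ?u + sc (q ^ (Suc (Suc k) * Suc (Suc k))) (z (Suc k) * Dn (Suc k) ?u)"
    using Dn_mult[OF hdeg_z Fil_z[OF order_refl] Fil_Dx[OF Suc.prems]]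
    by (simp add: Dn_z del: z.simps Dn.simps mult_Suc)
  have 2: "Dn (Suc k) (z k * u) = sc (Lam k * q * qi (Suc k)) ?u"
    using Suc.IH[OF Fil_mono[OF Suc.prems]] FilD[OF Suc.prems, of "Suc k"] by simp
  have "Dn (Suc (Suc k)) (z (Suc k) * u) = Dn (Suc k) (Dx (z (Suc k)) * u + sc (q ^ Suc (Suc k)) (z (Suc k) * ?u))"
    by (simp add: D_mult_hdeg[OF hdeg_z] del: z.simps)
  also have "\<dots> = sc (lam (Suc k)) (Dn (Suc k) (z k * u)) + sc (q ^ Suc (Suc k)) (Dn (Suc k) (z (Suc k) * ?u))"
    by (simp add: Dx_z Dn_add Dn_sc del: z.simps Dn.simps)
  also have "\<dots> = sc (lam (Suc k) * (Lam k * q * qi (Suc k))) ?u + sc (q ^ Suc (Suc k) * Lam (Suc k)) ?u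
      + sc (q ^ Suc (Suc k) * q ^ (Suc (Suc k) * Suc (Suc k))) (z (Suc k) * Dn (Suc (Suc k)) u)"
    unfolding 1 2 by (simp add: sc_add add.assoc del: z.simps)
  also have "q ^ Suc (Suc k) * q ^ (Suc (Suc k) * Suc (Suc k)) = q ^ (Suc (Suc (Suc k)) * Suc (Suc k))"
    by (simp add: power_add[symmetric])
  also have "sc (lam (Suc k) * (Lam k * q * qi (Suc k))) ?u + sc (q ^ Suc (Suc k) * Lam (Suc k)) ?u
     = sc (Lam (Suc k) * q * qi (Suc (Suc k))) ?u"
  proof -
    have "qi (Suc (Suc k)) = qi (Suc k) + q ^ Suc k" by (simp add: qi_def)
    then show ?thesis by (simp add: sc_add_left[symmetric] Lam_Suc algebra_simps)
  qed
  finally show ?case by (simp add: add.commute del: z.simps Dn.simps)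
qed

lemma rich_z:
  assumes "\<And>i. i > 0 \<Longrightarrow> q ^ i \<noteq> 1"
  shows "rich L z"
proof -
  have nz: "Lam m \<noteq> 0" for m using assms by (intro Lam_nz) auto
  have tail_span_Fil: "v \<in> tail_span z (Suc m) \<Longrightarrow> v \<in> Fil (Suc m)" for v m
  proof (induction rule: tail_span.induct)
    case (tail_span_mult u n)
    then show ?case by (intro Fil_mult[OF hdeg_z] Fil_z) auto
  qed (auto intro: Fil_add Fil_sc)
  show ?thesis
  proof (rule richI[where \<Omega> = Dn and c = Lam])
    fix m v assume v: "v \<in> tail_span z (Suc m)"
    show "Dn m v = 0" using tail_span_Fil[OF v] by (simp add: Fil_def)
    then show "Dn m (z m * v) = sc (Lam m) v"
      using Dn_mult[OF hdeg_z Fil_z[OF order_refl] Fil_mono[OF tail_span_Fil[OF v]], of m] by (simp add: Dn_z)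
  qed (simp_all add: nz Dn_dops)
qed

text \<open>The exponent is the product of the degrees \<open>b + 2\<close> and
  \<open>b + 1\<close>; with it the two contributions of \<open>Dn b\<close> cancel, which puts the
  commutator one step deeper in the filtration.\<close>

definition z_bracket :: "nat \<Rightarrow> ('l, 'k) falg" where
  "z_bracket b = z (Suc b) * z b - sc (q ^ (Suc (Suc b) * Suc b)) (z b * z (Suc b))"

text \<open>Read off from \<open>Dn_mult_z\<close> and \<open>Dn_z_mult\<close>. That it is nonzero
  has to be shown separately for even and odd order.\<close>

definition kap :: "nat \<Rightarrow> 'k" where
  "kap b = lam (Suc b) * Lam b * (1 + q ^ (Suc b * Suc b) * qi (Suc b) - q ^ (2 * (Suc (Suc b) * Suc b))
      - q ^ (Suc (Suc b) * Suc b + 1) * qi (Suc b))"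

lemma hdeg_z_bracket: "hdeg (2 * b + 3) (z_bracket b)"
  unfolding z_bracket_def by (intro hdeg_diff hdeg_sc hdeg_mult'[OF hdeg_z hdeg_z]) simp_all

lemma Fil_z_bracket: "z_bracket b \<in> Fil (Suc b)"
proof -
  have "z (Suc b) * z b \<in> Fil b" "z b * z (Suc b) \<in> Fil b"
    by (rule Fil_mult[OF hdeg_z Fil_z Fil_z]; simp)+
  then have 1: "z_bracket b \<in> Fil b" unfolding z_bracket_def by (intro Fil_diff Fil_sc)
  have "Dn b (z (Suc b) * z b) = sc (q ^ (Suc b * Suc (Suc b)) * Lam b) (z (Suc b))"
    using Dn_mult[OF hdeg_z[of "Suc b"] Fil_z Fil_z, of b b] by (simp add: Dn_z del: z.simps mult_Suc)
  moreover have "Dn b (z b * z (Suc b)) = sc (Lam b) (z (Suc b))"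
    using Dn_mult[OF hdeg_z[of b] Fil_z Fil_z, of b "Suc b"] by (simp add: Dn_z del: z.simps mult_Suc)
  ultimately have "Dn b (z_bracket b) = 0"
    unfolding z_bracket_def Dn_diff Dn_sc by (simp add: mult.commute[of "Suc (Suc b)" "Suc b"] del: z.simps mult_Suc mult_Suc_right power_Suc)
  with 1 show ?thesis by (simp add: Fil_Suc)
qed

lemma Dn_z_bracket: "Dn (Suc b) (z_bracket b) = sc (kap b) (z b)"
proof -
  have 1: "Dn (Suc b) (z (Suc b) * z b) =
      sc (Lam (Suc b)) (z b) + sc (Lam b * q ^ (Suc b * Suc b) * qi (Suc b) * lam (Suc b)) (z b)"
    using Dn_mult_z[OF hdeg_z Fil_z[OF order_refl], of b]
    by (simp add: Dn_z Dx_z del: z.simps mult_Suc Dn.simps)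
  have 2: "Dn (Suc b) (z b * z (Suc b)) =
      sc (q ^ (Suc (Suc b) * Suc b) * Lam (Suc b)) (z b) + sc (Lam b * q * qi (Suc b) * lam (Suc b)) (z b)"
    using Dn_z_mult[OF Fil_z[OF order_refl], of b]
    by (simp add: Dn_z Dx_z del: z.simps mult_Suc Dn.simps)
  show ?thesis
    unfolding z_bracket_def Dn_diff Dn_sc 1 2 sc_add sc_sc sc_add_left[symmetric] sc_diff_left[symmetric]
    by (rule sc_eqI) (simp add: kap_def Lam_Suc algebra_simps power_add power_mult power2_eq_square mult_2 del: mult_Suc,
        (simp add: eval_nat_numeral)?)
qed

lemma hdeg_Dn: "hdeg n u \<Longrightarrow> hdeg (n - Suc k) (Dn k u)"
proof (induction k arbitrary: n u)
  case 0
  then show ?case using hdeg_D by simp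
next
  case (Suc k)
  then show ?case using Suc.IH[OF hdeg_D[OF Suc.prems]] by simp
qed

section \<open>Roots of unity of even order\<close>

primrec evenR :: "nat \<Rightarrow> nat \<Rightarrow> ('l, 'k) falg" where
  "evenR b 0 = z b"
| "evenR b (Suc n) = z (Suc b) * evenR b n
     - sc (q ^ (Suc (Suc b) * (Suc (Suc b) * n + Suc b))) (evenR b n * z (Suc b))"

lemma hdeg_evenR: "hdeg (Suc (Suc b) * n + Suc b) (evenR b n)"
proof (induction n)
  case (Suc n)
  show ?case unfolding evenR.simps
    by (intro hdeg_diff hdeg_sc hdeg_mult'[OF hdeg_z Suc] hdeg_mult'[OF Suc hdeg_z]) simp_all
qed (use hdeg_z in simp)

text \<open>As \<open>q ^ (b + 2) = -1\<close>, the operator \<open>Dn (b + 1)\<close> passes an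
  element of degree \<open>n\<close> at the price \<open>(-1) ^ n\<close>. Since
  \<open>z (b + 1)\<close> has degree \<open>b + 2\<close>, the coefficients of the iterated
  commutators are signs too, and \<open>Dn (b + 1)\<close> takes each commutator to a multiple of
  the preceding one.\<close>

lemma rich_evenR:
  assumes p: "q ^ Suc (Suc b) = -1" and ord: "\<And>i. 0 < i \<Longrightarrow> i < 2 * Suc (Suc b) \<Longrightarrow> q ^ i \<noteq> 1"
  shows "rich L (evenR b)"
proof -
  let ?a = "Suc b" and ?p = "Suc (Suc b)"
  have Lam: "Lam b \<noteq> 0" using ord by (intro Lam_nz) auto
  have m1: "(-1 :: 'k) \<noteq> 1" using p ord[of ?p] by simp
  then have two: "(2 :: 'k) \<noteq> 0" by (metis add_neg_numeral_special(8) add_right_cancel one_add_one add.commute add.right_neutral ab_group_add_class.ab_left_minus)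
  have q0: "q \<noteq> 0" using p by auto
  have sq: "q ^ (2 * (?p * n)) = 1" for n
  proof -
    have "q ^ (2 * (?p * n)) = (q ^ ?p) ^ (2 * n)" by (simp only: power_mult[symmetric] mult.left_commute)
    then show ?thesis by (simp add: p power_mult del: power_Suc)
  qed
  have kap: "kap b \<noteq> 0"
  proof -
    \<comment> \<open>\<open>(a + 1) a + 1 = a^2 + p\<close>. Because of \<open>q ^ p = -1\<close>
      the two terms of \<open>kap\<close> with a \<open>q\<close>-integer add up instead of
      cancelling, whence the factor 2; the two others cancel.\<close>
    have "q ^ (?p * ?a + 1) = q ^ (?a * ?a) * q ^ ?p"
      by (subst power_add[symmetric], rule arg_cong[where f = "\<lambda>n. q ^ n"]) simp
    then have "kap b = lam ?a * Lam b * (2 * q ^ (?a * ?a) * qi ?a)"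
      unfolding kap_def sq p by (simp add: algebra_simps)
    moreover have "lam ?a \<noteq> 0" "qi ?a \<noteq> 0" using ord[of ?a] ord[of ?p] qi_nz[of ?a] by (simp_all add: lam_def)
    ultimately show ?thesis using Lam two q0 by simp
  qed
  have main: "evenR b (Suc n) \<in> Fil ?a \<and> Dn ?a (evenR b (Suc n)) = sc (kap b * q ^ (n * (?p * ?p))) (evenR b n)" for n
  proof (induction n)
    case 0
    have "evenR b (Suc 0) = z_bracket b" by (simp add: z_bracket_def del: z.simps mult_Suc)
    then show ?case using Fil_z_bracket[of b] Dn_z_bracket[of b] by (simp del: Dn.simps evenR.simps(2))
  next
    case (Suc n)
    let ?r = "evenR b (Suc n)" and ?L = "?p * Suc n + ?a"
    have zF: "z ?a \<in> Fil ?a" by (rule Fil_z) simp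
    note rF = Suc[THEN conjunct1] and rD = Suc[THEN conjunct2]
    have e: "evenR b (Suc (Suc n)) = z ?a * ?r - sc (q ^ (?p * ?L)) (?r * z ?a)" by (rule evenR.simps(2))
    have F: "evenR b (Suc (Suc n)) \<in> Fil ?a"
      unfolding e by (intro Fil_diff Fil_sc Fil_mult[OF hdeg_z zF rF] Fil_mult[OF hdeg_evenR rF zF])
    let ?k = "kap b * q ^ (n * (?p * ?p))"
    have 1: "Dn ?a (z ?a * ?r) = sc (Lam ?a) ?r + sc (q ^ (?p * ?p) * ?k) (z ?a * evenR b n)"
      using Dn_mult[OF hdeg_z zF rF] by (simp add: Dn_z rD del: z.simps mult_Suc Dn.simps evenR.simps)
    have 2: "Dn ?a (?r * z ?a) = sc ?k (evenR b n * z ?a) + sc (q ^ (?p * ?L) * Lam ?a) ?r"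
      using Dn_mult[OF hdeg_evenR rF zF] by (simp add: Dn_z rD del: z.simps mult_Suc Dn.simps evenR.simps)
    \<comment> \<open>The terms in which \<open>Dn (b + 1)\<close> is spent on
      \<open>z (b + 1)\<close> have the coefficients \<open>Lam (b + 1)\<close> and
      \<open>q ^ (2 p L) * Lam (b + 1)\<close>, so they drop out of the commutator.\<close>
    have c: "q ^ (?p * ?L) * (q ^ (?p * ?L) * Lam ?a) = Lam ?a"
    proof -
      have "q ^ (?p * ?L) * q ^ (?p * ?L) = 1" using sq[of ?L] by (simp only: mult_2 power_add)
      then show ?thesis by (simp only: mult.assoc[symmetric] mult_1_left)
    qed
    have c2: "q ^ (?p * ?L) = q ^ (?p * ?p) * q ^ (?p * (?p * n + ?a))"
      by (simp add: power_add[symmetric] algebra_simps)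
    have "Dn ?a (evenR b (Suc (Suc n))) = sc (q ^ (?p * ?p) * ?k) (z ?a * evenR b n)
        - sc (q ^ (?p * ?L) * ?k) (evenR b n * z ?a)"
      unfolding e Dn_diff Dn_sc 1 2 sc_add sc_sc c by (simp add: algebra_simps del: z.simps mult_Suc evenR.simps)
    also have "\<dots> = sc (q ^ (?p * ?p) * ?k) ?r"
      unfolding c2 evenR.simps(2)[of b n] sc_diff sc_sc by (simp add: mult_ac del: z.simps mult_Suc)
    also have "q ^ (?p * ?p) * ?k = kap b * q ^ (Suc n * (?p * ?p))"
      by (simp add: power_add mult_ac)
    finally show ?case using F by simp
  qed
  show ?thesis
  proof (rule rich_chain[where E = "Dn ?a" and \<delta> = "Dn b" and F = "Fil ?a"
        and \<kappa> = "\<lambda>n. kap b * q ^ (n * (?p * ?p))" and \<eta> = "\<lambda>n. q ^ (?p * (?p * Suc n + ?a))" and cz = "Lam b"])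
    fix u n assume u: "u \<in> Fil ?a"
    show "evenR b (Suc n) * u \<in> Fil ?a" by (rule Fil_mult[OF hdeg_evenR _ u]) (use main in blast)
    show "Dn ?a (evenR b (Suc n) * u) = sc (kap b * q ^ (n * (?p * ?p))) (evenR b n * u)
      + sc (q ^ (?p * (?p * Suc n + ?a))) (evenR b (Suc n) * Dn ?a u)"
      using Dn_mult[OF hdeg_evenR _ u, of b "Suc n"] main[of n] by (simp del: Dn.simps evenR.simps mult_Suc)
    show "Dn b u = 0" using u by (simp add: Fil_def)
    then show "Dn b (evenR b 0 * u) = sc (Lam b) u"
      using Dn_mult[OF hdeg_z Fil_z[OF order_refl] Fil_mono[OF u], of b] by (simp add: Dn_z)
  qed (use Fil_add Fil_sc Lam kap q0 in \<open>simp_all add: Dn_dops del: Dn.simps\<close>)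
qed

section \<open>Ordinary commutators: odd order, and order three with a third letter\<close>

primrec commR :: "('l, 'k) falg \<Rightarrow> ('l, 'k) falg \<Rightarrow> nat \<Rightarrow> ('l, 'k) falg" where
  "commR t r 0 = r"
| "commR t r (Suc n) = t * commR t r n - commR t r n * t"

lemma hdeg_commR: "hdeg N t \<Longrightarrow> hdeg d r \<Longrightarrow> hdeg (N * n + d) (commR t r n)"
proof (induction n)
  case (Suc n)
  show ?case unfolding commR.simps
    by (intro hdeg_diff hdeg_mult'[OF Suc.prems(1) Suc.IH[OF Suc.prems]] hdeg_mult'[OF Suc.IH[OF Suc.prems] Suc.prems(1)])
      simp_all
qed simp

text \<open>On \<open>F\<close> the operator \<open>E\<close> is a derivation and \<open>E t\<close>
  is a scalar, so \<open>E\<close> takes the commutator of \<open>t\<close> with \<open>r\<close> to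
  the commutator of \<open>t\<close> with \<open>E r\<close>. The relation \<open>base\<close>
  therefore propagates along the whole chain with the same constant \<kappa>.\<close>

lemma rich_commR:
  assumes E: "E \<in> dops L" and \<delta>: "\<delta> \<in> dops L"
    and t: "hdeg N t" "t \<in> F" "E t = sc \<tau> 1" and r: "hdeg d r"
    and F: "1 \<in> F" "\<And>u v. u \<in> F \<Longrightarrow> v \<in> F \<Longrightarrow> u + v \<in> F" "\<And>u c. u \<in> F \<Longrightarrow> sc c u \<in> F"
      "\<And>u v n. hdeg n u \<Longrightarrow> u \<in> F \<Longrightarrow> v \<in> F \<Longrightarrow> u * v \<in> F"
    and E1: "E 1 = 0" and E_mult: "\<And>u v n. hdeg n u \<Longrightarrow> u \<in> F \<Longrightarrow> v \<in> F \<Longrightarrow> E (u * v) = E u * v + u * E v"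
    and base: "t * r - r * t \<in> F" "E (t * r - r * t) = sc \<kappa> r"
    and \<delta>_F: "\<And>u. u \<in> F \<Longrightarrow> \<delta> u = 0"
    and \<delta>_lead: "\<And>u. u \<in> F \<Longrightarrow> \<delta> (r * u) = sc cz u"
    and nz: "cz \<noteq> 0" "\<kappa> \<noteq> 0"
  shows "rich L (commR t r)"
proof -
  have F_diff: "u - v \<in> F" if "u \<in> F" "v \<in> F" for u v
    using F(2)[OF that(1) F(3)[OF that(2), of "-1"]] by (simp add: sc_minus_left)
  note hd = hdeg_commR[OF t(1) r]
  have main: "commR t r (Suc n) \<in> F \<and> E (commR t r (Suc n)) = sc \<kappa> (commR t r n)" for n
  proof (induction n)
    case 0
    then show ?case using base by simp
  next
    case (Suc n)
    let ?r = "commR t r (Suc n)"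
    note rF = Suc[THEN conjunct1] and rE = Suc[THEN conjunct2]
    have e: "commR t r (Suc (Suc n)) = t * ?r - ?r * t" by (rule commR.simps(2))
    have "E (commR t r (Suc (Suc n))) = sc \<kappa> (t * commR t r n - commR t r n * t)"
      unfolding e dops_diff[OF E] E_mult[OF t(1,2) rF] E_mult[OF hd rF t(2)] rE t(3)
      by (simp add: sc_diff del: commR.simps)
    moreover have "commR t r (Suc (Suc n)) \<in> F"
      unfolding e by (intro F_diff F(4)[OF t(1,2) rF] F(4)[OF hd rF t(2)])
    ultimately show ?case by simp
  qed
  show ?thesis
  proof (rule rich_chain[where E = E and \<delta> = \<delta> and F = F and \<kappa> = "\<lambda>_. \<kappa>" and \<eta> = "\<lambda>_. 1" and cz = cz])
    fix u n assume u: "u \<in> F"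
    show "commR t r (Suc n) * u \<in> F" using main F(4)[OF hd _ u] by blast
    show "E (commR t r (Suc n) * u) = sc \<kappa> (commR t r n * u) + sc 1 (commR t r (Suc n) * E u)"
      using E_mult[OF hd _ u, of "Suc n"] main[of n] by (simp del: commR.simps)
  qed (use assms in simp_all)
qed

text \<open>\<open>z_bracket b\<close> has degree \<open>N = 2 b + 3\<close>, and \<open>E\<close>
  is composed of \<open>N\<close> derivations, so its twists are powers of \<open>q ^ N = 1\<close>.
  The work lies in the two constants \<open>kap b\<close> and \<open>?B\<close>.\<close>

lemma rich_odd:
  assumes N: "q ^ (2 * b + 3) = 1" and b: "b > 0"
    and ord: "\<And>i. 0 < i \<Longrightarrow> i < 2 * b + 3 \<Longrightarrow> q ^ i \<noteq> 1"
  shows "rich L (commR (z_bracket b) (z b))"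
proof -
  let ?a = "Suc b" and ?N = "2 * b + 3"
  \<comment> \<open>With \<open>a = b + 1\<close> and \<open>N = 2 a + 1\<close> one has
    \<open>2 a = -1\<close> modulo \<open>N\<close>, hence \<open>4 a^2 = 1\<close>. So \<sigma> is
    a fourth root of \<open>q\<close> among the powers of \<open>q\<close>, and the exponents below
    turn into small powers of \<sigma>.\<close>
  define \<sigma> where "\<sigma> = q ^ (?a * ?a)"
  have Nk: "q ^ (?N * n) = 1" "q ^ (n * ?N) = 1" for n
    using N by (simp_all only: power_mult power_one mult.commute[of _ ?N])
  have red: "q ^ m = q ^ n" if "m = n + ?N * k" for m n k
    unfolding that power_add Nk by simp
  have \<sigma>4: "\<sigma> ^ 4 = q"
  proof -
    have "q ^ (?a * ?a * 4) = q ^ 1" by (rule red[of "?a * ?a * 4" 1 "2 * b + 1"]) (simp add: algebra_simps)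
    then show ?thesis by (simp add: \<sigma>_def power_mult del: mult_Suc)
  qed
  have qa: "q ^ ?a * \<sigma>\<^sup>2 = 1"
  proof -
    have "q ^ (?a + ?a * ?a * 2) = q ^ 0" by (rule red[of "?a + ?a * ?a * 2" 0 ?a]) (simp add: algebra_simps)
    then show ?thesis by (simp only: \<sigma>_def power_mult power_add power_0)
  qed
  have \<sigma>0: "\<sigma> \<noteq> 0" using qa by auto
  then have qa': "q ^ ?a = inverse (\<sigma>\<^sup>2)" using qa by (simp add: field_simps)
  have e1: "q ^ (Suc ?a * ?a) = inverse \<sigma>"
  proof -
    have e: "q ^ (Suc ?a * ?a) = \<sigma> * q ^ ?a"
      unfolding \<sigma>_def power_add[symmetric] by (rule arg_cong[where f = "\<lambda>n. q ^ n"]) simp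
    show ?thesis unfolding e qa' using \<sigma>0 by (simp add: field_simps power2_eq_square)
  qed
  have e2: "q ^ (?a * (?N - 1)) = \<sigma>\<^sup>2"
  proof -
    have "?a * (?N - 1) = ?a * ?a * 2" by (simp add: algebra_simps)
    then show ?thesis by (simp only: \<sigma>_def power_mult)
  qed
  have e3: "q ^ (Suc ?a * ?a + 1) = \<sigma> ^ 3"
    using e1 \<sigma>4 \<sigma>0 by (simp only: power_add) (simp add: field_simps eval_nat_numeral)
  have \<sigma>2: "\<sigma>\<^sup>2 \<noteq> 1" using \<sigma>4 ord[of 1] by (auto simp: power2_eq_square eval_nat_numeral)
  \<comment> \<open>A primitive cube root \<sigma> would satisfy
    \<open>\<sigma> = \<sigma> ^ 4 = q\<close>, thus \<open>q ^ 3 = 1\<close>; \<open>b > 0\<close>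
    excludes exactly this.\<close>
  have \<sigma>3: "1 + \<sigma> + \<sigma>\<^sup>2 \<noteq> 0"
  proof
    assume "1 + \<sigma> + \<sigma>\<^sup>2 = 0"
    then have "(\<sigma> - 1) * (1 + \<sigma> + \<sigma>\<^sup>2) = 0" by simp
    then have "\<sigma> ^ 3 = 1" by (simp add: algebra_simps power2_eq_square power3_eq_cube)
    moreover have "\<sigma> ^ 4 = \<sigma> ^ 3 * \<sigma>" by (simp add: eval_nat_numeral)
    ultimately have "q ^ 3 = 1" using \<sigma>4 by simp
    then show False using ord[of 3] b by simp
  qed
  have q1: "1 - \<sigma> ^ 4 \<noteq> 0" using ord[of 1] \<sigma>4 by auto
  have qia: "(1 - \<sigma> ^ 4) * qi ?a = 1 - inverse (\<sigma>\<^sup>2)" using qi_geometric[of ?a] \<sigma>4 qa' by simp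
  have Lam: "Lam b \<noteq> 0" using ord by (intro Lam_nz) auto
  have lam: "lam ?a \<noteq> 0" using ord[of ?a] ord[of "Suc ?a"] b qi_nz[of ?a] by (simp add: lam_def)
  have kap: "kap b \<noteq> 0"
  proof -
    let ?K = "1 + \<sigma> * qi ?a - (inverse \<sigma>)\<^sup>2 - \<sigma> ^ 3 * qi ?a"
    have "kap b = lam ?a * Lam b * ?K"
      unfolding kap_def e3 \<sigma>_def[symmetric] using e1 by (simp only: mult.commute[of 2] power_mult)
    \<comment> \<open>The factor \<open>1 - \<sigma> ^ 4 = 1 - q\<close> clears the
      \<open>q\<close>-integer by \<open>qi_geometric\<close>. The same is done for
      \<open>?B\<close>.\<close>
    moreover have "(1 - \<sigma> ^ 4) * ?K = (1 - \<sigma> ^ 4) * (1 - (inverse \<sigma>)\<^sup>2) + (\<sigma> - \<sigma> ^ 3) * ((1 - \<sigma> ^ 4) * qi ?a)"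
      by (simp add: algebra_simps)
    moreover have "\<dots> = (1 - inverse (\<sigma>\<^sup>2)) * (1 - \<sigma>\<^sup>2) * (1 + \<sigma> + \<sigma>\<^sup>2)"
      unfolding qia using \<sigma>0 by (simp add: field_simps eval_nat_numeral)
    moreover have "(1 - inverse (\<sigma>\<^sup>2)) * (1 - \<sigma>\<^sup>2) * (1 + \<sigma> + \<sigma>\<^sup>2) \<noteq> 0"
    proof -
      have "inverse (\<sigma>\<^sup>2) \<noteq> 1" using \<sigma>2 by (metis inverse_inverse_eq inverse_1)
      then show ?thesis using \<sigma>2 \<sigma>3 by simp
    qed
    ultimately show ?thesis using Lam lam by auto
  qed
  \<comment> \<open>The coefficient of \<open>z b\<close> in \<open>E\<close> of the first
    commutator, up to the factor \<open>kap b * Lam b\<close>; see \<open>baseE\<close>.\<close>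
  let ?B = "(1 - q ^ (Suc ?a * ?a)) * (1 + \<sigma>) + qi ?a * (q ^ (?a * (?N - 1)) - q)"
  have B: "?B \<noteq> 0"
  proof -
    have "(1 - \<sigma> ^ 4) * ?B = (1 - \<sigma> ^ 4) * ((1 - inverse \<sigma>) * (1 + \<sigma>)) + ((1 - \<sigma> ^ 4) * qi ?a) * (\<sigma>\<^sup>2 - \<sigma> ^ 4)"
      unfolding e1 e2 \<sigma>4 by (simp add: algebra_simps)
    also have "\<dots> = - inverse \<sigma> * (1 - \<sigma>\<^sup>2) * (1 - \<sigma>\<^sup>2) * (1 + \<sigma> + \<sigma>\<^sup>2)"
      unfolding qia using \<sigma>0 by (simp add: field_simps eval_nat_numeral)
    finally show ?thesis using \<sigma>0 \<sigma>2 \<sigma>3 by auto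
  qed
  \<comment> \<open>Membership in \<open>F\<close> supplies the hypotheses of \<open>Dn_mult\<close>
    first for \<open>Dn (b + 1)\<close> and then for \<open>Dn b\<close>.\<close>
  define F where "F = {u \<in> Fil ?a. Dn ?a u \<in> Fil b}"
  define E where "E = (\<lambda>u. Dn b (Dn ?a u))"
  have E_dops: "E \<in> dops L" unfolding E_def by (rule dops_comp[OF Dn_dops Dn_dops])
  have F_mult: "u * v \<in> F \<and> E (u * v) = E u * v + u * E v" if u: "hdeg n u" "u \<in> F" and v: "v \<in> F" for u v n
  proof -
    have uF: "u \<in> Fil ?a" "Dn ?a u \<in> Fil b" "u \<in> Fil b" "Dn b u = 0"
      and vF: "v \<in> Fil ?a" "Dn ?a v \<in> Fil b" "v \<in> Fil b" "Dn b v = 0"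
      using u v by (auto simp: F_def Fil_Suc)
    have e: "Dn ?a (u * v) = Dn ?a u * v + sc (q ^ (Suc ?a * n)) (u * Dn ?a v)"
      by (rule Dn_mult[OF u(1) uF(1) vF(1)])
    have h: "hdeg (n - Suc ?a) (Dn ?a u)" by (rule hdeg_Dn[OF u(1)])
    have "Dn ?a (u * v) \<in> Fil b" unfolding e
      by (intro Fil_add Fil_sc Fil_mult[OF h uF(2) vF(3)] Fil_mult[OF u(1) uF(3) vF(2)])
    moreover have "E (u * v) = E u * v + sc (q ^ (Suc ?a * n) * q ^ (Suc b * n)) (u * E v)"
      unfolding E_def e Dn_add Dn_sc Dn_mult[OF h uF(2) vF(3)] Dn_mult[OF u(1) uF(3) vF(2)]
      by (simp add: uF(4) vF(4) del: Dn.simps mult_Suc)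
    moreover have "q ^ (Suc ?a * n) * q ^ (Suc b * n) = 1"
    proof -
      have "Suc ?a * n + Suc b * n = ?N * n" by (simp add: algebra_simps)
      then show ?thesis by (simp only: power_add[symmetric] Nk)
    qed
    ultimately show ?thesis using Fil_mult[OF u(1) uF(1) vF(1)] by (simp add: F_def)
  qed
  have tF: "z_bracket b \<in> F" using Fil_z_bracket by (simp add: F_def Dn_z_bracket Fil_sc Fil_z del: Dn.simps)
  let ?t = "z_bracket b" and ?z = "z b"
  have zF: "?z \<in> Fil b" by (simp add: Fil_z)
  have tb: "?t \<in> Fil b" "Dn b ?t = 0" using Fil_z_bracket[of b] by (simp_all add: Fil_Suc)
  have Dbz: "Dn b ?z = sc (Lam b) 1" by (simp add: Dn_z)
  have b1: "?t * ?z \<in> Fil b" "?z * ?t \<in> Fil b"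
    by (intro Fil_mult[OF hdeg_z_bracket] Fil_mult[OF hdeg_z] tb zF)+
  have b2: "Dn b (?t * ?z) = sc (Lam b) ?t"
    unfolding Dn_mult[OF hdeg_z_bracket tb(1) zF] Nk by (simp add: tb Dbz)
  have b3: "Dn b (?z * ?t) = sc (Lam b) ?t"
    unfolding Dn_mult[OF hdeg_z zF tb(1)] by (simp add: tb Dbz)
  have base_Fil: "?t * ?z - ?z * ?t \<in> Fil ?a"
    using b1 b2 b3 by (simp add: Fil_Suc Fil_diff Dn_diff)
  have d1: "Dn ?a (?t * ?z) = sc (kap b) (?z * ?z) + sc (Lam b * q ^ (?a * (?N - 1)) * qi ?a) (Dx ?t)"
    unfolding Dn_mult_z[OF hdeg_z_bracket Fil_z_bracket] Dn_z_bracket by simp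
  have d2: "Dn ?a (?z * ?t) = sc (q ^ (Suc ?a * ?a) * kap b) (?z * ?z) + sc (Lam b * q * qi ?a) (Dx ?t)"
    unfolding Dn_z_mult[OF Fil_z_bracket] Dn_z_bracket by simp
  have d3: "Dn ?a (?t * ?z - ?z * ?t) = sc (kap b * (1 - q ^ (Suc ?a * ?a))) (?z * ?z)
      + sc (Lam b * qi ?a * (q ^ (?a * (?N - 1)) - q)) (Dx ?t)"
    unfolding Dn_diff d1 d2 right_diff_distrib sc_diff_left by (simp add: algebra_simps del: mult_Suc)
  have zz: "?z * ?z \<in> Fil b" by (rule Fil_mult[OF hdeg_z zF zF])
  have Dt: "Dx ?t \<in> Fil b" by (rule Fil_Dx[OF Fil_z_bracket])
  have Dzz: "Dn b (?z * ?z) = sc (Lam b * (1 + \<sigma>)) ?z"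
    unfolding Dn_mult[OF hdeg_z zF zF] \<sigma>_def by (simp add: Dbz distrib_left sc_add_left mult.commute)
  have DDt: "Dn b (Dx ?t) = sc (kap b) ?z" using Dn_z_bracket[of b] by simp
  have baseE: "E (?t * ?z - ?z * ?t) = sc (kap b * Lam b * ?B) ?z"
    unfolding E_def d3 Dn_add Dn_sc Dzz DDt sc_sc sc_add_left[symmetric]
    by (rule sc_eqI) (simp add: algebra_simps del: mult_Suc)
  show ?thesis
  proof (rule rich_commR[where E = E and \<delta> = "Dn b" and F = F and N = ?N and \<tau> = "kap b * Lam b" and d = ?a
        and \<kappa> = "kap b * Lam b * ?B" and cz = "Lam b"])
    show "?t * ?z - ?z * ?t \<in> F"
      using base_Fil unfolding F_def d3 by (auto intro!: Fil_add Fil_sc zz Dt simp del: Dn.simps simp: d3)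
    show "E ?t = sc (kap b * Lam b) 1" by (simp add: E_def Dn_z_bracket Dn_sc Dbz del: Dn.simps)
    show "kap b * Lam b * ?B \<noteq> 0" using kap Lam B by simp
    show "E (?t * ?z - ?z * ?t) = sc (kap b * Lam b * ?B) ?z" by (rule baseE)
    show "E \<in> dops L" by (rule E_dops)
  next
    fix u v :: "('l, 'k) falg" and n assume "hdeg n u" "u \<in> F" "v \<in> F"
    then show "u * v \<in> F" "E (u * v) = E u * v + u * E v" using F_mult by blast+
  next
    fix u assume u: "u \<in> F"
    show "Dn b u = 0" using u by (auto simp: F_def Fil_Suc)
    then show "Dn b (?z * u) = sc (Lam b) u"
      using Dn_mult[OF hdeg_z zF, of u] u by (simp add: Dbz F_def Fil_mono[of u ?a b])
  qed (use tF Lam in \<open>auto simp: Dn_dops hdeg_z_bracket hdeg_z F_def E_def Dn_add Dn_sc intro: Fil_add Fil_sc simp del: Dn.simps(2)\<close>)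
qed

text \<open>\<open>E\<close> takes one derivation for each of \<open>x\<close>, \<open>w\<close>,
  \<open>y\<close>; each pays \<open>q ^ n\<close> for passing degree \<open>n\<close>, together
  \<open>q ^ (3 n) = 1\<close>. The coefficients in \<open>u\<close> and \<open>t\<close> are such
  that of the three derivations only \<open>Dx\<close> does not kill \<open>t\<close>, which puts
  \<open>t\<close> into \<open>F\<close>.\<close>

lemma rich_cubic:
  assumes q3: "q ^ 3 = 1" "q \<noteq> 1"
    and w: "fw \<in> L" "fw w = 1" "fw x = 0" "fw y = 0" "fx w = 0" "fy w = 0"
  defines "W \<equiv> wrd [w]"
  defines "u \<equiv> X * W - sc q (W * X)"
  shows "rich L (commR (u * Y - sc (q\<^sup>2) (Y * u)) Y)"
proof -
  let ?Dw = "D fw"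
  have hW: "hdeg 1 W" using hdeg_wrd[of "[w]"] by (simp add: W_def)
  have DW [simp]: "Dx W = 0" "Dy W = 0" "?Dw W = 1" "?Dw X = 0" "?Dw Y = 0"
    by (simp_all add: W_def D_letter w)
  note lm = D_mult_hdeg[OF hdeg_X] D_mult_hdeg[OF hdeg_Y] D_mult_hdeg[OF hW]
  have q3': "q * (q * q) = 1" "\<And>c. q * (q * (q * c)) = c"
    using q3(1) by (simp_all add: power3_eq_cube mult.assoc[symmetric])
  have q2: "q\<^sup>2 \<noteq> 1" "1 + q \<noteq> 0"
  proof -
    show 2: "q\<^sup>2 \<noteq> 1" using q3' q3(2) by (auto simp: power2_eq_square)
    show "1 + q \<noteq> 0"
    proof
      assume "1 + q = 0"
      then have "(1 + q) * (q - 1) = 0" by simp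
      then show False using 2 by (simp add: algebra_simps power2_eq_square)
    qed
  qed
  define t where "t = u * Y - sc (q\<^sup>2) (Y * u)"
  define \<alpha> where "\<alpha> = (1 - q\<^sup>2) * (1 - q)"
  have t: "t = X * (W * Y) - sc q (W * (X * Y)) - sc (q * q) (Y * (X * W)) + Y * (W * X)"
    by (simp add: t_def u_def algebra_simps sc_diff power2_eq_square q3')
  have hu: "hdeg 2 u" unfolding u_def
    using hdeg_mult[OF hdeg_X hW] hdeg_mult[OF hW hdeg_X] by (auto intro!: hdeg_diff hdeg_sc simp: numeral_2_eq_2)
  have ht: "hdeg 3 t" unfolding t_def
    using hdeg_mult[OF hu hdeg_Y] hdeg_mult[OF hdeg_Y hu] by (auto intro!: hdeg_diff hdeg_sc simp: numeral_3_eq_3)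
  have Dxt: "Dx t = sc (1 - q\<^sup>2) (W * Y - Y * W)"
    unfolding t by (simp add: D_add D_diff D_sc lm sc_add sc_diff sc_diff_left power2_eq_square q3' algebra_simps)
  have Dyt: "Dy t = 0"
    unfolding t by (simp add: D_add D_diff D_sc lm sc_add sc_diff sc_diff_left q3' algebra_simps)
  have Dwt: "?Dw t = 0"
    unfolding t by (simp add: D_add D_diff D_sc lm sc_add sc_diff sc_diff_left q3' algebra_simps)
  have DwDxt: "?Dw (Dx t) = sc \<alpha> Y"
    unfolding Dxt D_sc D_diff lm by (simp add: \<alpha>_def sc_diff sc_diff_left sc_add_left algebra_simps power2_eq_square)
  define F where "F = {v :: ('l, 'k) falg. Dy v = 0 \<and> ?Dw v = 0}"
  define E where "E = (\<lambda>v. Dy (?Dw (Dx v)))"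
  have Dd: "(\<lambda>p. D f p) \<in> dops L" if "f \<in> L" for f using dops_D[OF dops_id that] by simp
  have E_dops: "E \<in> dops L" unfolding E_def
    by (intro dops_comp[OF Dd] dops_comp[OF Dd Dd] fL w)
  have hL: "q ^ n * (q ^ n * q ^ n) = 1" for n
    using q3(1) by (simp add: power_mult_distrib[symmetric] power3_eq_cube mult.assoc)
  have F_mult: "a * v \<in> F \<and> E (a * v) = E a * v + a * E v" if a: "hdeg n a" "a \<in> F" and v: "v \<in> F" for a v n
  proof -
    note h = hdeg_D[OF a(1), of fx] 
    have "E (a * v) = E a * v + sc (q ^ n * (q ^ n * q ^ n)) (a * E v)"
      using a v unfolding E_def F_def
      by (simp add: D_mult_hdeg[OF a(1)] D_mult_hdeg[OF h] D_mult_hdeg[OF hdeg_D[OF h]] D_add D_sc sc_add mult.assoc)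
    then show ?thesis using a v by (simp add: hL F_def D_mult_hdeg[OF a(1)])
  qed
  have baseF: "t * Y - Y * t \<in> F"
    using q3 by (simp add: F_def D_diff D_mult_hdeg[OF ht] lm Dyt Dwt)
  have Dx1: "Dx (t * Y - Y * t) = Dx t * Y - sc q (Y * Dx t)"
    by (simp add: D_diff D_mult_hdeg[OF ht] lm)
  have h2: "hdeg 2 (Dx t)" using hdeg_D[OF ht, of fx] by simp
  have Dw1: "?Dw (Dx t * Y - sc q (Y * Dx t)) = sc (\<alpha> * (1 - q\<^sup>2)) (Y * Y)"
    by (simp add: D_diff D_sc D_mult_hdeg[OF h2] lm DwDxt sc_diff_left algebra_simps power2_eq_square)
  have baseE: "E (t * Y - Y * t) = sc (\<alpha> * (1 - q\<^sup>2) * (1 + q)) Y"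
    unfolding E_def Dx1 Dw1 D_sc lm by (simp add: sc_add sc_add_left sc_diff_left algebra_simps)
  have "rich L (commR t Y)"
  proof (rule rich_commR[where E = E and \<delta> = Dy and F = F and N = 3 and \<tau> = \<alpha> and d = 1
        and \<kappa> = "\<alpha> * (1 - q\<^sup>2) * (1 + q)" and cz = 1])
    show "Dy \<in> dops L" using Dd[OF fL(2)] by simp
    show "t \<in> F" by (simp add: F_def Dyt Dwt)
    show "E t = sc \<alpha> 1" by (simp add: E_def DwDxt D_sc)
    show "\<alpha> * (1 - q\<^sup>2) * (1 + q) \<noteq> 0" using q2 q3 by (simp add: \<alpha>_def)
    show "t * Y - Y * t \<in> F" by (rule baseF)
    show "E (t * Y - Y * t) = sc (\<alpha> * (1 - q\<^sup>2) * (1 + q)) Y" by (rule baseE)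
  next
    fix v assume "v \<in> F"
    then show "Dy (Y * v) = sc 1 v" by (simp add: lm F_def)
  qed (use F_mult E_dops ht hdeg_Y in \<open>auto simp: F_def E_def D_add D_sc\<close>)
  then show ?thesis by (simp add: t_def)
qed

lemma rich_exists:
  assumes q: "q\<^sup>2 \<noteq> 1"
    and w: "q ^ 3 = 1 \<Longrightarrow> \<exists>w fw. fw \<in> L \<and> fw w = 1 \<and> fw x = 0 \<and> fw y = 0 \<and> fx w = 0 \<and> fy w = 0"
  shows "\<exists>r l. rich L r \<and> (\<forall>i. \<exists>d\<le>l * Suc i. hdeg d (r i))"
proof (cases "\<forall>i>0. q ^ i \<noteq> 1")
  case True
  then have "rich L z" by (intro rich_z) auto
  moreover have "\<forall>i. \<exists>d\<le>1 * Suc i. hdeg d (z i)" using hdeg_z by auto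
  ultimately show ?thesis by blast
next
  case False
  define N where "N = (LEAST i. i > 0 \<and> q ^ i = 1)"
  have N: "N > 0" "q ^ N = 1"
    using False LeastI_ex[of "\<lambda>i. i > 0 \<and> q ^ i = 1"] by (auto simp: N_def)
  have ord: "q ^ i \<noteq> 1" if "0 < i" "i < N" for i
    using not_less_Least[of i "\<lambda>i. i > 0 \<and> q ^ i = 1"] that by (auto simp: N_def)
  have q1: "q \<noteq> 1" using q by auto
  have "N \<noteq> 1" "N \<noteq> 2" using N q q1 by auto
  then consider "N = 3" | b where "N = 2 * Suc (Suc b)" | b where "N = 2 * b + 3" "b > 0"
  proof -
    assume h: "N = 3 \<Longrightarrow> thesis" "\<And>b. N = 2 * Suc (Suc b) \<Longrightarrow> thesis" "\<And>b. N = 2 * b + 3 \<Longrightarrow> b > 0 \<Longrightarrow> thesis"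
    show thesis
    proof (cases "even N")
      case True
      then obtain k where "N = 2 * k" by blast
      then show ?thesis using h(2)[of "k - 2"] N \<open>N \<noteq> 2\<close> by (cases k) (auto simp: Suc_diff_le)
    next
      case False
      then obtain k where "N = 2 * k + 1" by (rule oddE)
      then show ?thesis using h(1) h(3)[of "k - 1"] \<open>N \<noteq> 1\<close> by (cases "k = 1") auto
    qed
  qed
  then show ?thesis
  proof cases
    case 1
    then obtain w fw where w: "fw \<in> L" "fw w = 1" "fw x = 0" "fw y = 0" "fx w = 0" "fy w = 0"
      using w N by auto
    let ?u = "X * wrd [w] - sc q (wrd [w] * X)"
    let ?t = "?u * Y - sc (q\<^sup>2) (Y * ?u)"
    have hw: "hdeg 1 (wrd [w] :: ('l, 'k) falg)" using hdeg_wrd[of "[w]"] by simp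
    have hu: "hdeg 2 ?u" by (intro hdeg_diff hdeg_sc hdeg_mult'[OF hdeg_X hw] hdeg_mult'[OF hw hdeg_X]) simp_all
    have "hdeg 3 ?t" by (intro hdeg_diff hdeg_sc hdeg_mult'[OF hu hdeg_Y] hdeg_mult'[OF hdeg_Y hu]) simp_all
    then have "hdeg (3 * i + 1) (commR ?t Y i)" for i by (rule hdeg_commR[OF _ hdeg_Y])
    moreover have "3 * i + 1 \<le> 3 * Suc i" for i by simp
    ultimately show ?thesis using rich_cubic[OF _ q1 w] N 1 by metis
  next
    case (2 b)
    have "(q ^ Suc (Suc b))\<^sup>2 = 1" using N 2 by (simp only: power_mult[symmetric] mult.commute)
    moreover have "q ^ Suc (Suc b) \<noteq> 1" using ord[of "Suc (Suc b)"] 2 by simp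
    ultimately have "q ^ Suc (Suc b) = -1" using power2_eq_1_iff by blast
    then have "rich L (evenR b)" using ord 2 by (intro rich_evenR) auto
    moreover have "Suc (Suc b) * n + Suc b \<le> Suc (Suc b) * Suc n" for n by simp
    ultimately show ?thesis using hdeg_evenR by blast
  next
    case (3 b)
    then have "rich L (commR (z_bracket b) (z b))" using ord N by (intro rich_odd) auto
    moreover have "hdeg ((2 * b + 3) * n + Suc b) (commR (z_bracket b) (z b) n)" for n
      by (rule hdeg_commR[OF hdeg_z_bracket hdeg_z])
    moreover have "(2 * b + 3) * n + Suc b \<le> (2 * b + 3) * Suc n" for n by simp
    ultimately show ?thesis by blast
  qed
qed

end

section \<open>The radical as a two-sided ideal\<close>

context skew
begin

lemma rad_diff: "p \<in> rad L \<Longrightarrow> r \<in> rad L \<Longrightarrow> p - r \<in> rad L" by (simp add: rad_def ap_diff)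

lemma rad_by_D: "Poly_Mapping.lookup p 0 = 0 \<Longrightarrow> (\<And>f. f \<in> L \<Longrightarrow> D f p \<in> rad L) \<Longrightarrow> p \<in> rad L"
  unfolding rad_def
proof (intro CollectI allI impI)
  fix F assume h: "Poly_Mapping.lookup p 0 = 0"
    "\<And>f. f \<in> L \<Longrightarrow> D f p \<in> {p. \<forall>F. set F \<subseteq> L \<longrightarrow> ap p (phi F) = 0}" "set F \<subseteq> L"
  show "ap p (phi F) = 0"
  proof (cases F)
    case Nil
    then show ?thesis using h by (simp add: ap_phi)
  next
    case (Cons f F')
    then show ?thesis using h by (simp add: ap_phi_Cons)
  qed
qed

lemma sh_cong_set:
  "(\<And>a b. set a \<subseteq> set w \<Longrightarrow> set b \<subseteq> set w \<Longrightarrow> length a + length b = length w \<Longrightarrow> \<psi> a b = \<chi> a b) \<Longrightarrow> sh w \<psi> = sh w \<chi>"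
proof (induction w arbitrary: \<psi> \<chi>)
  case (Cons c w)
  have "sh w (\<lambda>a b. \<psi> (c # a) b + q ^ length a * \<psi> a (c # b)) = sh w (\<lambda>a b. \<chi> (c # a) b + q ^ length a * \<chi> a (c # b))"
  proof (rule Cons.IH)
    fix a b assume "set a \<subseteq> set w" "set b \<subseteq> set w" "length a + length b = length w"
    then have "\<psi> (c # a) b = \<chi> (c # a) b" "\<psi> a (c # b) = \<chi> a (c # b)" by (auto intro!: Cons.prems)
    then show "\<psi> (c # a) b + q ^ length a * \<psi> a (c # b) = \<chi> (c # a) b + q ^ length a * \<chi> a (c # b)" by simp
  qed
  then show ?case by simp
qed simp

lemma ap_sh: "ap p (\<lambda>u. sh F (\<lambda>F1 F2. \<psi> F1 F2 u)) = sh F (\<lambda>F1 F2. ap p (\<psi> F1 F2))"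
  by (induction p rule: falg_induct) (simp_all add: ap_add sh_add ap_sc sh_scale)

lemma ap_mult_phi: "ap (p * r) (phi F) = sh F (\<lambda>F1 F2. ap p (phi F1) * ap r (phi F2))"
proof -
  have "ap (p * r) (phi F) = sh F (\<lambda>F1 F2. ap p (\<lambda>u. ap r (\<lambda>w. phi F1 u * phi F2 w)))"
    by (simp add: ap_mult phi_append ap_sh)
  then show ?thesis by (simp add: ap_fun_scale mult.commute[of _ "ap r _"])
qed

text \<open>By \<open>ap_mult_phi\<close>, each term of \<open>phi F\<close> on a product is a
  product of pairings with two subwords of \<open>F\<close>, one of which vanishes.\<close>

lemma rad_mult_left: "p \<in> rad L \<Longrightarrow> r * p \<in> rad L"
  and rad_mult_right: "p \<in> rad L \<Longrightarrow> p * r \<in> rad L"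
proof -
  assume p: "p \<in> rad L"
  have "ap (r * p) (phi F) = 0" "ap (p * r) (phi F) = 0" if "set F \<subseteq> L" for F
  proof -
    have pz: "ap p (phi H) = 0" if "set H \<subseteq> set F" for H
      using p that \<open>set F \<subseteq> L\<close> by (auto simp: rad_def)
    have "sh F (\<lambda>F1 F2. ap r (phi F1) * ap p (phi F2)) = sh F (\<lambda>F1 F2. 0)"
      by (rule sh_cong_set) (simp add: pz)
    moreover have "sh F (\<lambda>F1 F2. ap p (phi F1) * ap r (phi F2)) = sh F (\<lambda>F1 F2. 0)"
      by (rule sh_cong_set) (simp add: pz)
    ultimately show "ap (r * p) (phi F) = 0" "ap (p * r) (phi F) = 0" by (simp_all add: ap_mult_phi)
  qed
  then show "r * p \<in> rad L" "p * r \<in> rad L" by (simp_all add: rad_def)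
qed

section \<open>Polynomially many spanning words\<close>

inductive_set rad_span :: "('l \<Rightarrow> 'k) set \<Rightarrow> 'l list set \<Rightarrow> ('l, 'k) falg set"
  for L :: "('l \<Rightarrow> 'k) set" and M :: "'l list set" where
  rad_span_wrd: "s \<in> M \<Longrightarrow> wrd s \<in> rad_span L M"
| rad_span_rad: "p \<in> rad L \<Longrightarrow> p \<in> rad_span L M"
| rad_span_add: "p \<in> rad_span L M \<Longrightarrow> r \<in> rad_span L M \<Longrightarrow> p + r \<in> rad_span L M"
| rad_span_sc: "p \<in> rad_span L M \<Longrightarrow> sc c p \<in> rad_span L M"

lemma rad_span_0: "0 \<in> rad_span L M" by (rule rad_span_rad[OF rad_0])

lemma rad_span_minus: "p \<in> rad_span L M \<Longrightarrow> - p \<in> rad_span L M"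
  using rad_span_sc[of p L M "-1"] by (simp add: sc_minus_left)

lemma rad_span_diff: "p \<in> rad_span L M \<Longrightarrow> r \<in> rad_span L M \<Longrightarrow> p - r \<in> rad_span L M"
  using rad_span_add[of p L M "- r"] rad_span_minus[of r] by simp

lemma rad_span_sum: "(\<And>i. i \<in> A \<Longrightarrow> p i \<in> rad_span L M) \<Longrightarrow> sum p A \<in> rad_span L M"
  by (rule falg_sum_induct) (auto intro: rad_span_0 rad_span_add)

lemma rad_span_cong: "p - r \<in> rad L \<Longrightarrow> r \<in> rad_span L M \<Longrightarrow> p \<in> rad_span L M"
  using rad_span_add[OF rad_span_rad[of "p - r" L M], of r] by simp

lemma rad_span_mono: "p \<in> rad_span L M \<Longrightarrow> M \<subseteq> M' \<Longrightarrow> p \<in> rad_span L M'"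
  by (induction rule: rad_span.induct) (auto intro: rad_span.intros)

lemma rad_span_mult:
  assumes "p \<in> rad_span L M" "\<And>s. s \<in> M \<Longrightarrow> a * wrd s \<in> rad_span L M'"
  shows "a * p \<in> rad_span L M'"
  using assms by (induction rule: rad_span.induct) (auto simp: distrib_left intro: rad_span.intros rad_mult_left)

text \<open>\<open>B\<close> generates all letters as far as the forms in \<open>L\<close> can see.
  For vectors and linear forms, any finite basis will do.\<close>

definition spans :: "('l \<Rightarrow> 'k) set \<Rightarrow> 'l set \<Rightarrow> bool" where
  "spans L B \<longleftrightarrow> (\<forall>v. \<exists>c. \<forall>f\<in>L. f v = (\<Sum>b\<in>B. c b * f b))"

lemma rad_letter:
  assumes "\<And>f. f \<in> L \<Longrightarrow> f v = (\<Sum>b\<in>B. c b * f b)"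
  shows "wrd [v] - (\<Sum>b\<in>B. sc (c b) (wrd [b])) \<in> rad L"
proof (rule rad_by_D)
  show "Poly_Mapping.lookup (wrd [v] - (\<Sum>b\<in>B. sc (c b) (wrd [b]))) 0 = 0"
    by (simp add: wrd_def lookup_minus lookup_sum zero_fmon_def lookup_single when_def)
  fix f assume "f \<in> L"
  then have "D f (wrd [v] - (\<Sum>b\<in>B. sc (c b) (wrd [b]))) = 0"
    by (simp add: D_diff D_sum D_sc D_letter assms sc_sum_left)
  then show "D f (wrd [v] - (\<Sum>b\<in>B. sc (c b) (wrd [b]))) \<in> rad L" by (simp add: rad_0)
qed

text \<open>Modulo the radical a letter is a combination of letters in \<open>B\<close>, so only the
  effect of prepending a letter of \<open>B\<close> to a word of \<open>M n\<close> has to be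
  controlled.\<close>

lemma rad_span_words:
  assumes B: "spans L B" and M0: "[] \<in> M 0"
    and step: "\<And>b s n. b \<in> B \<Longrightarrow> s \<in> M n \<Longrightarrow> wrd (b # s) \<in> rad_span L (M (Suc n))"
  shows "wrd w \<in> rad_span L (M (length w))"
proof (induction w)
  case Nil
  then show ?case using M0 by (auto intro: rad_span_wrd)
next
  case (Cons v w)
  obtain c where c: "\<And>f. f \<in> L \<Longrightarrow> f v = (\<Sum>b\<in>B. c b * f b)"
    using B unfolding spans_def by meson
  have "(wrd [v] - (\<Sum>b\<in>B. sc (c b) (wrd [b]))) * wrd w \<in> rad L"
    by (rule rad_mult_right[OF rad_letter[OF c]])
  then have 1: "wrd (v # w) - (\<Sum>b\<in>B. sc (c b) (wrd [b] * wrd w)) \<in> rad L"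
    by (simp add: wrd_Cons[of v w] left_diff_distrib sum_distrib_right)
  have "(\<Sum>b\<in>B. sc (c b) (wrd [b] * wrd w)) \<in> rad_span L (M (Suc (length w)))"
    using step by (intro rad_span_sum rad_span_sc rad_span_mult[OF Cons]) (simp add: wrd_Cons[symmetric])
  then show ?case using rad_span_cong[OF 1] by simp
qed

definition poly_spanned :: "('l \<Rightarrow> 'k) set \<Rightarrow> bool" where
  "poly_spanned L \<longleftrightarrow> (\<exists>C d. \<forall>n. \<exists>M. finite M \<and> card M \<le> C * Suc n ^ d \<and> (\<forall>s\<in>M. length s \<le> n)
     \<and> (\<forall>w. length w \<le> n \<longrightarrow> wrd w \<in> rad_span L M))"

lemma poly_spannedI:
  assumes B: "spans L B" and M0: "[] \<in> M 0"
    and step: "\<And>b s n. b \<in> B \<Longrightarrow> s \<in> M n \<Longrightarrow> wrd (b # s) \<in> rad_span L (M (Suc n))"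
    and M: "\<And>n s. s \<in> M n \<Longrightarrow> length s = n" "\<And>n. finite (M n)" "\<And>n. card (M n) \<le> C * Suc n ^ d"
  shows "poly_spanned L"
  unfolding poly_spanned_def
proof (rule exI[of _ C], rule exI[of _ "Suc d"], intro allI)
  fix n
  let ?M = "\<Union>k\<le>n. M k"
  have 1: "finite ?M" using M by simp
  have "card ?M \<le> (\<Sum>k\<le>n. card (M k))" by (rule card_UN_le) simp
  also have "\<dots> \<le> (\<Sum>k\<le>n. C * Suc n ^ d)"
  proof (rule sum_mono)
    fix k assume "k \<in> {..n}"
    then have "C * Suc k ^ d \<le> C * Suc n ^ d" by (intro mult_left_mono power_mono) auto
    then show "card (M k) \<le> C * Suc n ^ d" using M(3)[of k] by linarith
  qed
  also have "\<dots> = C * Suc n ^ Suc d" by (simp add: algebra_simps)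
  finally have 2: "card ?M \<le> C * Suc n ^ Suc d" .
  have 3: "\<forall>s\<in>?M. length s \<le> n" using M(1) by auto
  have "wrd w \<in> rad_span L ?M" if "length w \<le> n" for w
    by (rule rad_span_mono[OF rad_span_words[of L B M, OF B M0 step]]) (use that in auto)
  then show "\<exists>M. finite M \<and> card M \<le> C * Suc n ^ Suc d \<and> (\<forall>s\<in>M. length s \<le> n)
     \<and> (\<forall>w. length w \<le> n \<longrightarrow> wrd w \<in> rad_span L M)"
    using 1 2 3 by blast
qed

lemma rad_swap:
  assumes "q\<^sup>2 = 1"
  shows "wrd [a, b] - sc q (wrd [b, a]) \<in> rad L"
proof (rule rad_by_D)
  show "Poly_Mapping.lookup (wrd [a, b] - sc q (wrd [b, a])) 0 = 0"
    by (simp add: wrd_def lookup_minus zero_fmon_def lookup_single when_def)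
  fix f assume "f \<in> L"
  have "D f (wrd [a, b] - sc q (wrd [b, a])) = sc (f a - q * (q * f a)) (wrd [b]) + sc (q * f b - q * f b) (wrd [a])"
    unfolding sc_diff_left by (simp add: D_diff D_sc D_wrd delw.simps(2) sc_add wrd_Nil mult_ac)
  also have "\<dots> = 0" using assms by (simp add: power2_eq_square mult.assoc[symmetric])
  finally show "D f (wrd [a, b] - sc q (wrd [b, a])) \<in> rad L" by (simp add: rad_0)
qed

lemma rad_span_insort:
  assumes q: "q\<^sup>2 = 1"
  shows "\<exists>c. wrd (b # s) - sc c (wrd (insort_key k b s)) \<in> rad L"
proof (induction s)
  case Nil
  show ?case by (rule exI[of _ 1]) (simp add: rad_0)
next
  case (Cons y s)
  show ?case
  proof (cases "k b \<le> k y")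
    case True
    then show ?thesis by (intro exI[of _ 1]) (simp add: rad_0)
  next
    case False
    obtain c where c: "wrd (b # s) - sc c (wrd (insort_key k b s)) \<in> rad L" using Cons by blast
    have 1: "wrd (b # y # s) - sc q (wrd (y # b # s)) \<in> rad L"
      using rad_mult_right[OF rad_swap[OF q, of b y], of "wrd s"]
      by (simp add: left_diff_distrib wrd_append[symmetric])
    have 2: "sc q (wrd (y # b # s)) - sc (q * c) (wrd (y # insort_key k b s)) \<in> rad L"
      using rad_sc[OF rad_mult_left[OF c, of "wrd [y]"], of q]
      by (simp add: right_diff_distrib wrd_append[symmetric] sc_diff)
    show ?thesis using rad_add[OF 1 2] False by (intro exI[of _ "q * c"]) simp
  qed
qed

text \<open>By \<open>rad_span_insort\<close> a word can be sorted along an arbitrary injective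
  numbering of \<open>B\<close>, up to a scalar. A sorted word is determined by the multiplicities
  of its letters, which leaves at most \<open>Suc n ^ card B\<close> of them.\<close>

lemma poly_spanned_swap:
  fixes L :: "('l \<Rightarrow> 'k) set"
  assumes q: "q\<^sup>2 = 1" and B: "spans L B" "finite B"
  shows "poly_spanned L"
proof -
  obtain k :: "'l \<Rightarrow> nat" where k: "inj_on k B"
    using finite_imp_inj_to_nat_seg[OF B(2)] by blast
  define M where "M n = {s. sorted (map k s) \<and> set s \<subseteq> B \<and> length s = n}" for n
  show ?thesis
  proof (rule poly_spannedI[OF B(1), of M])
    show "[] \<in> M 0" by (simp add: M_def)
    fix n
    have "M n \<subseteq> {s. set s \<subseteq> B \<and> length s = n}" by (auto simp: M_def)
    then show fin: "finite (M n)" using finite_lists_length_eq[OF B(2)] finite_subset by blast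
    let ?c = "\<lambda>s. \<lambda>b\<in>B. count (mset s) b"
    have "inj_on ?c (M n)"
    proof (rule inj_onI)
      fix s t assume s: "s \<in> M n" and t: "t \<in> M n" and e: "?c s = ?c t"
      have "mset s = mset t"
      proof (rule multiset_eqI)
        fix b show "count (mset s) b = count (mset t) b"
        proof (cases "b \<in> B")
          case True
          then show ?thesis using fun_cong[OF e, of b] by simp
        next
          case False
          then have "b \<notin> set s" "b \<notin> set t" using s t by (auto simp: M_def)
          then have "count (mset s) b = 0" "count (mset t) b = 0" by simp_all
          then show ?thesis by (simp only:)
        qed
      qed
      then have "mset (map k s) = mset (map k t)" by simp
      then have "map k s = map k t" using s t properties_for_sort by (metis (no_types, lifting) M_def mem_Collect_eq)
      moreover have "inj_on k (set s \<union> set t)" using k s t by (intro inj_on_subset[OF k]) (auto simp: M_def)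
      ultimately show "s = t" using map_inj_on by blast
    qed
    moreover have "?c ` M n \<subseteq> (\<Pi>\<^sub>E b\<in>B. {..n})"
      by (auto simp: M_def PiE_iff count_mset count_le_length)
    ultimately have "card (M n) \<le> card (\<Pi>\<^sub>E b\<in>B. {..n})"
      using B(2) by (intro card_inj_on_le) (auto intro: finite_PiE)
    then show "card (M n) \<le> 1 * Suc n ^ card B" using B(2) by (simp add: card_PiE)
  next
    fix b s n assume b: "b \<in> B" and s: "s \<in> M n"
    obtain c where "wrd (b # s) - sc c (wrd (insort_key k b s)) \<in> rad L" using rad_span_insort[where b = b and s = s and k = k and L = L, OF q] by blast
    moreover have "insort_key k b s \<in> M (Suc n)" using b s by (auto simp: M_def sorted_insort_key set_insort_key)
    ultimately show "wrd (b # s) \<in> rad_span L (M (Suc n))" by (blast intro: rad_span_cong rad_span_sc rad_span_wrd)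
  qed (simp add: M_def)
qed

section \<open>Two letters at a primitive third root of unity\<close>

context
  assumes q3: "1 + q + q\<^sup>2 = 0"
begin

text \<open>In a derivative each remaining word occurs with the coefficients \<open>c\<close>,
  \<open>q c\<close> and \<open>q^2 c\<close>, whose sum is zero.\<close>

lemma rad_cube: "wrd [a, a, a] \<in> rad L"
  and rad_serre: "wrd [a, a, b] + wrd [a, b, a] + wrd [b, a, a] \<in> rad L"
proof -
  have c: "sc c p + (sc (q * c) p + sc (q * (q * c)) p) = 0" for c and p :: "('l, 'k) falg"
  proof -
    have "sc c p + (sc (q * c) p + sc (q * (q * c)) p) = sc ((1 + q + q\<^sup>2) * c) p"
      unfolding sc_add_left[symmetric] by (rule sc_eqI) (simp add: algebra_simps power2_eq_square)
    then show ?thesis using q3 by simp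
  qed
  have D1: "D f (wrd [u, v, w]) = sc (f u) (wrd [v, w]) + (sc (q * f v) (wrd [u, w]) + sc (q * (q * f w)) (wrd [u, v]))"
    for f and u v w :: 'l
    by (simp add: D_wrd delw.simps(2) sc_add distrib_left wrd_append[symmetric])
  have "D f (wrd [a, a, a]) = 0" for f by (simp only: D1 c)
  then show "wrd [a, a, a] \<in> rad L"
    by (rule_tac rad_by_D) (simp_all add: rad_0, simp add: wrd_def lookup_single when_def zero_fmon_def)
  have "D f (wrd [a, a, b] + wrd [a, b, a] + wrd [b, a, a]) = 0" for f
  proof -
    have "D f (wrd [a, a, b] + wrd [a, b, a] + wrd [b, a, a]) =
      (sc (f a) (wrd [a, b]) + (sc (q * f a) (wrd [a, b]) + sc (q * (q * f a)) (wrd [a, b])))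
      + (sc (f a) (wrd [b, a]) + (sc (q * f a) (wrd [b, a]) + sc (q * (q * f a)) (wrd [b, a])))
      + (sc (f b) (wrd [a, a]) + (sc (q * f b) (wrd [a, a]) + sc (q * (q * f b)) (wrd [a, a])))"
      by (simp add: D_add D1 algebra_simps)
    then show ?thesis by (simp only: c add_0)
  qed
  then show "wrd [a, a, b] + wrd [a, b, a] + wrd [b, a, a] \<in> rad L"
    by (rule_tac rad_by_D) (simp_all add: rad_0, simp add: wrd_def lookup_add lookup_single when_def zero_fmon_def)
qed

text \<open>Normal words are \<open>x^a (yx)^b y^c\<close> with \<open>a, c \<le> 2\<close>. The
  cubes bound \<open>a\<close> and \<open>c\<close>; the symmetrized relations replace
  \<open>yxx\<close> by \<open>- xxy - xyx\<close> and \<open>yyx\<close> by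
  \<open>- yxy - xyy\<close>.\<close>

lemma poly_spanned_cubic:
  fixes L :: "('l \<Rightarrow> 'k) set"
  assumes B: "spans L {x, y}"
  shows "poly_spanned L"
proof -
  define nw where "nw a b c = replicate a x @ concat (replicate b [y, x]) @ replicate c y" for a b c
  define M where "M n = {nw a b c | a b c. a \<le> 2 \<and> c \<le> 2 \<and> a + 2 * b + c = n}" for n
  have len: "length (nw a b c) = a + 2 * b + c" for a b c
    by (simp add: nw_def length_concat sum_list_replicate)
  let ?X = "wrd [x] :: ('l, 'k) falg" and ?Y = "wrd [y] :: ('l, 'k) falg"
  note app = wrd_append[symmetric]
  have memM: "a \<le> 2 \<Longrightarrow> c \<le> 2 \<Longrightarrow> a + 2 * b + c = n \<Longrightarrow> wrd (nw a b c) \<in> rad_span L (M n)" for a b c n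
    by (rule rad_span_wrd) (auto simp: M_def)
  have x_step: "wrd (x # s) \<in> rad_span L (M (Suc n))" if s: "s \<in> M n" for s n
  proof -
    obtain a b c where abc: "s = nw a b c" "a \<le> 2" "c \<le> 2" "a + 2 * b + c = n" using s by (auto simp: M_def)
    show ?thesis
    proof (cases "a = 2")
      case True
      have "wrd [x, x, x] * wrd (nw 0 b c) \<in> rad L" by (intro rad_mult_right rad_cube)
      moreover have "wrd [x, x, x] * wrd (nw 0 b c) = wrd (x # s)"
        using abc True by (simp add: nw_def app numeral_2_eq_2)
      ultimately show ?thesis by (metis rad_span_rad)
    next
      case False
      have "x # s = nw (Suc a) b c" using abc by (simp add: nw_def)
      then show ?thesis using abc False by (simp only:) (rule memM, auto)
    qed
  qed
  have xm: "?X * p \<in> rad_span L (M (Suc n))" if "p \<in> rad_span L (M n)" for p n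
    using x_step by (intro rad_span_mult[OF that]) (simp add: app)
  have "s \<in> M n \<Longrightarrow> wrd (y # s) \<in> rad_span L (M (Suc n))" for s n
  proof (induction n arbitrary: s rule: less_induct)
    case (less n)
    have IH: "?Y * p \<in> rad_span L (M (Suc m))" if "m < n" "p \<in> rad_span L (M m)" for p m
      using less.IH[OF that(1)] by (intro rad_span_mult[OF that(2)]) (simp add: app)
    \<comment> \<open>Prepending \<open>y\<close> to a word that starts with \<open>x\<close>. For
      \<open>yxx s\<close> the relation asks for \<open>y s\<close> with a shorter normal word
      \<open>s\<close>, where the induction hypothesis applies.\<close>
    have pos: "wrd (y # nw (Suc a) b c) \<in> rad_span L (M (Suc n))" if "Suc a \<le> 2" "c \<le> 2" "Suc a + 2 * b + c = n" for a b c
    proof (cases "a = 0")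
      case True
      have "y # nw (Suc a) b c = nw 0 (Suc b) c" using True by (simp add: nw_def)
      then show ?thesis using that True by (simp only:) (rule memM, auto)
    next
      case False
      then have a: "a = 1" using that by simp
      let ?s = "nw 0 b c"
      have n: "n = Suc (Suc (2 * b + c))" using that a by simp
      have rel: "(wrd [x, x, y] + wrd [x, y, x] + wrd [y, x, x]) * wrd ?s \<in> rad L" by (intro rad_mult_right rad_serre)
      have eq: "(wrd [x, x, y] + wrd [x, y, x] + wrd [y, x, x]) * wrd ?s =
          wrd (y # nw (Suc a) b c) - (- (?X * (?X * (?Y * wrd ?s))) - ?X * wrd (nw 0 (Suc b) c))"
        using a by (simp add: nw_def distrib_right app algebra_simps)
      have "- (?X * (?X * (?Y * wrd ?s))) - ?X * wrd (nw 0 (Suc b) c) \<in> rad_span L (M (Suc n))"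
      proof -
        have "wrd ?s \<in> rad_span L (M (2 * b + c))" "wrd (nw 0 (Suc b) c) \<in> rad_span L (M (Suc (Suc (2 * b + c))))"
          by (rule memM; use that in simp)+
        note mem = this
        have "?Y * wrd ?s \<in> rad_span L (M (Suc (2 * b + c)))" by (rule IH[OF _ mem(1)]) (simp add: n)
        then have "?X * (?X * (?Y * wrd ?s)) \<in> rad_span L (M (Suc n))" unfolding n by (intro xm)
        moreover have "?X * wrd (nw 0 (Suc b) c) \<in> rad_span L (M (Suc n))" unfolding n by (rule xm[OF mem(2)])
        ultimately show ?thesis by (intro rad_span_diff rad_span_minus)
      qed
      then show ?thesis by (rule rad_span_cong[OF rel[unfolded eq]])
    qed
    obtain a b c where abc: "s = nw a b c" "a \<le> 2" "c \<le> 2" "a + 2 * b + c = n" using less.prems by (auto simp: M_def)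
    show ?case
    proof (cases a)
      case (Suc a')
      then show ?thesis using pos abc by simp
    next
      case a: 0
      show ?thesis
      proof (cases b)
        case b: 0
        show ?thesis
        proof (cases "c = 2")
          case True
          then have "y # s = [y, y, y]" using abc a b by (simp add: nw_def numeral_2_eq_2)
          then show ?thesis using rad_cube rad_span_rad by metis
        next
          case False
          have "y # s = nw 0 0 (Suc c)" using abc a b by (simp add: nw_def)
          then show ?thesis using abc a b False by (simp only:) (rule memM, auto)
        qed
      next
        case (Suc b')
        let ?s = "nw 0 b' c"
        have n: "n = Suc (Suc (2 * b' + c))" using abc a Suc by simp
        have "wrd ?s \<in> rad_span L (M (2 * b' + c))" by (rule memM) (use abc in simp_all)
        then have yS: "?Y * wrd ?s \<in> rad_span L (M (Suc (2 * b' + c)))"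
          using n by (intro IH) simp_all
        \<comment> \<open>Prepending \<open>x\<close> to a normal word gives a normal word starting
          with \<open>x\<close>, covered by \<open>pos\<close>, or a cube.\<close>
        have yx: "?Y * (?X * p) \<in> rad_span L (M (Suc n))" if "p \<in> rad_span L (M (Suc (2 * b' + c)))" for p
          unfolding mult.assoc[symmetric]
        proof (rule rad_span_mult[OF that])
          fix t assume "t \<in> M (Suc (2 * b' + c))"
          then obtain a2 b2 c2 where t: "t = nw a2 b2 c2" "a2 \<le> 2" "c2 \<le> 2" "a2 + 2 * b2 + c2 = Suc (2 * b' + c)"
            by (auto simp: M_def)
          show "?Y * ?X * wrd t \<in> rad_span L (M (Suc n))"
          proof (cases "a2 = 2")
            case True
            have "?Y * (wrd [x, x, x] * wrd (nw 0 b2 c2)) \<in> rad L" by (intro rad_mult_left rad_mult_right rad_cube)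
            moreover have "?Y * (wrd [x, x, x] * wrd (nw 0 b2 c2)) = ?Y * ?X * wrd t"
              using t True by (simp add: nw_def app numeral_2_eq_2)
            ultimately show ?thesis by (metis rad_span_rad)
          next
            case False
            have eq: "?Y * ?X * wrd t = wrd (y # nw (Suc a2) b2 c2)" using t by (simp add: nw_def app)
            show ?thesis unfolding eq by (rule pos) (use t False n in auto)
          qed
        qed
        have rel: "(wrd [y, y, x] + wrd [y, x, y] + wrd [x, y, y]) * wrd ?s \<in> rad L" by (intro rad_mult_right rad_serre)
        have eq: "(wrd [y, y, x] + wrd [y, x, y] + wrd [x, y, y]) * wrd ?s =
            wrd (y # s) - (- (?Y * (?X * (?Y * wrd ?s))) - ?X * (?Y * (?Y * wrd ?s)))"
          using abc a Suc by (simp add: nw_def distrib_right app algebra_simps)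
        have "- (?Y * (?X * (?Y * wrd ?s))) - ?X * (?Y * (?Y * wrd ?s)) \<in> rad_span L (M (Suc n))"
        proof -
          have "?Y * (?Y * wrd ?s) \<in> rad_span L (M (Suc (Suc (2 * b' + c))))"
            by (rule IH[OF _ yS]) (simp add: n)
          then have "?X * (?Y * (?Y * wrd ?s)) \<in> rad_span L (M (Suc n))" unfolding n by (rule xm)
          then show ?thesis by (intro rad_span_diff rad_span_minus yx yS)
        qed
        then show ?thesis by (rule rad_span_cong[OF rel[unfolded eq]])
      qed
    qed
  qed
  note y_step = this
  show ?thesis
  proof (rule poly_spannedI[OF B, of M])
    show "[] \<in> M 0" unfolding M_def by (intro CollectI exI[of _ 0]) (simp add: nw_def)
    fix n
    have sub: "M n \<subseteq> (\<lambda>(a, b, c). nw a b c) ` ({..2} \<times> {..n} \<times> {..2})" by (force simp: M_def)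
    then show "finite (M n)" by (rule finite_subset) simp
    have "card (M n) \<le> card (({..2::nat} \<times> {..n} \<times> {..2::nat}))"
      using card_mono[OF _ sub] card_image_le[of "{..2::nat} \<times> {..n} \<times> {..2::nat}" "\<lambda>(a, b, c). nw a b c"] by fastforce
    then show "card (M n) \<le> 9 * Suc n ^ 1" by (simp add: card_cartesian_product)
  next
    fix b s n assume "b \<in> {x, y}" "s \<in> M n"
    then show "wrd (b # s) \<in> rad_span L (M (Suc n))" using x_step y_step by blast
  next
    fix n s assume "s \<in> M n"
    then show "length s = n" by (auto simp: M_def len)
  qed
qed

end

end

lemma lin_span_least:
  assumes "S \<subseteq> U" "\<zero>\<^bsub>A\<^esub> \<in> U" "\<And>x y. x \<in> U \<Longrightarrow> y \<in> U \<Longrightarrow> x \<oplus>\<^bsub>A\<^esub> y \<in> U" "\<And>c x. x \<in> U \<Longrightarrow> c \<odot>\<^bsub>A\<^esub> x \<in> U"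
  shows "lin_span A S \<subseteq> U"
proof
  fix x assume "x \<in> lin_span A S"
  then show "x \<in> U" using assms by (induction rule: lin_span.induct) auto
qed

lemma lin_span_subset: "S \<subseteq> lin_span A S' \<Longrightarrow> lin_span A S \<subseteq> lin_span A S'"
  by (rule lin_span_least) (auto intro: lin_span.intros)

section \<open>The tensor algebra of a module with scalar degree action\<close>

locale yd_line = skew q for q :: "'k::field" +
  fixes G :: "('g, 'm) monoid_scheme" (structure)
    and \<Phi> :: "'g \<Rightarrow> 'g \<Rightarrow> 'g \<Rightarrow> 'k"
    and V :: "('k, 'g, 'v::ab_group_add) yd_module"
    and g :: 'g
  assumes G: "comm_group G" "finite (carrier G)"
    and cocycle: "normalized_3_cocycle G \<Phi>"
    and yd: "twisted_yd_module G \<Phi> V"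
    and g: "g \<in> carrier G" "concentrated_in_degree V g"
    and act_g: "\<And>v. act V g v = scal V q v"
begin

sublocale comm_group G by (rule G)

sublocale vs: vector_space "scal V" using yd by (simp add: twisted_yd_module_def)

abbreviation "MF \<equiv> multilinear_forms G V"
abbreviation "BMF \<equiv> bimultilinear_forms G V"
abbreviation "TA \<equiv> tensor_algebra G \<Phi> V"
abbreviation "TA2 \<equiv> tensor_algebra2 G \<Phi> V"

lemma comp_g: "comp V g = UNIV"
  using g by (simp add: concentrated_in_degree_def)

lemma comp_subspace: "h \<in> carrier G \<Longrightarrow> vs.subspace (comp V h)"
  using yd by (simp add: twisted_yd_module_def)

text \<open>Otherwise \<open>v\<close> would have two decompositions, one placing it in degree
  \<open>h\<close> and one in degree \<open>g\<close>.\<close>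

lemma comp_other:
  assumes h: "h \<in> carrier G" "h \<noteq> g" and v: "v \<in> comp V h"
  shows "v = 0"
proof -
  have 0: "0 \<in> comp V k" if "k \<in> carrier G" for k using vs.subspace_0[OF comp_subspace[OF that]] .
  let ?f = "\<lambda>j. \<lambda>k\<in>carrier G. if k = j then v else 0"
  have "?f h \<in> (\<Pi>\<^sub>E k\<in>carrier G. comp V k) \<and> v = (\<Sum>k\<in>carrier G. ?f h k)"
    "?f g \<in> (\<Pi>\<^sub>E k\<in>carrier G. comp V k) \<and> v = (\<Sum>k\<in>carrier G. ?f g k)"
    using 0 h v g G(2) by (auto simp: comp_g)
  moreover have "\<exists>!f. f \<in> (\<Pi>\<^sub>E k\<in>carrier G. comp V k) \<and> v = (\<Sum>k\<in>carrier G. f k)"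
    using yd by (simp add: twisted_yd_module_def)
  ultimately have "?f h = ?f g" by blast
  from fun_cong[OF this, of h] show ?thesis using h by simp
qed

lemma act_linear: "e \<in> carrier G \<Longrightarrow> Vector_Spaces.linear (scal V) (scal V) (act V e)"
  using yd by (simp add: twisted_yd_module_def)

lemma act_add: "e \<in> carrier G \<Longrightarrow> act V e (x + y) = act V e x + act V e y"
  and act_scale: "e \<in> carrier G \<Longrightarrow> act V e (scal V c x) = scal V c (act V e x)"
proof -
  assume "e \<in> carrier G"
  then interpret l: Vector_Spaces.linear "scal V" "scal V" "act V e" by (rule act_linear)
  show "act V e (x + y) = act V e x + act V e y" "act V e (scal V c x) = scal V c (act V e x)"
    by (simp_all add: l.add l.scale)
qed

lemma act_one: "act V \<one> v = v"
  using yd by (simp add: twisted_yd_module_def)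

lemma Phi_nz: "a \<in> carrier G \<Longrightarrow> b \<in> carrier G \<Longrightarrow> c \<in> carrier G \<Longrightarrow> \<Phi> a b c \<noteq> 0"
  using cocycle by (simp add: normalized_3_cocycle_def)

lemma Phi_cocycle:
  "a \<in> carrier G \<Longrightarrow> b \<in> carrier G \<Longrightarrow> c \<in> carrier G \<Longrightarrow> d \<in> carrier G \<Longrightarrow>
    \<Phi> (a \<otimes> b) c d * \<Phi> a b (c \<otimes> d) = \<Phi> a b c * \<Phi> a (b \<otimes> c) d * \<Phi> b c d"
  using cocycle by (simp add: normalized_3_cocycle_def)

lemma Phi_mid [simp]: "a \<in> carrier G \<Longrightarrow> b \<in> carrier G \<Longrightarrow> \<Phi> a \<one> b = 1"
  using cocycle by (simp add: normalized_3_cocycle_def)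

lemma Phi_left [simp]: "a \<in> carrier G \<Longrightarrow> b \<in> carrier G \<Longrightarrow> \<Phi> \<one> a b = 1"
  using Phi_cocycle[of \<one> \<one> a b] Phi_nz[of \<one> a b] by simp

lemma Phi_right [simp]: "a \<in> carrier G \<Longrightarrow> b \<in> carrier G \<Longrightarrow> \<Phi> a b \<one> = 1"
  using Phi_cocycle[of a b \<one> \<one>] Phi_nz[of a b \<one>] by simp

abbreviation gp :: "nat \<Rightarrow> 'g" where "gp n \<equiv> g [^] n"

lemma gp_closed [simp]: "gp n \<in> carrier G" using g by simp

lemma gp_Suc: "gp (Suc n) = gp n \<otimes> g" by simp

text \<open>The rebracketing scalar by which multiplying words of lengths \<open>m\<close> and \<open>n\<close> differs from
  concatenating them.\<close>

definition gam :: "nat \<Rightarrow> nat \<Rightarrow> 'k" where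
  "gam m n = (\<Prod>i<n. \<Phi> (gp m) (gp i) g)"

lemma gam_nz: "gam m n \<noteq> 0"
  using g by (simp add: gam_def Phi_nz)

lemma gam_0 [simp]: "gam m 0 = 1" by (simp add: gam_def)

lemma gam_0_left [simp]: "gam 0 n = 1" using g by (simp add: gam_def)

lemma gam_Suc: "gam m (Suc n) = gam m n * \<Phi> (gp m) (gp n) g" by (simp add: gam_def)

text \<open>The induction step is the cocycle identity at \<open>(g^m, g, g^n, g)\<close> together
  with \<open>g g^n = g^(n+1)\<close>. This relation makes the associators of the braided product
  fit the scalars \<open>gam\<close> in the coproduct.\<close>

lemma gam_shift: "gam m n * \<Phi> (gp m) (gp n) g * gam 1 n = \<Phi> (gp m) g (gp n) * gam (Suc m) n"
proof (induction n)
  case 0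
  show ?case using g by simp
next
  case (Suc n)
  have c: "\<Phi> (gp (Suc m)) (gp n) g * \<Phi> (gp m) g (gp (Suc n)) = \<Phi> (gp m) g (gp n) * \<Phi> (gp m) (gp (Suc n)) g * \<Phi> g (gp n) g"
  proof -
    have "g \<otimes> gp n = gp (Suc n)" using g m_comm[of g "gp n"] by simp
    then show ?thesis using Phi_cocycle[of "gp m" g "gp n" g] g by (simp add: gp_Suc[of m] del: nat_pow_Suc)
  qed
  have "gam m (Suc n) * \<Phi> (gp m) (gp (Suc n)) g * gam 1 (Suc n)
     = (gam m n * \<Phi> (gp m) (gp n) g * gam 1 n) * \<Phi> (gp m) (gp (Suc n)) g * \<Phi> g (gp n) g"
    using g by (simp add: gam_Suc mult_ac del: nat_pow_Suc)
  also have "\<dots> = (\<Phi> (gp m) g (gp n) * \<Phi> (gp m) (gp (Suc n)) g * \<Phi> g (gp n) g) * gam (Suc m) n"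
    unfolding Suc by (simp only: mult_ac)
  also have "\<dots> = \<Phi> (gp (Suc m)) (gp n) g * \<Phi> (gp m) g (gp (Suc n)) * gam (Suc m) n"
    by (simp only: c)
  also have "\<dots> = \<Phi> (gp m) g (gp (Suc n)) * gam (Suc m) (Suc n)"
    by (simp add: gam_Suc mult_ac del: nat_pow_Suc)
  finally show ?case .
qed

text \<open>Since \<open>\<Phi>_g(g, g^n)\<close> simplifies to \<open>\<Phi>(g, g^n, g)\<close>,
  letting \<open>g\<close> act \<open>n\<close> times collects exactly the factors of
  \<open>gam 1 n\<close>.\<close>

lemma act_gp: "act V (gp n) v = scal V (q ^ n / gam 1 n) v"
proof (induction n)
  case 0
  show ?case by (simp add: act_one)
next
  case (Suc n)
  have "slice \<Phi> g g (gp n) = \<Phi> g (gp n) g" using g Phi_nz[of g g "gp n"] by (simp add: slice_def)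
  moreover have "act V g (act V (gp n) v) = scal V (slice \<Phi> g g (gp n)) (act V (g \<otimes> gp n) v)"
    using yd g by (simp add: twisted_yd_module_def comp_g)
  moreover have "g \<otimes> gp n = gp (Suc n)" using g m_comm[of g "gp n"] by simp
  ultimately have "scal V q (scal V (q ^ n / gam 1 n) v) = scal V (\<Phi> g (gp n) g) (act V (gp (Suc n)) v)"
    by (simp only: act_g Suc)
  then have "scal V (inverse (\<Phi> g (gp n) g)) (scal V q (scal V (q ^ n / gam 1 n) v)) = act V (gp (Suc n)) v"
    using Phi_nz[of g "gp n" g] g by simp
  moreover have "inverse (\<Phi> g (gp n) g) * (q * (q ^ n / gam 1 n)) = q ^ Suc n / gam 1 (Suc n)"
    using g by (simp add: gam_Suc field_simps)
  ultimately show ?case by (simp del: nat_pow_Suc)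
qed

abbreviation Wd :: "'v list \<Rightarrow> ('g, 'v) word" where "Wd v \<equiv> map (Pair g) v"

text \<open>Words that are not good vanish in \<open>T(V)\<close>, since \<open>V\<^sub>h = 0\<close> for \<open>h \<noteq> g\<close>.\<close>

abbreviation good :: "('g, 'v) word \<Rightarrow> bool" where "good w \<equiv> (\<forall>p\<in>set w. fst p = g)"

lemma good_Wd: "good w \<Longrightarrow> w = Wd (map snd w)"
  by (induction w) (auto simp: prod_eq_iff)

lemma Wd_words [simp]: "Wd v \<in> words G V"
  using g by (auto simp: words_def comp_g)

lemma words_append [simp]: "u @ w \<in> words G V \<longleftrightarrow> u \<in> words G V \<and> w \<in> words G V"
  by (auto simp: words_def)

lemma words_Cons [simp]: "(h, x) # w \<in> words G V \<longleftrightarrow> h \<in> carrier G \<and> x \<in> comp V h \<and> w \<in> words G V"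
  by (auto simp: words_def)

lemma words_Nil [simp]: "[] \<in> words G V" by (simp add: words_def)

lemma wdeg_snoc: "wdeg G (w @ [p]) = wdeg G w \<otimes> fst p"
  by (simp add: wdeg_def)

lemma wdeg_Nil [simp]: "wdeg G [] = \<one>" by (simp add: wdeg_def)

lemma wdeg_closed: "w \<in> words G V \<Longrightarrow> wdeg G w \<in> carrier G"
proof (induction w rule: rev_induct)
  case (snoc p w)
  then show ?case by (cases p) (simp add: wdeg_snoc)
qed simp

lemma wdeg_Wd [simp]: "wdeg G (Wd v) = gp (length v)"
  by (induction v rule: rev_induct) (simp_all add: wdeg_snoc)

definition multilin :: "('v list \<Rightarrow> 'k) \<Rightarrow> bool" where
  "multilin f \<longleftrightarrow> (\<forall>u w x y. f (u @ (x + y) # w) = f (u @ x # w) + f (u @ y # w)) \<and>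
     (\<forall>u w c x. f (u @ scal V c x # w) = c * f (u @ x # w))"

lemma multilin_len: "multilin f \<Longrightarrow> multilin (\<lambda>v. \<kappa> (length v) * f v)"
  by (simp add: multilin_def algebra_simps)

lemma multilin_add: "multilin f \<Longrightarrow> multilin h \<Longrightarrow> multilin (\<lambda>v. f v + h v)"
  by (simp add: multilin_def algebra_simps)

lemma multilin_0: "multilin (\<lambda>v. 0)"
  by (simp add: multilin_def)

lemma multilin_app: "multilin f \<Longrightarrow> multilin (\<lambda>v. f (u @ v))" "multilin f \<Longrightarrow> multilin (\<lambda>v. f (v @ u))"
  by (simp_all add: multilin_def flip: append_assoc) (simp add: multilin_def)

lemma multilin_rev: "multilin f \<Longrightarrow> multilin (\<lambda>v. f (rev v))"
  by (simp add: multilin_def)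

lemma multilin_map: "multilin f \<Longrightarrow> e \<in> carrier G \<Longrightarrow> multilin (\<lambda>v. f (map (act V e) v))"
  by (simp add: multilin_def act_add act_scale)

lemma multilin_ap: "(\<And>w. multilin (\<lambda>v. f v w)) \<Longrightarrow> multilin (\<lambda>v. ap p (f v))"
proof -
  assume "\<And>w. multilin (\<lambda>v. f v w)"
  then have "f (u @ (x + y) # w) = (\<lambda>z. f (u @ x # w) z + f (u @ y # w) z)"
    "f (u @ scal V c x # w) = (\<lambda>z. c * f (u @ x # w) z)" for u w x y c
    by (auto simp: multilin_def intro!: HOL.ext)
  then show ?thesis by (simp add: multilin_def ap_fun_add ap_fun_scale)
qed

lemma MF_bad:
  assumes \<phi>: "\<phi> \<in> MF" and w: "w \<in> words G V" "\<not> good w"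
  shows "\<phi> w = 0"
proof -
  obtain u h v w' where e: "w = u @ (h, v) # w'" and h: "h \<noteq> g"
    using w(2) by (metis in_set_conv_decomp prod.collapse)
  then have m: "u \<in> words G V" "w' \<in> words G V" "h \<in> carrier G" "v \<in> comp V h" using w(1) by simp_all
  then have v: "v = scal V 0 v" using comp_other h by simp
  have "\<phi> (u @ (h, scal V 0 v) # w') = 0 * \<phi> (u @ (h, v) # w')"
    using \<phi> m unfolding multilinear_forms_def by blast
  then show ?thesis using e v by simp
qed

lemma MF_multilin: "\<phi> \<in> MF \<Longrightarrow> u \<in> words G V \<Longrightarrow> w \<in> words G V \<Longrightarrow> multilin (\<lambda>v. \<phi> (u @ Wd v @ w))"
proof -
  assume \<phi>: "\<phi> \<in> MF" and u: "u \<in> words G V" and w: "w \<in> words G V"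
  have a: "\<phi> (u' @ (g, x + y) # w') = \<phi> (u' @ (g, x) # w') + \<phi> (u' @ (g, y) # w')"
    "\<phi> (u' @ (g, scal V c x) # w') = c * \<phi> (u' @ (g, x) # w')"
    if "u' \<in> words G V" "w' \<in> words G V" for u' w' x y c
    using \<phi> that g unfolding multilinear_forms_def by (auto simp: comp_g)
  show ?thesis
    using a[of "u @ Wd _" "Wd _ @ w"] u w by (simp add: multilin_def)
qed

lemma MF_mlf': "\<phi> \<in> MF \<Longrightarrow> multilin (\<lambda>v. \<phi> (Wd v))"
  using MF_multilin[of \<phi> "[]" "[]"] by simp

lemma MFI:
  assumes bad: "\<And>w. w \<in> words G V \<Longrightarrow> \<not> good w \<Longrightarrow> \<phi> w = 0" and m: "multilin (\<lambda>v. \<phi> (Wd v))"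
  shows "\<phi> \<in> MF"
proof -
  have "(x \<in> comp V h \<longrightarrow> y \<in> comp V h \<longrightarrow> \<phi> (u @ (h, x + y) # w) = \<phi> (u @ (h, x) # w) + \<phi> (u @ (h, y) # w))
    \<and> (x \<in> comp V h \<longrightarrow> \<phi> (u @ (h, scal V c x) # w) = c * \<phi> (u @ (h, x) # w))"
    if uw: "u \<in> words G V" "w \<in> words G V" and h: "h \<in> carrier G" for u w h x y c
  proof (cases "good u \<and> good w \<and> h = g")
    case True
    then obtain u' w' where u': "u = Wd u'" and w': "w = Wd w'" using good_Wd by blast
    have "multilin (\<lambda>v. \<phi> (Wd v))" by (rule m)
    then have "\<phi> (Wd (u' @ (x + y) # w')) = \<phi> (Wd (u' @ x # w')) + \<phi> (Wd (u' @ y # w'))"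
      "\<phi> (Wd (u' @ scal V c x # w')) = c * \<phi> (Wd (u' @ x # w'))" by (simp_all only: multilin_def)
    then show ?thesis using True u' w' by simp
  next
    case False
    have "x \<in> comp V h \<Longrightarrow> y \<in> comp V h \<Longrightarrow> x + y \<in> comp V h" "x \<in> comp V h \<Longrightarrow> scal V c x \<in> comp V h"
      using comp_subspace[OF h] by (simp_all add: vs.subspace_add vs.subspace_scale)
    moreover have "\<phi> (u @ (h, t) # w) = 0" if "t \<in> comp V h" for t
    proof (rule bad)
      show "\<not> good (u @ (h, t) # w)" using False by auto
    qed (use uw h that in simp)
    ultimately show ?thesis by simp
  qed
  then show ?thesis unfolding multilinear_forms_def by blast
qed

definition ext :: "('v list \<Rightarrow> 'k) \<Rightarrow> ('g, 'v) word \<Rightarrow> 'k" where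
  "ext f w = (if good w then f (map snd w) else 0)"

lemma ext_Wd [simp]: "ext f (Wd v) = f v"
  by (simp add: ext_def o_def)

lemma ext_MF: "multilin f \<Longrightarrow> ext f \<in> MF"
  by (rule MFI) (auto simp: ext_def o_def)

text \<open>The linear map from the free algebra on the set of all vectors onto \<open>T(V)\<close>,
  see \<open>carrier_TA\<close>. It respects products only up to the scalars \<open>gam\<close>, see
  \<open>tmult_iota\<close>.\<close>

definition iota :: "('v, 'k) falg \<Rightarrow> ('g, 'v, 'k) tens" where
  "iota p = functional_on MF (\<lambda>\<phi>. ap p (\<lambda>v. \<phi> (Wd v)))"

lemma iota_MF: "\<phi> \<in> MF \<Longrightarrow> iota p \<phi> = ap p (\<lambda>v. \<phi> (Wd v))"
  by (simp add: iota_def functional_on_def)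

lemma iota_not_MF: "\<phi> \<notin> MF \<Longrightarrow> iota p \<phi> = 0"
  by (simp add: iota_def functional_on_def)

lemma iota_ext: "multilin f \<Longrightarrow> iota p (ext f) = ap p f"
  by (simp add: iota_MF ext_MF)

lemma TA_simps [simp]:
  "\<zero>\<^bsub>TA\<^esub> = (\<lambda>\<phi>. 0)" "x \<oplus>\<^bsub>TA\<^esub> y = (\<lambda>\<phi>. x \<phi> + y \<phi>)" "c \<odot>\<^bsub>TA\<^esub> x = (\<lambda>\<phi>. c * x \<phi>)"
  "x \<otimes>\<^bsub>TA\<^esub> y = tmult G \<Phi> V x y" "\<one>\<^bsub>TA\<^esub> = tword G V []"
  by (simp_all add: tensor_algebra_def functional_algebra_def Let_def)

lemma iota_add: "iota (p + r) = (\<lambda>\<phi>. iota p \<phi> + iota r \<phi>)"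
  by (rule ext) (simp add: iota_def functional_on_def ap_add)

lemma iota_sc: "iota (sc c p) = (\<lambda>\<phi>. c * iota p \<phi>)"
  by (rule ext) (simp add: iota_def functional_on_def ap_sc)

lemma iota_0: "iota 0 = (\<lambda>\<phi>. 0)"
  by (rule ext) (simp add: iota_def functional_on_def)

lemma iota_wrd: "iota (wrd v) = tword G V (Wd v)"
  by (simp add: iota_def tword_def)

lemma tword_bad: "w \<in> words G V \<Longrightarrow> \<not> good w \<Longrightarrow> tword G V w = (\<lambda>\<phi>. 0)"
  by (rule ext) (simp add: tword_def functional_on_def MF_bad)

lemma tword_iota: "w \<in> words G V \<Longrightarrow> tword G V w = iota (if good w then wrd (map snd w) else 0)"
  using good_Wd[of w] by (auto simp: iota_wrd tword_bad iota_0)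

lemma lin_span_TA_iota:
  assumes "P (0 :: ('v, 'k) falg)" "\<And>p r. P p \<Longrightarrow> P r \<Longrightarrow> P (p + r)" "\<And>p c. P p \<Longrightarrow> P (sc c p)"
    and "\<And>x. x \<in> S \<Longrightarrow> \<exists>p. P p \<and> x = iota p"
  shows "x \<in> lin_span TA S \<Longrightarrow> \<exists>p. P p \<and> x = iota p"
proof (induction rule: lin_span.induct)
  case zero
  then show ?case using assms(1) iota_0 by auto
next
  case (base x)
  then show ?case using assms(4) by blast
next
  case (add x y)
  then obtain p r where "P p" "x = iota p" "P r" "y = iota r" by blast
  then show ?case using assms(2) by (intro exI[of _ "p + r"]) (simp add: iota_add)
next
  case (smult x c)
  then obtain p where "P p" "x = iota p" by blast
  then show ?case using assms(3) by (intro exI[of _ "sc c p"]) (simp add: iota_sc)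
qed

lemma iota_lin_span:
  assumes "\<And>m. m \<in> Poly_Mapping.keys p \<Longrightarrow> iota (wrd (letters m)) \<in> lin_span TA S"
  shows "iota p \<in> lin_span TA S"
proof -
  have "iota (\<Sum>m\<in>Poly_Mapping.keys p. sc (Poly_Mapping.lookup p m) (wrd (letters m))) \<in> lin_span TA S"
  proof (rule falg_sum_induct)
    show "iota 0 \<in> lin_span TA S" using lin_span.zero[of TA S] by (simp add: iota_0)
  next
    fix p r assume "iota p \<in> lin_span TA S" "iota r \<in> lin_span TA S"
    then show "iota (p + r) \<in> lin_span TA S" using lin_span.add[of _ TA S] by (fastforce simp: iota_add)
  next
    fix m assume "m \<in> Poly_Mapping.keys p"
    then show "iota (sc (Poly_Mapping.lookup p m) (wrd (letters m))) \<in> lin_span TA S"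
      using lin_span.smult[OF assms[of m]] by (simp add: iota_sc)
  qed
  then show ?thesis by (simp flip: falg_expand)
qed

lemma carrier_TA: "carrier TA = range iota"
proof -
  have c: "carrier TA = lin_span TA (tword G V ` words G V)"
  proof -
    \<comment> \<open>The definition forms the span in the record with carrier \<open>UNIV\<close>.
      Spans depend only on zero, addition and scalar multiplication, so the restricted record gives
      the same set.\<close>
    have "lin_span A S = lin_span B S" if "zero A = zero B" "add A = add B" "module.smult A = module.smult B"
      for A B :: "('k, ('g, 'v, 'k) tens) module" and S
    proof -
      have "lin_span A S \<subseteq> lin_span B S" by (rule lin_span_least) (auto simp: that intro: lin_span.intros)
      moreover have "lin_span B S \<subseteq> lin_span A S" by (rule lin_span_least) (auto simp: that[symmetric] intro: lin_span.intros)
      ultimately show ?thesis by blast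
    qed
    note eq = this
    show ?thesis
      unfolding tensor_algebra_def functional_algebra_def Let_def
      by (simp, rule eq) simp_all
  qed
  have "\<exists>p. True \<and> x = iota p" if "x \<in> lin_span TA (tword G V ` words G V)" for x
    by (rule lin_span_TA_iota[OF _ _ _ _ that]) (auto simp: tword_iota)
  moreover have "iota p \<in> lin_span TA (tword G V ` words G V)" for p
    by (rule iota_lin_span) (auto simp: iota_wrd intro!: lin_span.base)
  ultimately show ?thesis unfolding c by auto
qed

definition Lin :: "('v \<Rightarrow> 'k) set" where
  "Lin = {f. (\<forall>x y. f (x + y) = f x + f y) \<and> (\<forall>c x. f (scal V c x) = c * f x)}"

lemma multilin_phi: "set F \<subseteq> Lin \<Longrightarrow> multilin (phi F)"
proof (induction F)
  case Nil
  then show ?case by (simp add: multilin_def phi_Nil)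
next
  case (Cons f F)
  have f: "f (x + y) = f x + f y" "f (scal V c x) = c * f x" for x y c using Cons.prems by (auto simp: Lin_def)
  have m: "phi F (u @ (x + y) # w) = phi F (u @ x # w) + phi F (u @ y # w)"
    "phi F (u @ scal V c x # w) = c * phi F (u @ x # w)" for u w x y c
    using Cons by (simp_all add: multilin_def)
  have m': "phi F (u @ a # u' @ (x + y) # w) = phi F (u @ a # u' @ x # w) + phi F (u @ a # u' @ y # w)"
    "phi F (u @ a # u' @ scal V c x # w) = c * phi F (u @ a # u' @ x # w)"
    "phi F (u @ (x + y) # w @ w') = phi F (u @ x # w @ w') + phi F (u @ y # w @ w')" for u u' w w' a x y c
    using m[of "u @ a # u'"] m[of u] by simp_all
  show ?case
    unfolding multilin_def
    by (auto simp: phi_Cons ap_delw_append ap_delw_Cons f m m' ap_fun_add ap_fun_scale algebra_simps)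
qed

definition I0 :: "('g, 'v, 'k) tens set" where
  "I0 = iota ` rad Lin"

lemma iota_phi: "set F \<subseteq> Lin \<Longrightarrow> iota p (ext (phi F)) = ap p (phi F)"
  by (simp add: iota_ext multilin_phi)

text \<open>For linear forms the functionals \<open>phi F\<close> are multilinear and thus factor
  through \<open>iota\<close>. Hence the kernel of \<open>iota\<close> lies in the radical, and
  membership can be tested on any preimage.\<close>

lemma iota_I0: "iota p \<in> I0 \<longleftrightarrow> p \<in> rad Lin"
proof
  assume "iota p \<in> I0"
  then obtain r where r: "r \<in> rad Lin" "iota p = iota r" by (auto simp: I0_def)
  then have "ap p (phi F) = ap r (phi F)" if "set F \<subseteq> Lin" for F
    using iota_phi[OF that] by metis
  then show "p \<in> rad Lin" using r(1) by (simp add: rad_def)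
qed (simp add: I0_def)

lemma concat_coeff_Wd: "concat_coeff G \<Phi> u (Wd v) = (\<Prod>i<length v. \<Phi> (wdeg G u) (gp i) g)"
  unfolding concat_coeff_def by (simp add: take_map[symmetric] min_def) (simp add: take_map)

lemma concat_coeff_Wd2: "concat_coeff G \<Phi> (Wd u) (Wd v) = gam (length u) (length v)"
  by (simp add: concat_coeff_Wd gam_def)

text \<open>Lift of the product of \<open>T(V)\<close> along \<open>iota\<close>.\<close>

definition tm :: "('v, 'k) falg \<Rightarrow> ('v, 'k) falg \<Rightarrow> ('v, 'k) falg" where
  "tm p r = bind p (\<lambda>u. bind r (\<lambda>w. sc (gam (length u) (length w)) (wrd (u @ w))))"

lemma ap_tm: "ap (tm p r) f = ap p (\<lambda>u. ap r (\<lambda>w. gam (length u) (length w) * f (u @ w)))"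
  by (simp add: tm_def ap_bind ap_sc)

lemma concat_form_MF:
  assumes "\<phi> \<in> MF" "u \<in> words G V"
  shows "(\<lambda>w. concat_coeff G \<Phi> u w * \<phi> (u @ w)) \<in> MF"
proof (rule MFI)
  fix w assume "w \<in> words G V" "\<not> good w"
  then have "\<phi> (u @ w) = 0" using assms by (intro MF_bad) auto
  then show "concat_coeff G \<Phi> u w * \<phi> (u @ w) = 0" by simp
next
  show "multilin (\<lambda>v. concat_coeff G \<Phi> u (Wd v) * \<phi> (u @ Wd v))"
    unfolding concat_coeff_Wd using MF_multilin[OF assms, of "[]"]
    by (intro multilin_len[where \<kappa> = "\<lambda>n. \<Prod>i<n. \<Phi> (wdeg G u) (gp i) g"]) simp
qed

lemma tmult_iota: "tmult G \<Phi> V (iota p) (iota r) = iota (tm p r)"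
proof (rule ext)
  fix \<phi>
  show "tmult G \<Phi> V (iota p) (iota r) \<phi> = iota (tm p r) \<phi>"
  proof (cases "\<phi> \<in> MF")
    case True
    let ?\<Theta> = "\<lambda>u. iota r (\<lambda>w. concat_coeff G \<Phi> u w * \<phi> (u @ w))"
    have \<Theta>: "?\<Theta> u = ap r (\<lambda>v. concat_coeff G \<Phi> u (Wd v) * \<phi> (u @ Wd v))" if "u \<in> words G V" for u
      by (rule iota_MF[OF concat_form_MF[OF True that]])
    have \<Theta>W: "?\<Theta> (Wd u) = ap r (\<lambda>v. gam (length u) (length v) * \<phi> (Wd (u @ v)))" for u
      by (simp add: \<Theta> concat_coeff_Wd2)
    have "?\<Theta> \<in> MF"
    proof (rule MFI)
      fix w assume "w \<in> words G V" "\<not> good w"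
      then have "\<phi> (w @ Wd v) = 0" for v by (intro MF_bad[OF True]) auto
      then show "?\<Theta> w = 0" using \<open>w \<in> words G V\<close> by (simp add: \<Theta>)
    next
      show "multilin (\<lambda>v. ?\<Theta> (Wd v))" unfolding \<Theta>W
        by (intro multilin_ap multilin_len[where \<kappa> = "\<lambda>n. gam n (length _)"] multilin_app MF_mlf' True)
    qed
    then show ?thesis using True by (simp add: tmult_def functional_on_def iota_MF \<Theta>W ap_tm)
  qed (simp add: tmult_def functional_on_def iota_not_MF)
qed

definition acf :: "'g \<Rightarrow> nat \<Rightarrow> 'k" where
  "acf e n = (\<Prod>i<n. slice \<Phi> e (gp i) g)"

lemma act_coeff_Wd: "act_coeff G \<Phi> e (Wd v) = acf e (length v)"
  unfolding act_coeff_def acf_def by (simp add: take_map[symmetric] min_def) (simp add: take_map)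

lemma act_word_Wd: "act_word V e (Wd v) = Wd (map (act V e) v)"
  by (simp add: act_word_def)

lemma act_word_words: "e \<in> carrier G \<Longrightarrow> w \<in> words G V \<Longrightarrow> act_word V e w \<in> words G V"
  using yd by (force simp: words_def act_word_def twisted_yd_module_def)

lemma act_word_good: "good (act_word V e w) \<longleftrightarrow> good w"
  by (force simp: act_word_def)

lemma tact_iota:
  assumes "e \<in> carrier G"
  shows "tact G \<Phi> V e (iota p) = iota (bind p (\<lambda>v. sc (acf e (length v)) (wrd (map (act V e) v))))"
proof (rule ext)
  fix \<phi>
  show "tact G \<Phi> V e (iota p) \<phi> = iota (bind p (\<lambda>v. sc (acf e (length v)) (wrd (map (act V e) v)))) \<phi>"
  proof (cases "\<phi> \<in> MF")
    case True
    have "(\<lambda>w. act_coeff G \<Phi> e w * \<phi> (act_word V e w)) \<in> MF"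
    proof (rule MFI)
      fix w assume "w \<in> words G V" "\<not> good w"
      then show "act_coeff G \<Phi> e w * \<phi> (act_word V e w) = 0"
        using MF_bad[OF True act_word_words[OF assms]] act_word_good by simp
    next
      show "multilin (\<lambda>v. act_coeff G \<Phi> e (Wd v) * \<phi> (act_word V e (Wd v)))"
        unfolding act_coeff_Wd act_word_Wd by (intro multilin_len[where \<kappa> = "acf e"] multilin_map[OF MF_mlf'] True assms)
    qed
    then show ?thesis using True
      by (simp add: tact_def functional_on_def iota_MF act_coeff_Wd act_word_Wd ap_bind ap_sc)
  qed (simp add: tact_def functional_on_def iota_not_MF)
qed

lemma counit_iota: "counit (iota p) = ap p (phi [])"
proof -
  have "(\<lambda>w. if w = [] then 1 else 0) = ext (phi [])"
    by (rule ext) (auto simp: ext_def phi_Nil)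
  then show ?thesis by (simp add: counit_def iota_phi)
qed

section \<open>The coproduct of the tensor algebra\<close>

definition bimultilin :: "('v list \<Rightarrow> 'v list \<Rightarrow> 'k) \<Rightarrow> bool" where
  "bimultilin \<chi> \<longleftrightarrow> (\<forall>b. multilin (\<lambda>a. \<chi> a b)) \<and> (\<forall>a. multilin (\<lambda>b. \<chi> a b))"

lemma bimultilin_len: "bimultilin \<chi> \<Longrightarrow> bimultilin (\<lambda>a b. \<kappa> (length a) (length b) * \<chi> a b)"
  by (simp add: bimultilin_def multilin_def algebra_simps)

lemma bimultilin_add: "bimultilin \<chi> \<Longrightarrow> bimultilin \<psi> \<Longrightarrow> bimultilin (\<lambda>a b. \<chi> a b + \<psi> a b)"
  by (simp add: bimultilin_def multilin_add)

lemma bimultilin_app: "bimultilin \<chi> \<Longrightarrow> bimultilin (\<lambda>a b. \<chi> (u @ a @ u') (w @ b @ w'))"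
  by (simp add: bimultilin_def multilin_def) (simp flip: append_assoc)

lemma multilin_sh: "bimultilin \<chi> \<Longrightarrow> multilin (\<lambda>v. sh v \<chi>)"
proof -
  have "(bimultilin \<chi> \<longrightarrow> sh (u @ (x + y) # w) \<chi> = sh (u @ x # w) \<chi> + sh (u @ y # w) \<chi>)
     \<and> (bimultilin \<chi> \<longrightarrow> sh (u @ scal V c x # w) \<chi> = c * sh (u @ x # w) \<chi>)" for u w x y c
  proof (induction u arbitrary: \<chi>)
    case Nil
    {
      assume "bimultilin \<chi>"
      then have e: "\<chi> ((x + y) # a) b = \<chi> (x # a) b + \<chi> (y # a) b" "\<chi> a ((x + y) # b) = \<chi> a (x # b) + \<chi> a (y # b)"
        "\<chi> (scal V c x # a) b = c * \<chi> (x # a) b" "\<chi> a (scal V c x # b) = c * \<chi> a (x # b)" for a b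
        unfolding bimultilin_def multilin_def by (metis append_Nil)+
      have "sh ((x + y) # w) \<chi> = sh (x # w) \<chi> + sh (y # w) \<chi>"
        by (simp add: e sh_add[symmetric] algebra_simps)
      moreover have "sh (scal V c x # w) \<chi> = c * sh (x # w) \<chi>"
        by (simp add: e sh_scale[symmetric] algebra_simps)
      note this calculation
    }
    then show ?case by simp
  next
    case (Cons z u)
    have "bimultilin (\<lambda>a b. \<chi> (z # a) b + q ^ length a * \<chi> a (z # b))" if "bimultilin \<chi>"
      using bimultilin_add[OF bimultilin_app[OF that, of "[z]" "[]" "[]" "[]"]
        bimultilin_len[OF bimultilin_app[OF that, of "[]" "[]" "[z]" "[]"], of "\<lambda>m n. q ^ m"]] by simp
    then show ?case using Cons.IH by simp
  qed
  then show "bimultilin \<chi> \<Longrightarrow> multilin (\<lambda>v. sh v \<chi>)" by (simp add: multilin_def)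
qed

lemma BMFI:
  assumes bad: "\<And>a b. a \<in> words G V \<Longrightarrow> b \<in> words G V \<Longrightarrow> \<not> (good a \<and> good b) \<Longrightarrow> \<psi> (a, b) = 0"
    and m: "bimultilin (\<lambda>a b. \<psi> (Wd a, Wd b))"
  shows "\<psi> \<in> BMF"
proof -
  have "(\<lambda>a. \<psi> (a, b)) \<in> MF" if b: "b \<in> words G V" for b
  proof (rule MFI)
    show "multilin (\<lambda>v. \<psi> (Wd v, b))"
    proof (cases "good b")
      case True
      then show ?thesis using good_Wd[of b] m unfolding bimultilin_def by metis
    next
      case False
      then have "(\<lambda>v. \<psi> (Wd v, b)) = (\<lambda>v. 0)" by (intro HOL.ext bad b) auto
      then show ?thesis by (simp add: multilin_0)
    qed
  qed (rule bad, use b in auto)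
  moreover have "(\<lambda>b. \<psi> (a, b)) \<in> MF" if a: "a \<in> words G V" for a
  proof (rule MFI)
    show "multilin (\<lambda>v. \<psi> (a, Wd v))"
    proof (cases "good a")
      case True
      then show ?thesis using good_Wd[of a] m unfolding bimultilin_def by metis
    next
      case False
      then have "(\<lambda>v. \<psi> (a, Wd v)) = (\<lambda>v. 0)" by (intro HOL.ext bad a) auto
      then show ?thesis by (simp add: multilin_0)
    qed
  qed (rule bad, use a in auto)
  ultimately show ?thesis by (simp add: bimultilinear_forms_def)
qed

lemma BMF_left: "\<psi> \<in> BMF \<Longrightarrow> b \<in> words G V \<Longrightarrow> (\<lambda>a. \<psi> (a, b)) \<in> MF"
  and BMF_right: "\<psi> \<in> BMF \<Longrightarrow> a \<in> words G V \<Longrightarrow> (\<lambda>b. \<psi> (a, b)) \<in> MF"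
  by (simp_all add: bimultilinear_forms_def)

lemma BMF_bad: "\<psi> \<in> BMF \<Longrightarrow> a \<in> words G V \<Longrightarrow> b \<in> words G V \<Longrightarrow> \<not> (good a \<and> good b) \<Longrightarrow> \<psi> (a, b) = 0"
  using MF_bad[OF BMF_left[of \<psi> b], of a] MF_bad[OF BMF_right[of \<psi> a], of b] by blast

lemma BMF_bimultilin: "\<psi> \<in> BMF \<Longrightarrow> bimultilin (\<lambda>a b. \<psi> (Wd a, Wd b))"
  by (simp add: bimultilin_def MF_mlf'[OF BMF_left] MF_mlf'[OF BMF_right])

definition ext2 :: "('v list \<Rightarrow> 'v list \<Rightarrow> 'k) \<Rightarrow> ('g, 'v) word \<times> ('g, 'v) word \<Rightarrow> 'k" where
  "ext2 \<chi> = (\<lambda>(a, b). if good a \<and> good b then \<chi> (map snd a) (map snd b) else 0)"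

lemma ext2_Wd [simp]: "ext2 \<chi> (Wd a, Wd b) = \<chi> a b"
  by (simp add: ext2_def o_def)

lemma ext2_BMF: "bimultilin \<chi> \<Longrightarrow> ext2 \<chi> \<in> BMF"
  by (rule BMFI) (auto simp: ext2_def o_def)

lemma pure_iota:
  assumes \<psi>: "\<psi> \<in> BMF"
  shows "pure_tensor G V (iota p) (iota r) \<psi> = ap p (\<lambda>a. ap r (\<lambda>b. \<psi> (Wd a, Wd b)))"
proof -
  have \<Theta>: "iota r (\<lambda>b. \<psi> (a, b)) = ap r (\<lambda>b. \<psi> (a, Wd b))" if "a \<in> words G V" for a
    by (rule iota_MF[OF BMF_right[OF \<psi> that]])
  have "(\<lambda>a. iota r (\<lambda>b. \<psi> (a, b))) \<in> MF"
  proof (rule MFI)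
    fix a assume a: "a \<in> words G V" "\<not> good a"
    then show "iota r (\<lambda>b. \<psi> (a, b)) = 0" using BMF_bad[OF \<psi> a(1)] by (simp add: \<Theta>)
  next
    show "multilin (\<lambda>a. iota r (\<lambda>b. \<psi> (Wd a, b)))"
      using BMF_bimultilin[OF \<psi>] by (simp add: \<Theta> bimultilin_def multilin_ap)
  qed
  then show ?thesis using \<psi> by (simp add: pure_tensor_def functional_on_def iota_MF \<Theta>)
qed

lemma pure_not_BMF: "\<psi> \<notin> BMF \<Longrightarrow> pure_tensor G V x y \<psi> = 0"
  by (simp add: pure_tensor_def functional_on_def)

lemma TA2_simps [simp]:
  "\<zero>\<^bsub>TA2\<^esub> = (\<lambda>\<phi>. 0)" "x \<oplus>\<^bsub>TA2\<^esub> y = (\<lambda>\<phi>. x \<phi> + y \<phi>)" "c \<odot>\<^bsub>TA2\<^esub> x = (\<lambda>\<phi>. c * x \<phi>)"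
  by (simp_all add: tensor_algebra2_def functional_algebra_def Let_def)

text \<open>The closed form of the coproduct of a word, to be proved in
  \<open>comult_word_eval\<close>: the \<open>q\<close>-unshuffle with each component divided by its
  rebracketing scalar.\<close>

definition comult_form :: "'v list \<Rightarrow> (('g, 'v) word \<times> ('g, 'v) word \<Rightarrow> 'k) \<Rightarrow> 'k" where
  "comult_form v \<psi> = sh v (\<lambda>a b. inverse (gam (length a) (length b)) * \<psi> (Wd a, Wd b))"

abbreviation letter_comult :: "'g \<times> 'v \<Rightarrow> ('g, 'v, 'k) tens2" where
  "letter_comult p \<equiv> pure_tensor G V (tword G V [p]) (tword G V []) \<oplus>\<^bsub>TA2\<^esub> pure_tensor G V (tword G V []) (tword G V [p])"

text \<open>Pairing the product of a word pair \<open>(a, b)\<close> with \<open>x\<close> in \<open>T(V) \<otimes> T(V)\<close> against \<open>\<psi>\<close> amounts to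
  pairing \<open>x\<close> against this form.\<close>

abbreviation mult2_form :: "(('g, 'v) word \<times> ('g, 'v) word \<Rightarrow> 'k) \<Rightarrow> ('g, 'v) word \<Rightarrow> ('g, 'v) word \<Rightarrow>
    ('g, 'v) word \<times> ('g, 'v) word \<Rightarrow> 'k" where
  "mult2_form \<psi> a b \<equiv> (\<lambda>(c, d). interchange_coeff G \<Phi> (wdeg G a) (wdeg G b) (wdeg G c) (wdeg G d) *
        act_coeff G \<Phi> (wdeg G b) c *
        concat_coeff G \<Phi> a (act_word V (wdeg G b) c) * concat_coeff G \<Phi> b d *
        \<psi> (a @ act_word V (wdeg G b) c, b @ d))"

lemma letter_comult_eval:
  assumes "\<psi> \<in> BMF" "[p] \<in> words G V"
  shows "letter_comult p \<psi> = (if fst p = g then \<psi> ([p], []) + \<psi> ([], [p]) else 0)"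
proof -
  obtain h x where p: "p = (h, x)" by (cases p)
  have 0: "tword G V [] = iota (wrd [])" by (simp add: iota_wrd)
  have tp: "tword G V [(h, x)] = iota (if h = g then wrd [x] else 0)"
    using tword_iota[of "[p]"] assms(2) by (simp add: p)
  show ?thesis
    unfolding p fst_conv TA2_simps tp 0 pure_iota[OF assms(1)] by simp
qed

lemma mult2_form_BMF:
  assumes \<psi>: "\<psi> \<in> BMF" and a: "a \<in> words G V" and b: "b \<in> words G V"
  shows "mult2_form \<psi> a b \<in> BMF"
proof (rule BMFI)
  fix c d assume c: "c \<in> words G V" and d: "d \<in> words G V" and bad: "\<not> (good c \<and> good d)"
  have "act_word V (wdeg G b) c \<in> words G V" by (rule act_word_words[OF wdeg_closed[OF b] c])
  moreover have "\<not> (good (a @ act_word V (wdeg G b) c) \<and> good (b @ d))"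
    using bad act_word_good[of "wdeg G b" c] by auto
  ultimately have "\<psi> (a @ act_word V (wdeg G b) c, b @ d) = 0"
    using a b d by (intro BMF_bad[OF \<psi>]) simp_all
  then show "mult2_form \<psi> a b (c, d) = 0" by simp
next
  let ?e = "wdeg G b"
  have e: "?e \<in> carrier G" by (rule wdeg_closed[OF b])
  have l: "multilin (\<lambda>c. \<psi> (a @ Wd (map (act V ?e) c), b @ Wd d))" for d
    using multilin_map[OF MF_multilin[OF BMF_left[OF \<psi>, of "b @ Wd d"] a words_Nil] e] b by simp
  have r: "multilin (\<lambda>d. \<psi> (a @ Wd (map (act V ?e) c), b @ Wd d))" for c
  proof -
    have "a @ Wd (map (act V ?e) c) \<in> words G V" using a by (simp only: words_append Wd_words)
    from MF_multilin[OF BMF_right[OF \<psi> this] b words_Nil] show ?thesis by (simp only: append_Nil2)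
  qed
  show "bimultilin (\<lambda>c d. mult2_form \<psi> a b (Wd c, Wd d))"
    unfolding split act_word_Wd act_coeff_Wd concat_coeff_Wd wdeg_Wd length_map
    by (rule bimultilin_len[where \<kappa> = "\<lambda>m n. interchange_coeff G \<Phi> (wdeg G a) ?e (gp m) (gp n) * acf ?e m *
      (\<Prod>i<m. \<Phi> (wdeg G a) (gp i) g) * (\<Prod>i<n. \<Phi> ?e (gp i) g)"]) (use l r in \<open>simp add: bimultilin_def\<close>)
qed

text \<open>The new letter either moves left past \<open>b\<close>, which costs the action of
  \<open>g ^ length b\<close> on it and two associators, or stays in the right factor, which costs
  one inverse associator.\<close>

lemma Theta_Wd:
  assumes \<psi>: "\<psi> \<in> BMF"
  shows "letter_comult (g, x) (mult2_form \<psi> (Wd a) (Wd b)) =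
    \<Phi> (gp (length a)) g (gp (length b)) / \<Phi> (gp (length a)) (gp (length b)) g * (q ^ length b / gam 1 (length b)) * \<psi> (Wd (a @ [x]), Wd b)
    + inverse (\<Phi> (gp (length a)) (gp (length b)) g) * \<psi> (Wd a, Wd (b @ [x]))"
proof -
  let ?m = "gp (length a)" and ?n = "gp (length b)"
  have x: "[(g, x)] \<in> words G V" using g by (simp add: comp_g)
  have wx: "wdeg G [(g, x)] = g" using g by (simp add: wdeg_def)
  have sl: "slice \<Phi> ?n \<one> g = 1" using g by (simp add: slice_def)
  have ac: "act_coeff G \<Phi> ?n [(g, x)] = 1" "act_coeff G \<Phi> ?n [] = 1"
    using sl by (simp_all add: act_coeff_def)
  have cc: "concat_coeff G \<Phi> (Wd u) [(g, y)] = 1" "concat_coeff G \<Phi> u' [] = 1" for u u' y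
    using g by (simp_all add: concat_coeff_def)
  have i1: "interchange_coeff G \<Phi> ?m ?n g \<one> = \<Phi> ?m g ?n / \<Phi> ?m ?n g"
    using g by (simp add: interchange_coeff_def field_simps)
  have i2: "interchange_coeff G \<Phi> ?m ?n \<one> g = inverse (\<Phi> ?m ?n g)"
    using g by (simp add: interchange_coeff_def)
  have ax: "act_word V ?n [(g, x)] = [(g, scal V (q ^ length b / gam 1 (length b)) x)]" "act_word V ?n [] = []"
    by (simp_all add: act_word_def act_gp)
  have lin: "\<psi> (Wd a @ [(g, scal V c x)], Wd b) = c * \<psi> (Wd (a @ [x]), Wd b)" for c
  proof -
    have "multilin (\<lambda>a. \<psi> (Wd a, Wd b))" using BMF_bimultilin[OF \<psi>] by (simp add: bimultilin_def)
    then have "\<psi> (Wd (a @ scal V c x # []), Wd b) = c * \<psi> (Wd (a @ x # []), Wd b)" unfolding multilin_def by blast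
    then show ?thesis by simp
  qed
  show ?thesis
    unfolding letter_comult_eval[OF mult2_form_BMF[OF \<psi> Wd_words Wd_words] x]
    by (simp add: wx ac cc i1 i2 ax lin)
qed

text \<open>A rearrangement of \<open>gam_shift\<close>. With \<open>gam_step2\<close> it turns the
  two cases of \<open>Theta_Wd\<close> into the recursion \<open>sh_snoc\<close>.\<close>

lemma gam_step1: "inverse (gam m n) * (\<Phi> (gp m) g (gp n) / \<Phi> (gp m) (gp n) g * (q ^ n / gam 1 n)) = q ^ n * inverse (gam (Suc m) n)"
proof -
  have nz: "gam m n \<noteq> 0" "\<Phi> (gp m) (gp n) g \<noteq> 0" "gam 1 n \<noteq> 0" "gam (Suc m) n \<noteq> 0"
    "\<Phi> (gp m) g (gp n) \<noteq> 0" using g by (simp_all add: gam_nz Phi_nz)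
  show ?thesis using gam_shift[of m n] nz by (simp add: field_simps del: nat_pow_Suc)
qed

lemma gam_step2: "inverse (gam m n) * inverse (\<Phi> (gp m) (gp n) g) = inverse (gam m (Suc n))"
  by (simp add: gam_Suc)

text \<open>The induction follows the last letter, because \<open>comult_word\<close> multiplies by
  letters from the right.\<close>

lemma comult_word_eval:
  "w \<in> words G V \<Longrightarrow> comult_word G \<Phi> V w = functional_on BMF (\<lambda>\<psi>. if good w then comult_form (map snd w) \<psi> else 0)"
proof (induction w rule: rev_induct)
  case Nil
  have 0: "tword G V [] = iota (wrd [])" by (simp add: iota_wrd)
  show ?case
    by (rule HOL.ext) (simp add: comult_word_def functional_on_def comult_form_def 0 pure_iota pure_not_BMF)
next
  case (snoc p w)
  obtain h x where p: "p = (h, x)" by (cases p)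
  have w: "w \<in> words G V" and pw: "[p] \<in> words G V" using snoc.prems p by simp_all
  have step: "comult_word G \<Phi> V (w @ [p]) = tmult2 G \<Phi> V (comult_word G \<Phi> V w) (letter_comult p)"
    by (simp add: comult_word_def)
  show ?case
  proof (rule HOL.ext)
    fix \<psi>
    show "comult_word G \<Phi> V (w @ [p]) \<psi> = functional_on BMF (\<lambda>\<psi>. if good (w @ [p]) then comult_form (map snd (w @ [p])) \<psi> else 0) \<psi>"
    proof (cases "\<psi> \<in> BMF")
      case False
      then show ?thesis by (simp add: step tmult2_def functional_on_def)
    next
      case \<psi>: True
      let ?\<Theta> = "\<lambda>(a, b). letter_comult p (mult2_form \<psi> a b)"
      have e: "comult_word G \<Phi> V (w @ [p]) \<psi> = comult_word G \<Phi> V w ?\<Theta>"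
        using \<psi> unfolding step tmult2_def functional_on_def by (simp only: if_True)
      have \<Theta>0: "?\<Theta> (a, b) = 0" if "a \<in> words G V" "b \<in> words G V" "\<not> (good a \<and> good b) \<or> h \<noteq> g" for a b
      proof -
        have "mult2_form \<psi> a b (c, d) = 0" if "c \<in> words G V" "d \<in> words G V" "\<not> (good a \<and> good b)" for c d
        proof -
          have "act_word V (wdeg G b) c \<in> words G V"
            by (rule act_word_words[OF wdeg_closed[OF \<open>b \<in> words G V\<close>] that(1)])
          then have "\<psi> (a @ act_word V (wdeg G b) c, b @ d) = 0"
            using that \<open>a \<in> words G V\<close> \<open>b \<in> words G V\<close> by (intro BMF_bad[OF \<psi>]) auto
          then show ?thesis by simp
        qed
        note z = this
        show ?thesis
        proof (cases "h = g")
          case True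
          then have bad: "\<not> (good a \<and> good b)" using that(3) by blast
          have "mult2_form \<psi> a b ([p], []) = 0" "mult2_form \<psi> a b ([], [p]) = 0"
            by (rule z[OF pw words_Nil bad], rule z[OF words_Nil pw bad])
          then have "letter_comult p (mult2_form \<psi> a b) = 0"
            unfolding letter_comult_eval[OF mult2_form_BMF[OF \<psi> that(1,2)] pw] by (simp only: add_0_right if_cancel)
          then show ?thesis by (simp only: split)
        next
          case False
          then show ?thesis unfolding split letter_comult_eval[OF mult2_form_BMF[OF \<psi> that(1,2)] pw] using p by simp
        qed
      qed
      show ?thesis
      proof (cases "good (w @ [p])")
        case False
        have "?\<Theta> \<in> BMF \<Longrightarrow> good w \<Longrightarrow> comult_form (map snd w) ?\<Theta> = 0"
        proof -
          assume "good w"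
          then have "h \<noteq> g" using False p by auto
          then have "?\<Theta> (Wd a, Wd b) = 0" for a b by (intro \<Theta>0) auto
          then show "comult_form (map snd w) ?\<Theta> = 0" by (simp add: comult_form_def)
        qed
        then show ?thesis using False unfolding e snoc.IH[OF w] by (auto simp: functional_on_def)
      next
        case True
        then have h: "h = g" and gw: "good w" using p by auto
        have \<Theta>W: "?\<Theta> (Wd a, Wd b) =
            \<Phi> (gp (length a)) g (gp (length b)) / \<Phi> (gp (length a)) (gp (length b)) g * (q ^ length b / gam 1 (length b)) * \<psi> (Wd (a @ [x]), Wd b)
            + inverse (\<Phi> (gp (length a)) (gp (length b)) g) * \<psi> (Wd a, Wd (b @ [x]))" for a b
          unfolding split p h by (rule Theta_Wd[OF \<psi>])
        \<comment> \<open>Functionals have the default value 0 outside \<open>BMF\<close>, so the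
          induction hypothesis says something about this form only after its multilinearity has been
          checked.\<close>
        have "?\<Theta> \<in> BMF"
        proof (rule BMFI)
          show "bimultilin (\<lambda>a b. ?\<Theta> (Wd a, Wd b))"
            unfolding \<Theta>W
            by (intro bimultilin_add
              bimultilin_len[where \<kappa> = "\<lambda>m n. \<Phi> (gp m) g (gp n) / \<Phi> (gp m) (gp n) g * (q ^ n / gam 1 n)"]
              bimultilin_len[where \<kappa> = "\<lambda>m n. inverse (\<Phi> (gp m) (gp n) g)"])
             (use bimultilin_app[OF BMF_bimultilin[OF \<psi>], of "[]" "[x]" "[]" "[]"] bimultilin_app[OF BMF_bimultilin[OF \<psi>], of "[]" "[]" "[]" "[x]"] in simp_all)
        qed (use \<Theta>0 in blast)
        then have "comult_word G \<Phi> V (w @ [p]) \<psi> = comult_form (map snd w) ?\<Theta>"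
          unfolding e snoc.IH[OF w] using gw by (simp add: functional_on_def)
        also have "\<dots> = sh (map snd w) (\<lambda>a b. q ^ length b * (inverse (gam (length (a @ [x])) (length b)) * \<psi> (Wd (a @ [x]), Wd b))
            + inverse (gam (length a) (length (b @ [x]))) * \<psi> (Wd a, Wd (b @ [x])))"
          unfolding comult_form_def \<Theta>W distrib_left mult.assoc[symmetric] 
          by (simp only: mult.assoc gam_step2[symmetric] length_append list.size add_0_right add_Suc_right)
            (simp only: mult.assoc[symmetric] gam_step1[symmetric, simplified mult.assoc[symmetric]] times_divide_eq_right)
        also have "\<dots> = comult_form (map snd (w @ [p])) \<psi>"
          unfolding comult_form_def by (simp only: map_append list.map p snd_conv sh_snoc)
        finally show ?thesis using True \<psi> by (simp add: functional_on_def)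
      qed
    qed
  qed
qed

lemma comult_form_multilin: "\<psi> \<in> BMF \<Longrightarrow> multilin (\<lambda>v. comult_form v \<psi>)"
  unfolding comult_form_def by (intro multilin_sh bimultilin_len[where \<kappa> = "\<lambda>m n. inverse (gam m n)"] BMF_bimultilin)

lemma comult_iota:
  assumes \<psi>: "\<psi> \<in> BMF"
  shows "comult G \<Phi> V (iota p) \<psi> = ap p (\<lambda>v. comult_form v \<psi>)"
proof -
  have eW: "comult_word G \<Phi> V (Wd v) \<psi> = comult_form v \<psi>" for v
    using \<psi> comult_word_eval[OF Wd_words, of v] by (simp add: functional_on_def o_def)
  have "(\<lambda>w. comult_word G \<Phi> V w \<psi>) \<in> MF"
  proof (rule MFI)
    fix w assume "w \<in> words G V" "\<not> good w"
    then show "comult_word G \<Phi> V w \<psi> = 0" using comult_word_eval[of w] by (auto simp: functional_on_def)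
  qed (simp add: eW comult_form_multilin \<psi>)
  then show ?thesis using \<psi> by (simp add: comult_def functional_on_def iota_MF eW)
qed

lemma comult_not_BMF: "\<psi> \<notin> BMF \<Longrightarrow> comult G \<Phi> V x \<psi> = 0"
  by (simp add: comult_def functional_on_def)

lemma bimultilin_phi: "set F \<subseteq> Lin \<Longrightarrow> multilin f \<Longrightarrow> bimultilin (\<lambda>a b. phi F a * f b)"
  using multilin_phi[of F] by (simp add: bimultilin_def multilin_def algebra_simps)

lemma comult_phi:
  assumes "set F \<subseteq> Lin" "multilin f" "\<And>v. length v \<noteq> n \<Longrightarrow> f v = 0"
  shows "comult G \<Phi> V (iota p) (ext2 (\<lambda>a b. phi F a * f b)) = inverse (gam (length F) n) * ap (DF F p) f"
proof -
  have "comult_form v (ext2 (\<lambda>a b. phi F a * f b)) = inverse (gam (length F) n) * ap (DF F (wrd v)) f" for v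
  proof -
    have "comult_form v (ext2 (\<lambda>a b. phi F a * f b)) = sh v (\<lambda>a b. inverse (gam (length F) n) * (phi F a * f b))"
      unfolding comult_form_def by (rule sh_cong) (use assms(3) phi_length[of F] in \<open>auto, metis\<close>)
    then show ?thesis by (simp add: sh_scale sh_phi_left)
  qed
  then have "comult G \<Phi> V (iota p) (ext2 (\<lambda>a b. phi F a * f b)) = ap p (\<lambda>v. inverse (gam (length F) n) * ap (DF F (wrd v)) f)"
    by (simp add: comult_iota ext2_BMF bimultilin_phi assms)
  also have "\<dots> = inverse (gam (length F) n) * ap (DF F p) f"
    by (induction p rule: falg_induct) (simp_all add: ap_add ap_sc DF_add DF_sc algebra_simps)
  finally show ?thesis .
qed

end

context skew
begin

lemma ap_fun_scale_right: "ap p (\<lambda>w. f w * c) = ap p f * c"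
  by (simp add: ap_fun_scale mult.commute[of _ c])

lemma phi_map: "phi F (map T v) = phi (map (\<lambda>f x. f (T x)) F) v"
proof (induction F arbitrary: v)
  case Nil
  then show ?case by (simp add: phi_Nil)
next
  case (Cons f F)
  have "ap (delw f (map T v)) \<phi> = ap (delw (\<lambda>x. f (T x)) v) (\<lambda>u. \<phi> (map T u))" for \<phi>
    by (induction v arbitrary: \<phi>) (simp_all add: ap_delw_Cons)
  then show ?case by (simp add: phi_Cons Cons.IH)
qed

lemma phi_single: "phi [f] [x] = f x"
  by (simp add: phi_Cons ap_delw_Cons phi_Nil)

lemma ap_phi_length: "ap p (\<lambda>v. \<kappa> (length v) * phi F v) = \<kappa> (length F) * ap p (phi F)"
proof -
  have "(\<lambda>v. \<kappa> (length v) * phi F v) = (\<lambda>v. \<kappa> (length F) * phi F v)"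
    by (rule HOL.ext) (metis mult_zero_right phi_length)
  then show ?thesis by (simp add: ap_fun_scale)
qed

section \<open>The antipode and the maximal Hopf ideal\<close>

text \<open>Equal to \<open>(-1)^n q^(n(n-1)/2)\<close>, the scalar with which the antipode reverses
  a word of length \<open>n\<close>.\<close>

primrec antipode_sign :: "nat \<Rightarrow> 'k" where
  "antipode_sign 0 = 1"
| "antipode_sign (Suc n) = - (q ^ n * antipode_sign n)"

text \<open>Already the two places for the first letter cancel: sent to the left it becomes the last
  letter of the reversed factor, and sent to the right it becomes the first letter of
  \<open>b\<close>, which is the same position.\<close>

lemma sh_antipode_left: "sh v (\<lambda>a b. antipode_sign (length a) * f (rev a @ b)) = (if v = [] then f [] else 0)"
  by (cases v) (simp_all add: algebra_simps)

lemma sh_antipode_right: "sh v (\<lambda>a b. antipode_sign (length b) * f (a @ rev b)) = (if v = [] then f [] else 0)"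
  by (cases v rule: rev_cases) (simp_all add: sh_snoc algebra_simps)

lemma sh_expand: "\<exists>ps. \<forall>\<chi>. sh v \<chi> = (\<Sum>(a, b, c)\<leftarrow>ps. c * \<chi> a b)"
proof (induction v)
  case Nil
  show ?case by (rule exI[of _ "[([], [], 1)]"]) simp
next
  case (Cons z v)
  then obtain ps where ps: "\<And>\<chi>. sh v \<chi> = (\<Sum>(a, b, c)\<leftarrow>ps. c * \<chi> a b)" by blast
  let ?qs = "map (\<lambda>(a, b, c). (z # a, b, c)) ps @ map (\<lambda>(a, b, c). (a, z # b, c * q ^ length a)) ps"
  have "sh (z # v) \<chi> = (\<Sum>(a, b, c)\<leftarrow>?qs. c * \<chi> a b)" for \<chi>
  proof -
    have "sh (z # v) \<chi> = (\<Sum>(a, b, c)\<leftarrow>ps. c * (\<chi> (z # a) b + q ^ length a * \<chi> a (z # b)))"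
      by (simp add: ps)
    also have "\<dots> = (\<Sum>(a, b, c)\<leftarrow>?qs. c * \<chi> a b)"
      by (induction ps) (auto simp: algebra_simps)
    finally show ?thesis .
  qed
  then show ?case by blast
qed

definition hom_part :: "nat \<Rightarrow> ('l, 'k) falg \<Rightarrow> ('l, 'k) falg" where
  "hom_part n p = bind p (\<lambda>v. if length v = n then wrd v else 0)"

lemma hdeg_hom_part: "hdeg n (hom_part n p)"
  unfolding hom_part_def bind_def
  by (rule falg_sum_induct) (use hdeg_wrd in \<open>auto intro!: hdeg_add hdeg_sc\<close>)

lemma hom_part_sum:
  assumes "\<And>m. m \<in> Poly_Mapping.keys p \<Longrightarrow> length (letters m) \<le> N"
  shows "p = (\<Sum>n\<le>N. hom_part n p)"
proof -
  have "(\<Sum>n\<le>N. hom_part n p) = (\<Sum>m\<in>Poly_Mapping.keys p. \<Sum>n\<le>N. sc (Poly_Mapping.lookup p m) (if length (letters m) = n then wrd (letters m) else 0))"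
    unfolding hom_part_def bind_def by (rule sum.swap)
  also have "\<dots> = (\<Sum>m\<in>Poly_Mapping.keys p. sc (Poly_Mapping.lookup p m) (wrd (letters m)))"
    using assms by (intro sum.cong refl) (simp add: if_distrib sum.delta cong: if_cong)
  finally show ?thesis by (simp flip: falg_expand)
qed

lemma ap_hom_part: "ap (hom_part n p) (phi F) = (if length F = n then ap p (phi F) else 0)"
proof -
  have "(\<lambda>v. ap (if length v = n then wrd v else 0) (phi F)) = (\<lambda>v. (if length v = n then 1 else 0) * phi F v)"
    by auto
  then show ?thesis
    using ap_phi_length[of p "\<lambda>m. if m = n then 1 else 0" F] by (simp add: hom_part_def ap_bind)
qed

lemma hom_part_rad: "p \<in> rad L \<Longrightarrow> hom_part n p \<in> rad L"
  by (simp add: rad_def ap_hom_part)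

end

context yd_line
begin

definition antip :: "('g, 'v, 'k) tens \<Rightarrow> ('g, 'v, 'k) tens" where
  "antip x = functional_on MF (\<lambda>\<phi>. x (\<lambda>w. antipode_sign (length w) * \<phi> (rev w)))"

definition antip_falg :: "('v, 'k) falg \<Rightarrow> ('v, 'k) falg" where
  "antip_falg p = bind p (\<lambda>v. sc (antipode_sign (length v)) (wrd (rev v)))"

definition act_falg :: "'g \<Rightarrow> ('v, 'k) falg \<Rightarrow> ('v, 'k) falg" where
  "act_falg e p = bind p (\<lambda>v. sc (acf e (length v)) (wrd (map (act V e) v)))"

lemma tact_iota': "e \<in> carrier G \<Longrightarrow> tact G \<Phi> V e (iota p) = iota (act_falg e p)"
  by (simp add: tact_iota act_falg_def)

lemma antip_iota: "antip (iota p) = iota (antip_falg p)"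
proof (rule HOL.ext)
  fix \<phi>
  show "antip (iota p) \<phi> = iota (antip_falg p) \<phi>"
  proof (cases "\<phi> \<in> MF")
    case True
    have "(\<lambda>w. antipode_sign (length w) * \<phi> (rev w)) \<in> MF"
    proof (rule MFI)
      fix w assume "w \<in> words G V" "\<not> good w"
      then have "\<phi> (rev w) = 0" by (intro MF_bad[OF True]) (auto simp: words_def)
      then show "antipode_sign (length w) * \<phi> (rev w) = 0" by simp
    next
      show "multilin (\<lambda>v. antipode_sign (length (Wd v)) * \<phi> (rev (Wd v)))"
        using multilin_len[OF multilin_rev[OF MF_mlf'[OF True]], of antipode_sign] by (simp add: rev_map)
    qed
    then show ?thesis using True by (simp add: antip_def functional_on_def iota_MF antip_falg_def ap_bind ap_sc rev_map)
  qed (simp add: antip_def functional_on_def iota_not_MF)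
qed

lemma iota_sum_span: "(\<And>n. n \<in> A \<Longrightarrow> iota (p n) \<in> lin_span TA U) \<Longrightarrow> iota (sum p A) \<in> lin_span TA U"
proof (induction A rule: infinite_finite_induct)
  case (insert n A)
  then show ?case using lin_span.add[of "iota (p n)" TA U "iota (sum p A)"] by (simp add: iota_add)
qed (use lin_span.zero[of TA U] in \<open>simp_all add: iota_0\<close>)

lemma iota_sc_span: "iota p \<in> lin_span TA U \<Longrightarrow> iota (sc c p) \<in> lin_span TA U"
  using lin_span.smult[of "iota p" TA U c] by (simp add: iota_sc)

lemma iota_carrier [simp]: "iota p \<in> carrier TA"
  by (simp add: carrier_TA)

lemma hdeg_tpower: "hdeg n p \<Longrightarrow> iota p \<in> tpower G \<Phi> V n"
  unfolding tpower_def by (rule iota_lin_span) (auto simp: iota_wrd hdeg_def intro!: lin_span.base)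

lemma tpower_tgroup: "tpower G \<Phi> V n \<subseteq> tgroup_comp G \<Phi> V (gp n)"
  unfolding tpower_def tgroup_comp_def
proof (rule lin_span_subset, safe)
  fix w assume w: "w \<in> words G V" "n = length w"
  show "tword G V w \<in> lin_span TA (tword G V ` {u \<in> words G V. wdeg G u = gp (length w)})"
  proof (cases "good w")
    case True
    then have "wdeg G w = gp (length w)" using good_Wd[of w] wdeg_Wd[of "map snd w"] by simp
    then show ?thesis using w by (intro lin_span.base) auto
  next
    case False
    then show ?thesis using lin_span.zero[of TA] by (simp add: tword_bad w)
  qed
qed

lemma antipode_antip: "antipode G \<Phi> V antip"
proof -
  have endo: "tensor_endomorphism G \<Phi> V antip"
    unfolding tensor_endomorphism_def
  proof (intro conjI ballI allI)
    fix x y assume "x \<in> carrier TA" "y \<in> carrier TA"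
    then obtain p r where "x = iota p" "y = iota r" by (auto simp: carrier_TA)
    then show "antip (x \<oplus>\<^bsub>TA\<^esub> y) = antip x \<oplus>\<^bsub>TA\<^esub> antip y"
      by (simp add: antip_iota iota_add[symmetric]) (simp add: antip_falg_def bind_add)
  next
    fix x c assume "x \<in> carrier TA"
    then obtain p where "x = iota p" by (auto simp: carrier_TA)
    then show "antip (c \<odot>\<^bsub>TA\<^esub> x) = c \<odot>\<^bsub>TA\<^esub> antip x"
      by (simp add: antip_iota iota_sc[symmetric]) (simp add: antip_falg_def bind_sc)
  next
    fix h assume "h \<in> carrier G"
    show "antip ` tgroup_comp G \<Phi> V h \<subseteq> tgroup_comp G \<Phi> V h"
    proof
      fix y assume "y \<in> antip ` tgroup_comp G \<Phi> V h"
      then obtain x where x: "y = antip x" "x \<in> lin_span TA (tword G V ` {w \<in> words G V. wdeg G w = h})"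
        by (auto simp: tgroup_comp_def)
      let ?U = "lin_span TA (tword G V ` {w \<in> words G V. wdeg G w = h})"
      have z: "iota 0 \<in> ?U" using lin_span.zero[of TA] by (simp add: iota_0)
      have "\<exists>p. iota (antip_falg p) \<in> ?U \<and> x = iota p"
      proof (rule lin_span_TA_iota[OF _ _ _ _ x(2)])
        show "iota (antip_falg 0) \<in> ?U" using z by (simp add: antip_falg_def)
      next
        fix p r assume "iota (antip_falg p) \<in> ?U" "iota (antip_falg r) \<in> ?U"
        then show "iota (antip_falg (p + r)) \<in> ?U"
          using lin_span.add[of "iota (antip_falg p)" TA _ "iota (antip_falg r)"] by (simp add: antip_falg_def bind_add iota_add)
      next
        fix p c assume "iota (antip_falg p) \<in> ?U"
        then show "iota (antip_falg (sc c p)) \<in> ?U" using iota_sc_span[of "antip_falg p"] by (simp add: antip_falg_def bind_sc)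
      next
        fix x assume "x \<in> tword G V ` {w \<in> words G V. wdeg G w = h}"
        then obtain w where w: "w \<in> words G V" "wdeg G w = h" "x = tword G V w" by auto
        show "\<exists>p. iota (antip_falg p) \<in> ?U \<and> x = iota p"
        proof (cases "good w")
          case True
          obtain v where v: "w = Wd v" using good_Wd[OF True] by blast
          have "iota (wrd (rev v)) \<in> ?U"
            unfolding iota_wrd using w(2) v by (intro lin_span.base) auto
          then have "iota (antip_falg (wrd v)) \<in> ?U" by (simp add: antip_falg_def iota_sc_span)
          then show ?thesis using w(3) v by (auto simp: iota_wrd[symmetric])
        next
          case False
          then show ?thesis using w(3) z tword_bad[OF w(1) False] by (intro exI[of _ 0]) (simp add: antip_falg_def iota_0)
        qed
      qed
      then show "y \<in> tgroup_comp G \<Phi> V h" using x(1) by (auto simp: antip_iota tgroup_comp_def)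
    qed
  next
    fix e x assume e: "e \<in> carrier G" and "x \<in> carrier TA"
    then obtain p where x: "x = iota p" by (auto simp: carrier_TA)
    have "antip_falg (act_falg e p) = act_falg e (antip_falg p)"
      by (induction p rule: falg_induct) (simp_all add: antip_falg_def act_falg_def bind_add bind_sc rev_map mult_ac)
    then show "antip (tact G \<Phi> V e x) = tact G \<Phi> V e (antip x)"
      by (simp add: x antip_iota tact_iota'[OF e])
  qed
  \<comment> \<open>Both convolution identities at once, with \<open>f\<close> and \<open>h\<close>
    being the antipode and the identity in either order. The \<open>gam\<close> of the product
    cancels the inverse \<open>gam\<close> of the coproduct, so only the unshuffle identity
    \<open>cancel\<close> is left.\<close>
  have key: "functional_on MF (\<lambda>\<phi>. comult G \<Phi> V (iota p) (\<lambda>(a, b). tmult G \<Phi> V (f (tword G V a)) (h (tword G V b)) \<phi>))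
      = counit (iota p) \<odot>\<^bsub>TA\<^esub> \<one>\<^bsub>TA\<^esub>"
    if f: "\<And>p. f (iota p) = iota (f' p)" "f' 0 = 0" "\<And>v. f' (wrd v) = sc (\<kappa> (length v)) (wrd (f'' v))" "\<And>v. length (f'' v) = length v"
      and h: "\<And>p. h (iota p) = iota (h' p)" "h' 0 = 0" "\<And>v. h' (wrd v) = sc (\<mu> (length v)) (wrd (h'' v))" "\<And>v. length (h'' v) = length v"
      and m: "\<And>\<phi>. multilin \<phi> \<Longrightarrow> bimultilin (\<lambda>a b. \<phi> (f'' a @ h'' b))"
      and cancel: "\<And>v \<phi>. sh v (\<lambda>a b. \<kappa> (length a) * \<mu> (length b) * \<phi> (f'' a @ h'' b)) = (if v = [] then \<phi> [] else 0)"
    for p f f' f'' h h' h'' \<kappa> \<mu>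
  proof (rule HOL.ext)
    fix \<phi>
    let ?\<psi> = "\<lambda>(a, b). tmult G \<Phi> V (f (tword G V a)) (h (tword G V b)) \<phi>"
    show "functional_on MF (\<lambda>\<phi>. comult G \<Phi> V (iota p) (\<lambda>(a, b). tmult G \<Phi> V (f (tword G V a)) (h (tword G V b)) \<phi>)) \<phi>
      = (counit (iota p) \<odot>\<^bsub>TA\<^esub> \<one>\<^bsub>TA\<^esub>) \<phi>"
    proof (cases "\<phi> \<in> MF")
      case True
      have \<psi>W: "?\<psi> (Wd a, Wd b) = \<kappa> (length a) * \<mu> (length b) * gam (length a) (length b) * \<phi> (Wd (f'' a @ h'' b))" for a b
        by (simp add: iota_wrd[symmetric] f h tmult_iota iota_MF[OF True] ap_tm ap_sc mult_ac)
      have \<psi>B: "?\<psi> \<in> BMF"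
      proof (rule BMFI)
        fix a b assume w: "a \<in> words G V" "b \<in> words G V" "\<not> (good a \<and> good b)"
        define pa pb where "pa = (if good a then wrd (map snd a) else (0 :: ('v, 'k) falg))"
          and "pb = (if good b then wrd (map snd b) else (0 :: ('v, 'k) falg))"
        have "tword G V a = iota pa" "tword G V b = iota pb" "pa = 0 \<or> pb = 0"
          using w by (auto simp: pa_def pb_def tword_iota)
        then show "?\<psi> (a, b) = 0"
          by (auto simp: f h tmult_iota iota_MF[OF True] ap_tm)
      next
        show "bimultilin (\<lambda>a b. ?\<psi> (Wd a, Wd b))"
          unfolding \<psi>W by (intro bimultilin_len[where \<kappa> = "\<lambda>i j. \<kappa> i * \<mu> j * gam i j"] m MF_mlf' True)
      qed
      have "comult_form v ?\<psi> = (if v = [] then \<phi> [] else 0)" for v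
      proof -
        have "comult_form v ?\<psi> = sh v (\<lambda>a b. \<kappa> (length a) * \<mu> (length b) * (\<lambda>u. \<phi> (Wd u)) (f'' a @ h'' b))"
          unfolding comult_form_def \<psi>W by (rule sh_cong) (simp add: gam_nz)
        also have "\<dots> = (if v = [] then \<phi> (Wd []) else 0)" by (rule cancel)
        finally show ?thesis by simp
      qed
      then have "(\<lambda>v. comult_form v ?\<psi>) = (\<lambda>v. \<phi> [] * phi [] v)"
        by (intro HOL.ext) (simp add: phi_Nil)
      then have "comult G \<Phi> V (iota p) ?\<psi> = ap p (\<lambda>v. \<phi> [] * phi [] v)"
        unfolding comult_iota[OF \<psi>B] by (simp only:)
      then show ?thesis using True
        by (simp add: functional_on_def counit_iota ap_fun_scale tword_def)
    qed (simp add: functional_on_def tword_def)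
  qed
  have bm: "bimultilin (\<lambda>a b. \<phi> (rev a @ b))" "bimultilin (\<lambda>a b. \<phi> (a @ rev b))" if "multilin \<phi>" for \<phi>
    using multilin_app[OF that] multilin_rev[OF multilin_app(1)[OF that]] multilin_rev[OF multilin_app(2)[OF that]] by (simp_all add: bimultilin_def)
  have "convolution G \<Phi> V antip (\<lambda>y. y) x = counit x \<odot>\<^bsub>TA\<^esub> \<one>\<^bsub>TA\<^esub>"
    "convolution G \<Phi> V (\<lambda>y. y) antip x = counit x \<odot>\<^bsub>TA\<^esub> \<one>\<^bsub>TA\<^esub>" if "x \<in> carrier TA" for x
  proof -
    obtain p where x: "x = iota p" using \<open>x \<in> carrier TA\<close> by (auto simp: carrier_TA)
    show "convolution G \<Phi> V antip (\<lambda>y. y) x = counit x \<odot>\<^bsub>TA\<^esub> \<one>\<^bsub>TA\<^esub>"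
      unfolding x convolution_def
      by (rule key[of antip antip_falg antipode_sign rev "\<lambda>y. y" "\<lambda>p. p" "\<lambda>_. 1" "\<lambda>v. v" p])
        (auto simp: antip_iota antip_falg_def sh_antipode_left bm)
    show "convolution G \<Phi> V (\<lambda>y. y) antip x = counit x \<odot>\<^bsub>TA\<^esub> \<one>\<^bsub>TA\<^esub>"
      unfolding x convolution_def
      by (rule key[of "\<lambda>y. y" "\<lambda>p. p" "\<lambda>_. 1" "\<lambda>v. v" antip antip_falg antipode_sign rev p])
        (auto simp: antip_iota antip_falg_def sh_antipode_right bm)
  qed
  then show ?thesis unfolding antipode_def using endo by blast
qed

lemma ap_tm_phi: "ap (tm p r) (phi F) = sh F (\<lambda>F1 F2. gam (length F1) (length F2) * (ap p (phi F1) * ap r (phi F2)))"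
proof -
  have "gam (length u) (length w) * phi F (u @ w) = sh F (\<lambda>F1 F2. gam (length F1) (length F2) * (phi F1 u * phi F2 w))" for u w
    unfolding phi_append sh_scale[symmetric]
    by (rule sh_cong) (metis mult_zero_left mult_zero_right phi_length)
  then have "ap (tm p r) (phi F) = ap p (\<lambda>u. ap r (\<lambda>w. sh F (\<lambda>F1 F2. gam (length F1) (length F2) * (phi F1 u * phi F2 w))))"
    by (simp add: ap_tm)
  also have "\<dots> = sh F (\<lambda>F1 F2. ap p (\<lambda>u. ap r (\<lambda>w. gam (length F1) (length F2) * (phi F1 u * phi F2 w))))"
    by (simp only: ap_sh)
  finally show ?thesis by (simp add: ap_fun_scale mult.commute[of _ "ap r _"])
qed

lemma tm_rad: "p \<in> rad Lin \<Longrightarrow> tm r p \<in> rad Lin" "p \<in> rad Lin \<Longrightarrow> tm p r \<in> rad Lin"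
proof -
  assume p: "p \<in> rad Lin"
  have "ap (tm r p) (phi F) = 0" "ap (tm p r) (phi F) = 0" if "set F \<subseteq> Lin" for F
  proof -
    have pz: "ap p (phi H) = 0" if "set H \<subseteq> set F" for H
      using p that \<open>set F \<subseteq> Lin\<close> by (auto simp: rad_def)
    have "ap (tm r p) (phi F) = sh F (\<lambda>F1 F2. 0)" "ap (tm p r) (phi F) = sh F (\<lambda>F1 F2. 0)"
      unfolding ap_tm_phi by (rule sh_cong_set, simp add: pz)+
    then show "ap (tm r p) (phi F) = 0" "ap (tm p r) (phi F) = 0" by simp_all
  qed
  then show "tm r p \<in> rad Lin" "tm p r \<in> rad Lin" by (simp_all add: rad_def)
qed

text \<open>Linear forms composed with the action of \<open>e\<close> are linear forms
  again.\<close>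

lemma act_falg_rad:
  assumes e: "e \<in> carrier G" and p: "p \<in> rad Lin"
  shows "act_falg e p \<in> rad Lin"
  unfolding rad_def
proof (intro CollectI allI impI)
  fix F :: "('v \<Rightarrow> 'k) list" assume F: "set F \<subseteq> Lin"
  let ?F = "map (\<lambda>f x. f (act V e x)) F"
  have "set ?F \<subseteq> Lin" using F by (auto simp: Lin_def act_add[OF e] act_scale[OF e])
  then have "ap p (phi ?F) = 0" using p by (simp add: rad_def)
  then show "ap (act_falg e p) (phi F) = 0"
    using ap_phi_length[of p "acf e" ?F] by (simp add: act_falg_def ap_bind ap_sc phi_map)
qed

lemma antip_falg_rad:
  assumes p: "p \<in> rad Lin"
  shows "antip_falg p \<in> rad Lin"
  unfolding rad_def
proof (intro CollectI allI impI)
  fix F :: "('v \<Rightarrow> 'k) list" assume F: "set F \<subseteq> Lin"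
  then have "ap p (phi (rev F)) = 0" using p by (simp add: rad_def)
  moreover have "phi F (rev v) = phi (rev F) v" for v using phi_rev[of "rev F" v] by simp
  ultimately show "ap (antip_falg p) (phi F) = 0"
    using ap_phi_length[of p antipode_sign "rev F"] by (simp add: antip_falg_def ap_bind ap_sc)
qed

abbreviation pure :: "('v, 'k) falg \<Rightarrow> ('v, 'k) falg \<Rightarrow> ('g, 'v, 'k) tens2" where
  "pure p r \<equiv> pure_tensor G V (iota p) (iota r)"

lemma pure_add_left: "pure (p + p') r \<psi> = pure p r \<psi> + pure p' r \<psi>"
  by (cases "\<psi> \<in> BMF") (simp_all add: pure_iota pure_not_BMF ap_add)

lemma pure_add_right: "pure p (r + r') \<psi> = pure p r \<psi> + pure p r' \<psi>"
  by (cases "\<psi> \<in> BMF") (simp_all add: pure_iota pure_not_BMF ap_add ap_fun_add)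

lemma pure_sc: "pure (sc c p) r \<psi> = c * pure p r \<psi>" "pure p (sc c r) \<psi> = c * pure p r \<psi>"
  by (cases "\<psi> \<in> BMF"; simp add: pure_iota pure_not_BMF ap_sc ap_fun_scale)+

lemma pure_0: "pure 0 r \<psi> = 0"
  using pure_sc(1)[of 0 0 r \<psi>] by simp

lemma pure_sum: "pure (sum p A) r \<psi> = (\<Sum>i\<in>A. pure (p i) r \<psi>)"
  by (induction A rule: infinite_finite_induct) (simp_all add: pure_add_left pure_0)

definition coideal_span :: "('g, 'v, 'k) tens set \<Rightarrow> ('g, 'v, 'k) tens2 set" where
  "coideal_span I = lin_span TA2
        ({pure_tensor G V y z | y z. y \<in> I \<and> z \<in> carrier TA} \<union>
         {pure_tensor G V y z | y z. y \<in> carrier TA \<and> z \<in> I})"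

lemma coideal_span_sum:
  "(\<And>i. i \<in> A \<Longrightarrow> X i \<in> coideal_span I) \<Longrightarrow> (\<lambda>\<psi>. \<Sum>i\<in>A. X i \<psi>) \<in> coideal_span I"
proof (induction A rule: infinite_finite_induct)
  case (insert i A)
  then show ?case
    using lin_span.add[of "X i" TA2 _ "\<lambda>\<psi>. \<Sum>i\<in>A. X i \<psi>"] by (simp add: coideal_span_def)
qed (use lin_span.zero[of TA2] in \<open>simp_all add: coideal_span_def\<close>)

text \<open>The common kernel of all \<open>phi F \<otimes> phi H\<close> is
  \<open>rad \<otimes> T + T \<otimes> rad\<close>. Induction on the number of tensors: if the
  \<open>x j\<close> are independent modulo the radical, all \<open>y j\<close> lie in it; otherwise
  one \<open>x j\<close> is eliminated at the cost of a tensor whose left leg is in the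
  radical.\<close>

lemma tensor_kernel:
  fixes J :: "nat set"
  assumes "finite J"
    and "\<And>F H. set F \<subseteq> Lin \<Longrightarrow> set H \<subseteq> Lin \<Longrightarrow> (\<Sum>j\<in>J. ap (x j) (phi F) * ap (y j) (phi H)) = 0"
  shows "(\<lambda>\<psi>. \<Sum>j\<in>J. pure (x j) (y j) \<psi>) \<in> coideal_span I0"
  using assms
proof (induction "card J" arbitrary: J y)
  case 0
  then show ?case using coideal_span_sum[of "{}"] by simp
next
  case (Suc n)
  show ?case
  proof (cases "\<forall>c. (\<Sum>j\<in>J. sc (c j) (x j)) \<in> rad Lin \<longrightarrow> (\<forall>j\<in>J. c j = 0)")
    case True
    have "y j \<in> rad Lin" if j: "j \<in> J" for j
      unfolding rad_def
    proof (intro CollectI allI impI)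
      fix H :: "('v \<Rightarrow> 'k) list" assume H: "set H \<subseteq> Lin"
      have "(\<Sum>j\<in>J. sc (ap (y j) (phi H)) (x j)) \<in> rad Lin"
        using Suc.prems(2)[OF _ H] by (simp add: rad_def ap_sum ap_sc mult.commute)
      then show "ap (y j) (phi H) = 0" using True j by fast
    qed
    then have "iota (y j) \<in> I0" if "j \<in> J" for j using that by (simp add: I0_def)
    then have "pure (x j) (y j) \<in> coideal_span I0" if "j \<in> J" for j
      unfolding coideal_span_def using that iota_carrier by (intro lin_span.base UnI2) blast
    then show ?thesis by (intro coideal_span_sum) simp
  next
    case False
    then obtain c j0 where c: "(\<Sum>j\<in>J. sc (c j) (x j)) \<in> rad Lin" and j0: "j0 \<in> J" "c j0 \<noteq> 0" by blast
    let ?J = "J - {j0}"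
    define d where "d j = - c j / c j0" for j
    define \<rho> where "\<rho> = x j0 - (\<Sum>j\<in>?J. sc (d j) (x j))"
    have "sc (inverse (c j0)) (\<Sum>j\<in>J. sc (c j) (x j)) = \<rho>"
    proof -
      have "(\<Sum>j\<in>J. sc (c j) (x j)) = sc (c j0) (x j0) + (\<Sum>j\<in>?J. sc (c j) (x j))"
        using j0 Suc.prems(1) by (simp add: sum.remove)
      moreover have "sc (inverse (c j0)) (\<Sum>j\<in>?J. sc (c j) (x j)) = - (\<Sum>j\<in>?J. sc (d j) (x j))"
        unfolding sc_sum sum_negf[symmetric] sc_minus_left[symmetric] d_def
        by (rule sum.cong) (simp_all add: field_simps)
      ultimately show ?thesis using j0 by (simp add: sc_add \<rho>_def)
    qed
    then have \<rho>: "\<rho> \<in> rad Lin" using rad_sc[OF c] by metis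
    have x0: "x j0 = \<rho> + (\<Sum>j\<in>?J. sc (d j) (x j))" by (simp add: \<rho>_def)
    define y' where "y' j = y j + sc (d j) (y j0)" for j
    have split: "(\<Sum>j\<in>J. f j) = f j0 + (\<Sum>j\<in>?J. f j)" for f :: "nat \<Rightarrow> 'k"
      using j0 Suc.prems(1) by (simp add: sum.remove)
    have "(\<lambda>\<psi>. \<Sum>j\<in>?J. pure (x j) (y' j) \<psi>) \<in> coideal_span I0"
    proof (rule Suc.hyps(1))
      show "n = card ?J" "finite ?J" using Suc.hyps(2) Suc.prems(1) j0 by simp_all
      fix F H :: "('v \<Rightarrow> 'k) list" assume FH: "set F \<subseteq> Lin" "set H \<subseteq> Lin"
      have "ap \<rho> (phi F) = 0" using \<rho> FH by (simp add: rad_def)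
      then have "ap (x j0) (phi F) = (\<Sum>j\<in>?J. d j * ap (x j) (phi F))"
        by (simp add: x0 ap_add ap_sum ap_sc)
      then have "(\<Sum>j\<in>?J. ap (x j) (phi F) * ap (y' j) (phi H)) = (\<Sum>j\<in>J. ap (x j) (phi F) * ap (y j) (phi H))"
        by (simp add: split y'_def ap_add ap_sc algebra_simps sum.distrib sum_distrib_left sum_distrib_right)
      then show "(\<Sum>j\<in>?J. ap (x j) (phi F) * ap (y' j) (phi H)) = 0" using Suc.prems(2)[OF FH] by simp
    qed
    moreover have "pure \<rho> (y j0) \<in> coideal_span I0"
    proof -
      have "iota \<rho> \<in> I0" using \<rho> by (simp add: I0_def)
      then show ?thesis unfolding coideal_span_def using iota_carrier by (intro lin_span.base UnI1) blast
    qed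
    ultimately have "(\<lambda>\<psi>. pure \<rho> (y j0) \<psi> + (\<Sum>j\<in>?J. pure (x j) (y' j) \<psi>)) \<in> coideal_span I0"
      using lin_span.add[of "pure \<rho> (y j0)" TA2 _ "\<lambda>\<psi>. \<Sum>j\<in>?J. pure (x j) (y' j) \<psi>"] by (simp add: coideal_span_def)
    also have "(\<lambda>\<psi>. pure \<rho> (y j0) \<psi> + (\<Sum>j\<in>?J. pure (x j) (y' j) \<psi>)) = (\<lambda>\<psi>. \<Sum>j\<in>J. pure (x j) (y j) \<psi>)"
    proof (rule HOL.ext)
      fix \<psi>
      have "pure (x j0) (y j0) \<psi> = pure \<rho> (y j0) \<psi> + (\<Sum>j\<in>?J. d j * pure (x j) (y j0) \<psi>)"
        by (subst x0) (simp add: pure_add_left pure_sum pure_sc)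
      then show "pure \<rho> (y j0) \<psi> + (\<Sum>j\<in>?J. pure (x j) (y' j) \<psi>) = (\<Sum>j\<in>J. pure (x j) (y j) \<psi>)"
        by (simp add: split y'_def pure_add_right pure_sc sum.distrib)
    qed
    finally show ?thesis .
  qed
qed

lemma comult_expand: "\<exists>ps. \<forall>\<psi>. comult G \<Phi> V (iota p) \<psi> = (\<Sum>(a, b)\<leftarrow>ps. pure a b \<psi>)"
proof (induction p rule: falg_induct)
  case zero
  have "comult G \<Phi> V (iota 0) \<psi> = 0" for \<psi>
    by (cases "\<psi> \<in> BMF") (simp_all add: comult_iota comult_not_BMF)
  then show ?case by (intro exI[of _ "[]"]) simp
next
  case (wrd c v)
  obtain ps where ps: "\<And>\<chi>. sh v \<chi> = (\<Sum>(a, b, c)\<leftarrow>ps. c * \<chi> a b)" using sh_expand[of v] by blast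
  let ?qs = "map (\<lambda>(a, b, d). (sc (c * d * inverse (gam (length a) (length b))) (wrd a), wrd b)) ps"
  have "comult G \<Phi> V (iota (sc c (wrd v))) \<psi> = (\<Sum>(a, b)\<leftarrow>?qs. pure a b \<psi>)" for \<psi>
  proof (cases "\<psi> \<in> BMF")
    case True
    have "comult G \<Phi> V (iota (sc c (wrd v))) \<psi> = c * (\<Sum>(a, b, d)\<leftarrow>ps. d * (inverse (gam (length a) (length b)) * \<psi> (Wd a, Wd b)))"
      by (simp add: comult_iota[OF True] ap_sc comult_form_def ps)
    also have "\<dots> = (\<Sum>(a, b)\<leftarrow>?qs. pure a b \<psi>)"
      by (induction ps) (auto simp: pure_iota[OF True] ap_sc algebra_simps)
    finally show ?thesis .
  next
    case False
    have "(\<Sum>(a, b)\<leftarrow>?qs. pure a b \<psi>) = 0" by (induction ps) (auto simp: pure_not_BMF[OF False])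
    then show ?thesis by (simp add: comult_not_BMF[OF False])
  qed
  then show ?case by blast
next
  case (add p r)
  then obtain ps qs where "\<forall>\<psi>. comult G \<Phi> V (iota p) \<psi> = (\<Sum>(a, b)\<leftarrow>ps. pure a b \<psi>)"
    "\<forall>\<psi>. comult G \<Phi> V (iota r) \<psi> = (\<Sum>(a, b)\<leftarrow>qs. pure a b \<psi>)" by blast
  moreover have "comult G \<Phi> V (iota (p + r)) \<psi> = comult G \<Phi> V (iota p) \<psi> + comult G \<Phi> V (iota r) \<psi>" for \<psi>
    by (cases "\<psi> \<in> BMF") (simp_all add: comult_iota comult_not_BMF ap_add)
  ultimately show ?case by (intro exI[of _ "ps @ qs"]) simp
qed

text \<open>Pairing the coproduct with \<open>phi F\<close> and \<open>phi H\<close> gives a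
  multiple of \<open>phi (F @ H)\<close>, which vanishes on the radical;
  \<open>tensor_kernel\<close> does the rest.\<close>

lemma comult_I0:
  assumes p: "p \<in> rad Lin"
  shows "comult G \<Phi> V (iota p) \<in> coideal_span I0"
proof -
  obtain ps where ps: "\<And>\<psi>. comult G \<Phi> V (iota p) \<psi> = (\<Sum>(a, b)\<leftarrow>ps. pure a b \<psi>)"
    using comult_expand[of p] by blast
  let ?x = "\<lambda>j. fst (ps ! j)" and ?y = "\<lambda>j. snd (ps ! j)"
  have eq: "comult G \<Phi> V (iota p) = (\<lambda>\<psi>. \<Sum>j\<in>{0..<length ps}. pure (?x j) (?y j) \<psi>)"
    by (rule HOL.ext) (simp add: ps sum_list_sum_nth case_prod_beta)
  show ?thesis unfolding eq
  proof (rule tensor_kernel)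
    fix F H :: "('v \<Rightarrow> 'k) list" assume FH: "set F \<subseteq> Lin" "set H \<subseteq> Lin"
    let ?\<psi> = "ext2 (\<lambda>a b. phi F a * phi H b)"
    have B: "?\<psi> \<in> BMF" by (intro ext2_BMF bimultilin_phi FH multilin_phi)
    have "ap p (phi (F @ H)) = 0" using p FH by (simp add: rad_def)
    then have "ap (DF F p) (phi H) = 0" by (simp add: ap_phi DF_append)
    then have "comult G \<Phi> V (iota p) ?\<psi> = 0"
      using comult_phi[OF FH(1) multilin_phi[OF FH(2)], of "length H" p] phi_length[of H] by auto
    then have "(\<Sum>j\<in>{0..<length ps}. pure (?x j) (?y j) ?\<psi>) = 0" by (simp add: eq)
    then show "(\<Sum>j\<in>{0..<length ps}. ap (?x j) (phi F) * ap (?y j) (phi H)) = 0"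
      by (simp add: pure_iota[OF B] ap_fun_scale ap_fun_scale_right)
  qed simp
qed

lemma I0_closed:
  "\<zero>\<^bsub>TA\<^esub> \<in> I0" "x \<in> I0 \<Longrightarrow> y \<in> I0 \<Longrightarrow> x \<oplus>\<^bsub>TA\<^esub> y \<in> I0" "x \<in> I0 \<Longrightarrow> c \<odot>\<^bsub>TA\<^esub> x \<in> I0"
proof -
  show "\<zero>\<^bsub>TA\<^esub> \<in> I0" using rad_0 by (auto simp: I0_def iota_0[symmetric] simp del: TA_simps(2-))
  show "x \<in> I0 \<Longrightarrow> y \<in> I0 \<Longrightarrow> x \<oplus>\<^bsub>TA\<^esub> y \<in> I0" unfolding I0_def
    by (auto simp: iota_add[symmetric] intro!: imageI rad_add)
  show "x \<in> I0 \<Longrightarrow> c \<odot>\<^bsub>TA\<^esub> x \<in> I0" unfolding I0_def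
    by (auto simp: iota_sc[symmetric] intro!: imageI rad_sc)
qed

lemma I0_decomp:
  assumes "\<And>n p. p \<in> rad Lin \<Longrightarrow> hdeg n p \<Longrightarrow> iota p \<in> lin_span TA U"
  shows "I0 \<subseteq> lin_span TA U"
proof
  fix x assume "x \<in> I0"
  then obtain p where p: "x = iota p" "p \<in> rad Lin" by (auto simp: I0_def)
  have "length (letters m) \<le> (\<Sum>m\<in>Poly_Mapping.keys p. length (letters m))" if "m \<in> Poly_Mapping.keys p" for m
    by (rule member_le_sum[OF that]) simp_all
  then have "p = (\<Sum>n\<le>(\<Sum>m\<in>Poly_Mapping.keys p. length (letters m)). hom_part n p)" by (rule hom_part_sum)
  moreover have "iota (\<Sum>n\<le>(\<Sum>m\<in>Poly_Mapping.keys p. length (letters m)). hom_part n p) \<in> lin_span TA U"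
    by (intro iota_sum_span assms[OF hom_part_rad[OF p(2)] hdeg_hom_part])
  ultimately show "x \<in> lin_span TA U" using p by simp
qed

text \<open>In degrees 0 and 1 every multilinear form is a multiple of \<open>phi []\<close> or
  equal to some \<open>phi [f]\<close>, so nothing nonzero is in their common kernel.\<close>

lemma I0_low:
  assumes p: "p \<in> rad Lin" "hdeg n p" and n: "n < 2"
  shows "iota p = (\<lambda>\<phi>. 0)"
proof (rule HOL.ext)
  fix \<phi>
  show "iota p \<phi> = 0"
  proof (cases "\<phi> \<in> MF")
    case True
    show ?thesis
    proof (cases "n = 0")
      case True
      have "ap p (\<lambda>v. \<phi> (Wd v)) = ap p (\<lambda>v. \<phi> [] * phi [] v)"
        by (rule ap_cong_hdeg[OF p(2)]) (simp add: True phi_Nil)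
      also have "\<dots> = 0" using p(1) by (simp add: ap_fun_scale rad_def)
      finally show ?thesis using \<open>\<phi> \<in> MF\<close> by (simp add: iota_MF)
    next
      case False
      define f where "f x = \<phi> [(g, x)]" for x
      have "multilin (\<lambda>v. \<phi> (Wd v))" by (rule MF_mlf'[OF \<open>\<phi> \<in> MF\<close>])
      then have "\<phi> (Wd ([] @ (x + y) # [])) = \<phi> (Wd ([] @ x # [])) + \<phi> (Wd ([] @ y # []))"
        "\<phi> (Wd ([] @ scal V c x # [])) = c * \<phi> (Wd ([] @ x # []))" for x y c unfolding multilin_def by blast+
      then have "set [f] \<subseteq> Lin" by (simp add: Lin_def f_def)
      then have z: "ap p (phi [f]) = 0" using p(1) by (simp only: rad_def mem_Collect_eq)
      have "ap p (\<lambda>v. \<phi> (Wd v)) = ap p (phi [f])"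
      proof (rule ap_cong_hdeg[OF p(2)])
        fix w :: "'v list" assume "length w = n"
        then obtain x where "w = [x]" using False n by (cases w) auto
        then show "\<phi> (Wd w) = phi [f] w" by (simp add: phi_single f_def)
      qed
      then show ?thesis using \<open>\<phi> \<in> MF\<close> z by (simp add: iota_MF)
    qed
  qed (simp add: iota_not_MF)
qed

lemma hopf_ideal_I0: "hopf_ideal G \<Phi> V I0"
proof -
  have carr: "I0 \<subseteq> carrier TA" by (auto simp: I0_def)
  have sub: "lin_span TA U \<subseteq> I0" if "U \<subseteq> I0" for U
    using lin_span_least[of U I0 TA] that I0_closed by metis
  have dec: "I0 \<subseteq> lin_span TA (\<Union>h\<in>carrier G. I0 \<inter> tgroup_comp G \<Phi> V h)"
  proof (rule I0_decomp, rule lin_span.base)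
    fix n p assume "p \<in> rad Lin" "hdeg n p"
    then have "iota p \<in> I0 \<inter> tgroup_comp G \<Phi> V (gp n)" using hdeg_tpower tpower_tgroup by (auto simp: I0_def)
    then show "iota p \<in> (\<Union>h\<in>carrier G. I0 \<inter> tgroup_comp G \<Phi> V h)" using gp_closed by blast
  qed
  have "I0 = lin_span TA (\<Union>h\<in>carrier G. I0 \<inter> tgroup_comp G \<Phi> V h)"
    using dec sub[of "\<Union>h\<in>carrier G. I0 \<inter> tgroup_comp G \<Phi> V h"] by blast
  moreover have "\<forall>e\<in>carrier G. tact G \<Phi> V e ` I0 \<subseteq> I0"
    by (auto simp: I0_def tact_iota' act_falg_rad)
  ultimately have "tensor_subobject G \<Phi> V I0" using carr by (simp add: tensor_subobject_def)
  moreover have "\<forall>x\<in>carrier TA. \<forall>y\<in>I0. tmult G \<Phi> V x y \<in> I0 \<and> tmult G \<Phi> V y x \<in> I0"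
    by (auto simp: I0_def carrier_TA tmult_iota tm_rad)
  moreover have "\<forall>x\<in>I0. comult G \<Phi> V x \<in> coideal_span I0" by (auto simp: I0_def comult_I0[unfolded I0_def])
  moreover have "\<forall>x\<in>I0. counit x = 0" by (auto simp: I0_def counit_iota rad_def)
  moreover have "antip ` I0 \<subseteq> I0" by (auto simp: I0_def antip_iota antip_falg_rad)
  ultimately show ?thesis unfolding hopf_ideal_def coideal_span_def using antipode_antip by blast
qed

lemma nat_homogeneous_I0: "nat_homogeneous G \<Phi> V I0"
proof -
  have "I0 \<subseteq> lin_span TA (\<Union>n. I0 \<inter> tpower G \<Phi> V n)"
  proof (rule I0_decomp, rule lin_span.base)
    fix n p assume "p \<in> rad Lin" "hdeg n p"
    then have "iota p \<in> I0 \<inter> tpower G \<Phi> V n" by (simp add: I0_def hdeg_tpower)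
    then show "iota p \<in> (\<Union>n. I0 \<inter> tpower G \<Phi> V n)" by blast
  qed
  moreover have "lin_span TA (\<Union>n. I0 \<inter> tpower G \<Phi> V n) \<subseteq> I0"
    using lin_span_least[of "\<Union>n. I0 \<inter> tpower G \<Phi> V n" I0 TA] I0_closed by (metis UN_least inf_le1)
  ultimately show ?thesis unfolding nat_homogeneous_def by blast
qed

lemma I0_high: "I0 \<subseteq> lin_span TA (\<Union>n\<in>{2..}. tpower G \<Phi> V n)"
proof (rule I0_decomp)
  fix n p assume p: "p \<in> rad Lin" "hdeg n p"
  show "iota p \<in> lin_span TA (\<Union>n\<in>{2..}. tpower G \<Phi> V n)"
  proof (cases "n < 2")
    case True
    then show ?thesis using I0_low[OF p] lin_span.zero[of TA] by simp
  next
    case False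
    then show ?thesis using hdeg_tpower[OF p(2)] by (intro lin_span.base) auto
  qed
qed

text \<open>Contracting the left leg of the coproduct with a linear form \<open>f\<close> maps
  \<open>I\<close> into itself: \<open>I\<close> lives in degrees at least 2, so \<open>f\<close>
  vanishes on it and the summand \<open>I \<otimes> T(V)\<close> disappears. Up to the scalars
  \<open>gam 1 n\<close> this contraction is \<open>D f\<close>, and induction on \<open>F\<close>
  shows that all \<open>phi F\<close> vanish on \<open>I\<close>.\<close>

lemma hopf_ideal_le_I0:
  assumes I: "hopf_ideal G \<Phi> V I" and high: "I \<subseteq> lin_span TA (\<Union>n\<in>{2..}. tpower G \<Phi> V n)"
  shows "I \<subseteq> I0"
proof -
  have car: "I \<subseteq> carrier TA" and span: "I = lin_span TA (\<Union>h\<in>carrier G. I \<inter> tgroup_comp G \<Phi> V h)"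
    using I by (simp_all add: hopf_ideal_def tensor_subobject_def)
  obtain U where U: "I = lin_span TA U" using span by blast
  have cl: "(\<lambda>\<phi>. 0) \<in> I" "\<And>x y. x \<in> I \<Longrightarrow> y \<in> I \<Longrightarrow> (\<lambda>\<phi>. x \<phi> + y \<phi>) \<in> I" "\<And>c x. x \<in> I \<Longrightarrow> (\<lambda>\<phi>. c * x \<phi>) \<in> I"
    using lin_span.zero[of TA U] lin_span.add[of _ TA U] lin_span.smult[of _ TA U] by (simp_all add: U)
  have low: "x (ext (phi F)) = 0" if "x \<in> I" "set F \<subseteq> Lin" "length F < 2" for x F
  proof -
    have E: "ext (phi F) \<in> MF" by (intro ext_MF multilin_phi that)
    let ?U = "{x :: ('g, 'v, 'k) tens. x (ext (phi F)) = 0}"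
    have "lin_span TA (\<Union>n\<in>{2..}. tpower G \<Phi> V n) \<subseteq> ?U"
    proof (rule lin_span_least)
      have "tpower G \<Phi> V n \<subseteq> ?U" if n: "n \<ge> 2" for n
        unfolding tpower_def
      proof (rule lin_span_least)
        show "tword G V ` {w \<in> words G V. length w = n} \<subseteq> ?U"
          using E n \<open>length F < 2\<close> by (auto simp: tword_def functional_on_def ext_def phi_length)
      qed auto
      then show "(\<Union>n\<in>{2..}. tpower G \<Phi> V n) \<subseteq> ?U" by auto
    qed auto
    then show ?thesis using that(1) high by auto
  qed
  have "ap p (phi F) = 0" if "iota p \<in> I" "set F \<subseteq> Lin" for p F
    using that
  proof (induction F arbitrary: p)
    case Nil
    then show ?case using low[of "iota p" "[]"] by (simp add: iota_phi)
  next
    case (Cons f F)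
    have f: "set [f] \<subseteq> Lin" using Cons.prems by simp
    define \<Lambda> :: "('g, 'v, 'k) tens2 \<Rightarrow> ('g, 'v, 'k) tens" where
      "\<Lambda> X = functional_on MF (\<lambda>\<phi>. X (ext2 (\<lambda>a b. phi [f] a * \<phi> (Wd b))))" for X
    have BM: "ext2 (\<lambda>a b. phi [f] a * \<phi> (Wd b)) \<in> BMF" if "\<phi> \<in> MF" for \<phi>
      by (intro ext2_BMF bimultilin_phi f MF_mlf' that)
    have "\<Lambda> ` coideal_span I \<subseteq> I"
    proof -
      have "coideal_span I \<subseteq> {X. \<Lambda> X \<in> I}"
        unfolding coideal_span_def
      proof (rule lin_span_least)
        show "\<zero>\<^bsub>TA2\<^esub> \<in> {X. \<Lambda> X \<in> I}" using cl(1) by (simp add: \<Lambda>_def functional_on_def)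
        show "X \<oplus>\<^bsub>TA2\<^esub> Y \<in> {X. \<Lambda> X \<in> I}" if "X \<in> {X. \<Lambda> X \<in> I}" "Y \<in> {X. \<Lambda> X \<in> I}" for X Y
        proof -
          have "\<Lambda> (X \<oplus>\<^bsub>TA2\<^esub> Y) = (\<lambda>\<phi>. \<Lambda> X \<phi> + \<Lambda> Y \<phi>)" by (rule HOL.ext) (simp add: \<Lambda>_def functional_on_def)
          then show ?thesis using cl(2) that by simp
        qed
        show "c \<odot>\<^bsub>TA2\<^esub> X \<in> {X. \<Lambda> X \<in> I}" if "X \<in> {X. \<Lambda> X \<in> I}" for X c
        proof -
          have "\<Lambda> (c \<odot>\<^bsub>TA2\<^esub> X) = (\<lambda>\<phi>. c * \<Lambda> X \<phi>)" by (rule HOL.ext) (simp add: \<Lambda>_def functional_on_def)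
          then show ?thesis using cl(3) that by simp
        qed
        have pure: "\<Lambda> (pure a b) = (\<lambda>\<phi>. ap a (phi [f]) * iota b \<phi>)" for a b
        proof (rule HOL.ext)
          fix \<phi> show "\<Lambda> (pure a b) \<phi> = ap a (phi [f]) * iota b \<phi>"
            by (cases "\<phi> \<in> MF") (simp_all add: \<Lambda>_def functional_on_def pure_iota[OF BM] iota_MF iota_not_MF ap_fun_scale ap_fun_scale_right)
        qed
        show "{pure_tensor G V y z |y z. y \<in> I \<and> z \<in> carrier TA} \<union> {pure_tensor G V y z |y z. y \<in> carrier TA \<and> z \<in> I} \<subseteq> {X. \<Lambda> X \<in> I}"
        proof (safe)
          fix y z assume y: "y \<in> I" and z: "z \<in> carrier TA"
          then obtain a b where ab: "y = iota a" "z = iota b" using car by (auto simp: carrier_TA)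
          have "ap a (phi [f]) = 0" using low[OF y f] ab f by (simp add: iota_phi)
          then show "\<Lambda> (pure_tensor G V y z) \<in> I" using cl(1) by (simp add: ab pure)
        next
          fix y z assume y: "y \<in> carrier TA" and z: "z \<in> I"
          then obtain a b where ab: "y = iota a" "z = iota b" using car by (auto simp: carrier_TA)
          then show "\<Lambda> (pure_tensor G V y z) \<in> I" using cl(3) z by (simp add: ab pure)
        qed
      qed
      then show ?thesis by blast
    qed
    moreover have "comult G \<Phi> V (iota p) \<in> coideal_span I"
      using I Cons.prems(1) by (simp add: hopf_ideal_def coideal_span_def)
    ultimately have \<Lambda>I: "\<Lambda> (comult G \<Phi> V (iota p)) \<in> I" by blast
    define p' where "p' = bind (D f p) (\<lambda>b. sc (inverse (gam 1 (length b))) (wrd b))"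
    have "\<Lambda> (comult G \<Phi> V (iota p)) = iota p'"
    proof (rule HOL.ext)
      fix \<phi> show "\<Lambda> (comult G \<Phi> V (iota p)) \<phi> = iota p' \<phi>"
      proof (cases "\<phi> \<in> MF")
        case True
        have "comult_form v (ext2 (\<lambda>a b. phi [f] a * \<phi> (Wd b))) = ap (delw f v) (\<lambda>b. inverse (gam 1 (length b)) * \<phi> (Wd b))" for v
        proof -
          have "comult_form v (ext2 (\<lambda>a b. phi [f] a * \<phi> (Wd b))) = sh v (\<lambda>a b. phi [f] a * (inverse (gam 1 (length b)) * \<phi> (Wd b)))"
            unfolding comult_form_def by (rule sh_cong) (use phi_length[of "[f]"] in \<open>auto, metis\<close>)
          also have "\<dots> = ap (DF [f] (wrd v)) (\<lambda>b. inverse (gam 1 (length b)) * \<phi> (Wd b))" by (rule sh_phi_left)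
          finally show ?thesis by (simp add: D_wrd)
        qed
        then show ?thesis using True
          by (simp add: \<Lambda>_def functional_on_def comult_iota[OF BM] iota_MF p'_def ap_bind ap_sc D_def)
      qed (simp add: \<Lambda>_def functional_on_def iota_not_MF)
    qed
    then have "ap p' (phi F) = 0" using Cons.IH[of p'] \<Lambda>I Cons.prems(2) by simp
    then have "inverse (gam 1 (length F)) * ap (D f p) (phi F) = 0"
      using ap_phi_length[of "D f p" "\<lambda>n. inverse (gam 1 n)" F] by (simp add: p'_def ap_bind ap_sc)
    then show ?case by (simp add: gam_nz ap_phi_Cons)
  qed
  then have "p \<in> rad Lin" if "iota p \<in> I" for p using that by (simp add: rad_def)
  then show ?thesis using car by (fastforce simp: I0_def carrier_TA)
qed

theorem nichols_ideal_eq: "nichols_ideal G \<Phi> V = I0"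
  unfolding nichols_ideal_def
  by (rule Greatest_equality) (use hopf_ideal_I0 nat_homogeneous_I0 I0_high hopf_ideal_le_I0 in auto)

end

section \<open>Growth of the Nichols algebra\<close>

interpretation fa: vector_space "sc :: 'k::field \<Rightarrow> ('l, 'k) falg \<Rightarrow> ('l, 'k) falg"
  by standard (simp_all add: sc_add sc_add_left)

lemma hdeg_span: "hdeg n p \<Longrightarrow> p \<in> fa.span {wrd w | w. length w = n}"
  by (subst falg_expand, rule fa.span_sum, rule fa.span_scale, rule fa.span_base) (auto simp: hdeg_def)

definition deg_le :: "nat \<Rightarrow> ('l, 'k::field) falg set" where
  "deg_le n = {p. \<forall>m\<in>Poly_Mapping.keys p. length (letters m) \<le> n}"

lemma deg_le_subspace: "fa.subspace (deg_le n)"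
proof (rule fa.subspaceI)
  show "x + y \<in> deg_le n" if "x \<in> deg_le n" "y \<in> deg_le n" for x y :: "('l, 'k::field) falg"
    using that keys_add[of x y] by (fastforce simp: deg_le_def)
  show "sc c x \<in> deg_le n" if "x \<in> deg_le n" for c and x :: "('l, 'k::field) falg"
    using that keys_sc[of c x] by (fastforce simp: deg_le_def)
qed (simp add: deg_le_def)

lemma hdeg_deg_le: "hdeg m p \<Longrightarrow> m \<le> n \<Longrightarrow> p \<in> deg_le n"
  by (auto simp: hdeg_def deg_le_def)

lemma deg_le_expand: "p \<in> deg_le n \<Longrightarrow> p \<in> fa.span {wrd w | w. length w \<le> n}"
  by (subst falg_expand, rule fa.span_sum, rule fa.span_scale, rule fa.span_base) (auto simp: deg_le_def)

context skew
begin

lemma rad_span_span: "p \<in> rad_span L M \<Longrightarrow> \<exists>s\<in>fa.span (wrd ` M). p - s \<in> rad L"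
proof (induction rule: rad_span.induct)
  case (rad_span_wrd s)
  then show ?case by (intro bexI[of _ "wrd s"]) (auto simp: rad_0 intro: fa.span_base)
next
  case (rad_span_rad p)
  then show ?case by (intro bexI[of _ 0]) (auto intro: fa.span_zero)
next
  case (rad_span_add p r)
  then obtain s t where "s \<in> fa.span (wrd ` M)" "p - s \<in> rad L" "t \<in> fa.span (wrd ` M)" "r - t \<in> rad L" by blast
  then show ?case using rad_add[of "p - s" L "r - t"]
    by (intro bexI[of _ "s + t"]) (auto simp: algebra_simps intro: fa.span_add)
next
  case (rad_span_sc p c)
  then obtain s where "s \<in> fa.span (wrd ` M)" "p - s \<in> rad L" by blast
  then show ?case using rad_sc[of "p - s" L c]
    by (intro bexI[of _ "sc c s"]) (auto simp: sc_diff intro: fa.span_scale)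
qed

lemma span_rad_span:
  assumes "\<And>w. w \<in> W \<Longrightarrow> wrd w \<in> rad_span L M" "p \<in> fa.span (wrd ` W)"
  shows "p \<in> rad_span L M"
  using assms(2)
proof (induction rule: fa.span_induct_alt)
  case base
  show ?case by (rule rad_span_0)
next
  case (step c x y)
  then show ?case using assms(1) by (auto intro: rad_span_add rad_span_sc)
qed

lemma deg_le_rad_span:
  assumes "\<And>w. length w \<le> n \<Longrightarrow> wrd w \<in> rad_span L M" "p \<in> deg_le n"
  shows "\<exists>s\<in>fa.span (wrd ` M). p - s \<in> rad L"
proof -
  have eq: "{wrd w | w. length w \<le> n} = wrd ` {w. length w \<le> n}" by auto
  have "p \<in> fa.span (wrd ` {w. length w \<le> n})" using deg_le_expand[OF assms(2)] by (simp only: eq)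
  then have "p \<in> rad_span L M" by (rule span_rad_span[rotated]) (use assms(1) in simp)
  then show ?thesis by (rule rad_span_span)
qed

lemma finite_spanned:
  assumes B: "spans L B" "finite B"
  shows "\<exists>M. finite M \<and> (\<forall>s\<in>M. length s \<le> n) \<and> (\<forall>w. length w \<le> n \<longrightarrow> wrd w \<in> rad_span L M)"
proof -
  let ?M = "\<lambda>n. {w. set w \<subseteq> B \<and> length w = n}"
  have "wrd w \<in> rad_span L (?M (length w))" for w
    by (rule rad_span_words[OF B(1)]) (simp, rule rad_span_wrd, auto)
  then have "wrd w \<in> rad_span L {w. set w \<subseteq> B \<and> length w \<le> n}" if "length w \<le> n" for w
    using that by (rule_tac rad_span_mono[of _ _ "?M (length w)"]) auto
  then show ?thesis using finite_lists_length_le[OF B(2), of n]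
    by (intro exI[of _ "{w. set w \<subseteq> B \<and> length w \<le> n}"]) auto
qed

text \<open>Representatives of the subproducts in the span of \<open>T\<close> inherit their
  independence modulo the radical; in particular they are pairwise distinct.\<close>

lemma rich_card:
  assumes rich: "rich L r" and T: "finite T"
    and s: "\<And>bs. length bs = m \<Longrightarrow> s bs \<in> fa.span T \<and> subprod r 0 bs - s bs \<in> rad L"
  shows "2 ^ m \<le> card T"
proof -
  let ?L = "{bs :: bool list. length bs = m}"
  have fin: "finite ?L" using finite_lists_length_eq[of "UNIV :: bool set" m] by simp
  have zero: "c bs = 0" if "(\<Sum>bs\<in>?L. sc (c bs) (s bs)) = 0" "length bs = m" for c bs
  proof -
    have "(\<Sum>bs\<in>?L. sc (c bs) (subprod r 0 bs)) = (\<Sum>bs\<in>?L. sc (c bs) (subprod r 0 bs - s bs))"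
      using that(1) by (simp add: sc_diff sum_subtractf)
    also have "\<dots> \<in> rad L" by (rule falg_sum_induct) (use s in \<open>auto intro: rad_0 rad_add rad_sc\<close>)
    finally show ?thesis using rich that(2) unfolding rich_def by blast
  qed
  have inj: "inj_on s ?L"
  proof (rule inj_onI, rule ccontr)
    fix a b assume ab: "a \<in> ?L" "b \<in> ?L" "s a = s b" "a \<noteq> b"
    let ?c = "\<lambda>bs. if bs = a then 1 else if bs = b then -1 else (0 :: 'k)"
    have "(\<Sum>bs\<in>?L. sc (?c bs) (s bs)) = (\<Sum>bs\<in>{a, b}. sc (?c bs) (s bs))"
      using ab fin by (intro sum.mono_neutral_right) auto
    also have "\<dots> = 0" using ab by (simp add: sc_minus_left)
    finally have "?c a = 0" using ab by (intro zero) auto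
    then show False by simp
  qed
  have "fa.independent (s ` ?L)"
  proof
    assume "fa.dependent (s ` ?L)"
    then obtain u v where u: "v \<in> s ` ?L" "u v \<noteq> 0" "(\<Sum>v\<in>s ` ?L. sc (u v) v) = 0"
      using fa.dependent_finite[of "s ` ?L"] fin by auto
    then have "(\<Sum>bs\<in>?L. sc (u (s bs)) (s bs)) = 0" by (simp add: sum.reindex[OF inj])
    then show False using u zero[of "\<lambda>bs. u (s bs)"] by auto
  qed
  then have "card (s ` ?L) \<le> card T" using fa.independent_span_bound[OF T, of "s ` ?L"] s by auto
  moreover have "card ?L = 2 ^ m" using card_lists_length_eq[of "UNIV :: bool set" m] by simp
  ultimately show ?thesis by (simp add: card_image[OF inj])
qed

end

context yd_line
begin

abbreviation "Q \<equiv> nichols_algebra G \<Phi> V"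

definition nclass :: "('v, 'k) falg \<Rightarrow> ('g, 'v, 'k) tens set" where
  "nclass p = I0 +>\<^bsub>TA\<^esub> iota p"

lemma coset_eq: "I0 +>\<^bsub>TA\<^esub> x = {\<lambda>\<phi>. i \<phi> + x \<phi> | i. i \<in> I0}"
  unfolding a_r_coset_def' by auto

lemma nclass_eq: "nclass p = iota ` {r. r - p \<in> rad Lin}"
proof
  show "nclass p \<subseteq> iota ` {r. r - p \<in> rad Lin}"
  proof
    fix x assume "x \<in> nclass p"
    then obtain i where "i \<in> I0" "x = (\<lambda>\<phi>. i \<phi> + iota p \<phi>)" unfolding nclass_def coset_eq by blast
    then obtain s where "s \<in> rad Lin" "x = iota (s + p)" by (auto simp: I0_def iota_add)
    then show "x \<in> iota ` {r. r - p \<in> rad Lin}" by (intro image_eqI[of _ _ "s + p"]) simp_all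
  qed
  show "iota ` {r. r - p \<in> rad Lin} \<subseteq> nclass p"
  proof
    fix x assume "x \<in> iota ` {r. r - p \<in> rad Lin}"
    then obtain r where r: "x = iota r" "r - p \<in> rad Lin" by auto
    have "x = (\<lambda>\<phi>. iota (r - p) \<phi> + iota p \<phi>)" using r by (simp add: iota_add[symmetric])
    moreover have "iota (r - p) \<in> I0" using r by (simp add: I0_def)
    ultimately show "x \<in> nclass p" unfolding nclass_def coset_eq by blast
  qed
qed

lemma iota_eqD: "iota p = iota r \<Longrightarrow> p - r \<in> rad Lin"
proof -
  assume e: "iota p = iota r"
  have "iota (p - r) = (\<lambda>\<phi>. iota p \<phi> - iota r \<phi>)"
    by (rule HOL.ext) (simp add: iota_def functional_on_def ap_diff)
  then have "iota (p - r) = iota 0" using e by (simp add: iota_0)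
  then show ?thesis using iota_I0 rad_0 by metis
qed

lemma nclass_eq_iff: "nclass p = nclass r \<longleftrightarrow> p - r \<in> rad Lin"
proof
  assume "nclass p = nclass r"
  moreover have "iota p \<in> nclass p" by (auto simp: nclass_eq rad_0)
  ultimately obtain s where s: "iota p = iota s" "s - r \<in> rad Lin" by (auto simp: nclass_eq)
  then show "p - r \<in> rad Lin" using rad_add[OF iota_eqD[OF s(1)] s(2)] by simp
next
  assume pr: "p - r \<in> rad Lin"
  have "s - p \<in> rad Lin \<longleftrightarrow> s - r \<in> rad Lin" for s
    using rad_add[OF _ pr, of "s - p"] rad_diff[OF _ pr, of "s - r"] by auto
  then show "nclass p = nclass r" by (simp add: nclass_eq)
qed

lemma Q_simps:
  "\<zero>\<^bsub>Q\<^esub> = I0" "\<one>\<^bsub>Q\<^esub> = I0 +>\<^bsub>TA\<^esub> \<one>\<^bsub>TA\<^esub>" "x \<oplus>\<^bsub>Q\<^esub> y = set_add TA x y"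
  "x \<otimes>\<^bsub>Q\<^esub> y = rcoset_mult TA I0 x y" "c \<odot>\<^bsub>Q\<^esub> x = (\<Union>y\<in>x. I0 +>\<^bsub>TA\<^esub> (c \<odot>\<^bsub>TA\<^esub> y))"
  by (simp_all add: nichols_algebra_def quotient_algebra_def nichols_ideal_eq FactRing_def ring.defs module.defs)

lemma Q_zero: "\<zero>\<^bsub>Q\<^esub> = nclass 0"
  by (auto simp: Q_simps nclass_eq I0_def)

lemma Q_one: "\<one>\<^bsub>Q\<^esub> = nclass 1"
  by (simp add: Q_simps nclass_def iota_wrd[of "[]", symmetric, simplified] wrd_Nil)

lemma Q_add: "nclass p \<oplus>\<^bsub>Q\<^esub> nclass r = nclass (p + r)"
proof -
  have "nclass p \<oplus>\<^bsub>Q\<^esub> nclass r = {\<lambda>\<phi>. a \<phi> + b \<phi> | a b. a \<in> nclass p \<and> b \<in> nclass r}"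
    by (auto simp: Q_simps set_add_def set_mult_def)
  also have "\<dots> = nclass (p + r)"
  proof (safe)
    fix a b assume "a \<in> nclass p" "b \<in> nclass r"
    then obtain p' r' where "a = iota p'" "p' - p \<in> rad Lin" "b = iota r'" "r' - r \<in> rad Lin" by (auto simp: nclass_eq)
    then show "(\<lambda>\<phi>. a \<phi> + b \<phi>) \<in> nclass (p + r)"
      using rad_add[of "p' - p" Lin "r' - r"] by (auto simp: nclass_eq iota_add[symmetric] algebra_simps)
  next
    fix x assume "x \<in> nclass (p + r)"
    then obtain s where s: "x = iota s" "s - (p + r) \<in> rad Lin" by (auto simp: nclass_eq)
    have "x = (\<lambda>\<phi>. iota (s - r) \<phi> + iota r \<phi>)" using s by (simp add: iota_add[symmetric])
    moreover have "iota (s - r) \<in> nclass p" "iota r \<in> nclass r" using s by (auto simp: nclass_eq rad_0 algebra_simps)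
    ultimately show "\<exists>a b. x = (\<lambda>\<phi>. a \<phi> + b \<phi>) \<and> a \<in> nclass p \<and> b \<in> nclass r" by blast
  qed
  finally show ?thesis .
qed

lemma Q_smult: "c \<odot>\<^bsub>Q\<^esub> nclass p = nclass (sc c p)"
proof -
  have "I0 +>\<^bsub>TA\<^esub> (c \<odot>\<^bsub>TA\<^esub> iota r) = nclass (sc c p)" if "r - p \<in> rad Lin" for r
  proof -
    have "sc c r - sc c p \<in> rad Lin" using rad_sc[OF that, of c] by (simp add: sc_diff)
    then have "nclass (sc c r) = nclass (sc c p)" by (simp add: nclass_eq_iff)
    then show ?thesis by (simp add: nclass_def iota_sc)
  qed
  moreover have "p - p \<in> rad Lin" by (simp add: rad_0)
  ultimately show ?thesis unfolding Q_simps nclass_eq[of p] by blast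
qed

lemma tm_diff: "tm p r - tm p' r' = tm (p - p') r + tm p' (r - r')"
proof -
  have "bind p' (\<lambda>u. bind r (h u)) = bind p' (\<lambda>u. bind r' (h u)) + bind p' (\<lambda>u. bind (r - r') (h u))"
    for h :: "'v list \<Rightarrow> 'v list \<Rightarrow> ('v, 'k) falg"
    by (induction p' rule: falg_induct) (simp_all add: bind_add bind_sc bind_diff sc_diff algebra_simps)
  then show ?thesis unfolding tm_def bind_diff by (simp add: algebra_simps)
qed

lemma Q_mult: "nclass p \<otimes>\<^bsub>Q\<^esub> nclass r = nclass (tm p r)"
proof -
  have "I0 +>\<^bsub>TA\<^esub> (iota p' \<otimes>\<^bsub>TA\<^esub> iota r') = nclass (tm p r)" if "p' - p \<in> rad Lin" "r' - r \<in> rad Lin" for p' r'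
  proof -
    have "tm p' r' - tm p r \<in> rad Lin" unfolding tm_diff by (intro rad_add tm_rad that)
    then have "nclass (tm p' r') = nclass (tm p r)" by (simp add: nclass_eq_iff)
    then show ?thesis by (simp add: nclass_def tmult_iota)
  qed
  moreover have "p - p \<in> rad Lin" "r - r \<in> rad Lin" by (simp_all add: rad_0)
  ultimately show ?thesis unfolding Q_simps rcoset_mult_def nclass_eq[of p] nclass_eq[of r] by blast
qed

lemma lin_span_Q: "lin_span Q (nclass ` A) = nclass ` fa.span A"
proof
  show "lin_span Q (nclass ` A) \<subseteq> nclass ` fa.span A"
  proof (rule lin_span_least)
    show "\<zero>\<^bsub>Q\<^esub> \<in> nclass ` fa.span A" using fa.span_zero[of A] by (auto simp: Q_zero)
    show "x \<oplus>\<^bsub>Q\<^esub> y \<in> nclass ` fa.span A" if "x \<in> nclass ` fa.span A" "y \<in> nclass ` fa.span A" for x y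
      using that by (auto simp: Q_add intro!: imageI fa.span_add)
    show "c \<odot>\<^bsub>Q\<^esub> x \<in> nclass ` fa.span A" if "x \<in> nclass ` fa.span A" for c x
      using that by (auto simp: Q_smult intro!: imageI fa.span_scale)
  qed (auto intro: fa.span_base)
  have "nclass p \<in> lin_span Q (nclass ` A)" if "p \<in> fa.span A" for p
    using that
  proof (induction rule: fa.span_induct_alt)
    case base
    then show ?case using lin_span.zero[of Q] by (simp add: Q_zero)
  next
    case (step c x y)
    have "nclass x \<in> lin_span Q (nclass ` A)" using step by (intro lin_span.base) auto
    then have "nclass (sc c x) \<in> lin_span Q (nclass ` A)" using lin_span.smult[of "nclass x" Q _ c] by (simp add: Q_smult)
    then have "nclass (sc c x) \<oplus>\<^bsub>Q\<^esub> nclass y \<in> lin_span Q (nclass ` A)" by (rule lin_span.add[OF _ step.IH])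
    then show ?case by (simp add: Q_add)
  qed
  then show "nclass ` fa.span A \<subseteq> lin_span Q (nclass ` A)" by auto
qed

lemma tpower_eq: "tpower G \<Phi> V n = iota ` {p. hdeg n p}"
proof
  have "\<exists>p. hdeg n p \<and> x = iota p" if "x \<in> lin_span TA (tword G V ` {w \<in> words G V. length w = n})" for x
  proof (rule lin_span_TA_iota[OF _ _ _ _ that])
    fix y assume "y \<in> tword G V ` {w \<in> words G V. length w = n}"
    then obtain w where w: "w \<in> words G V" "length w = n" "y = tword G V w" by auto
    have "hdeg n (if good w then wrd (map snd w) else (0 :: ('v, 'k) falg))"
    proof -
      have "hdeg (length (map snd w)) (wrd (map snd w) :: ('v, 'k) falg)" by (rule hdeg_wrd)
      then show ?thesis using w by simp
    qed
    then show "\<exists>p. hdeg n p \<and> y = iota p" using tword_iota[OF w(1)] w(3) by blast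
  qed (auto intro: hdeg_add hdeg_sc)
  then show "tpower G \<Phi> V n \<subseteq> iota ` {p. hdeg n p}" by (auto simp: tpower_def)
qed (auto intro: hdeg_tpower)

lemma generators_eq: "nichols_generators G \<Phi> V = nclass ` {p. hdeg 1 p}"
  by (auto simp: nichols_generators_def nichols_ideal_eq tpower_eq nclass_def)

text \<open>Right multiplication by letters is untwisted, as
  \<open>gam n 1 = \<Phi>(g^n, 1, g) = 1\<close>. So the left-bracketed powers of the generators are
  the usual homogeneous components.\<close>

lemma tm_hdeg: "hdeg n p \<Longrightarrow> hdeg 1 r \<Longrightarrow> tm p r = p * r"
proof -
  assume p: "hdeg n p" and r: "hdeg 1 r"
  have "bind r (\<lambda>w. sc (gam (length u) (length w)) (wrd (u @ w))) = wrd u * r" for u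
  proof -
    have "gam (length u) 1 = 1" using g by (simp add: gam_def)
    then have "bind r (\<lambda>w. sc (gam (length u) (length w)) (wrd (u @ w))) = (\<Sum>m\<in>Poly_Mapping.keys r. sc (Poly_Mapping.lookup r m) (wrd u * wrd (letters m)))"
      unfolding bind_def using r by (intro sum.cong) (auto simp: hdeg_def wrd_append)
    also have "\<dots> = wrd u * r" by (subst (3) falg_expand) (simp add: sum_distrib_left)
    finally show ?thesis .
  qed
  then have "tm p r = bind p (\<lambda>u. wrd u * r)" by (simp add: tm_def)
  also have "\<dots> = p * r"
    by (induction p rule: falg_induct) (simp_all add: bind_add bind_sc distrib_right)
  finally show ?thesis .
qed

lemma power_span_eq: "power_span Q (nichols_generators G \<Phi> V) n = nclass ` {p. hdeg n p}"
proof (induction n)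
  case 0
  have "{p :: ('v, 'k) falg. hdeg 0 p} = fa.span {1}"
  proof
    show "{p :: ('v, 'k) falg. hdeg 0 p} \<subseteq> fa.span {1}"
    proof -
      have eq: "{wrd w :: ('v, 'k) falg | w. length w = 0} = {1}" by (auto simp: wrd_Nil)
      have "p \<in> fa.span {1}" if "hdeg 0 p" for p :: "('v, 'k) falg"
        using hdeg_span[OF that] by (simp only: eq)
      then show ?thesis by blast
    qed
    have "fa.subspace {p :: ('v, 'k) falg. hdeg 0 p}"
      by (rule fa.subspaceI) (auto intro: hdeg_add hdeg_sc)
    moreover have "hdeg 0 (1 :: ('v, 'k) falg)" using hdeg_wrd[of "[]"] by (simp add: wrd_Nil)
    ultimately show "fa.span {1} \<subseteq> {p :: ('v, 'k) falg. hdeg 0 p}" by (intro fa.span_minimal) auto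
  qed
  then show ?case using lin_span_Q[of "{1}"] by (simp add: Q_one)
next
  case (Suc n)
  let ?A = "{tm p r | p r. hdeg n p \<and> hdeg 1 r}"
  have e: "{x \<otimes>\<^bsub>Q\<^esub> u |x u. x \<in> nclass ` {p. hdeg n p} \<and> u \<in> nclass ` {p. hdeg 1 p}} = nclass ` ?A"
    by (auto simp: Q_mult image_iff) (metis Q_mult)+
  have "power_span Q (nichols_generators G \<Phi> V) (Suc n) = nclass ` fa.span ?A"
    unfolding power_span.simps Suc unfolding generators_eq e lin_span_Q ..
  moreover have "fa.span ?A = {p. hdeg (Suc n) p}"
  proof
    have "fa.subspace {p :: ('v, 'k) falg. hdeg (Suc n) p}"
      by (rule fa.subspaceI) (auto intro: hdeg_add hdeg_sc)
    moreover have "?A \<subseteq> {p. hdeg (Suc n) p}"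
      by (auto simp: tm_hdeg intro!: hdeg_mult')
    ultimately show "fa.span ?A \<subseteq> {p. hdeg (Suc n) p}" by (intro fa.span_minimal)
    have "wrd w \<in> ?A" if lw: "length w = Suc n" for w
    proof -
      obtain v x where w: "w = v @ [x]" using lw by (cases w rule: rev_cases) auto
      have "hdeg n (wrd v)" "hdeg 1 (wrd [x])" using hdeg_wrd[of v] hdeg_wrd[of "[x]"] w lw by simp_all
      moreover from tm_hdeg[OF this] have "wrd w = tm (wrd v) (wrd [x])" by (simp only: w wrd_append)
      ultimately show ?thesis by blast
    qed
    then have "fa.span {wrd w |w. length w = Suc n} \<subseteq> fa.span ?A" by (intro fa.span_mono) auto
    then show "{p. hdeg (Suc n) p} \<subseteq> fa.span ?A" using hdeg_span by blast
  qed
  ultimately show ?case by simp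
qed

abbreviation "filt n \<equiv> power_filtration Q (nichols_generators G \<Phi> V) n"

lemma filt_eq: "filt n = nclass ` deg_le n"
proof -
  have "(\<Union>i\<le>n. nclass ` {p. hdeg i p}) = nclass ` (\<Union>i\<le>n. {p. hdeg i p})" by auto
  moreover have "fa.span (\<Union>i\<le>n. {p. hdeg i p}) = (deg_le n :: ('v, 'k) falg set)"
  proof
    show "fa.span (\<Union>i\<le>n. {p. hdeg i p}) \<subseteq> (deg_le n :: ('v, 'k) falg set)"
      by (rule fa.span_minimal[OF _ deg_le_subspace]) (auto intro: hdeg_deg_le)
    have "{wrd w | w. length w \<le> n} \<subseteq> (\<Union>i\<le>n. {p :: ('v, 'k) falg. hdeg i p})" using hdeg_wrd by auto
    then show "(deg_le n :: ('v, 'k) falg set) \<subseteq> fa.span (\<Union>i\<le>n. {p. hdeg i p})"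
      using fa.span_mono deg_le_expand by blast
  qed
  ultimately show ?thesis unfolding power_filtration_def power_span_eq by (simp add: lin_span_Q)
qed

lemma filt_spanning:
  assumes M: "finite M" "\<And>s. s \<in> M \<Longrightarrow> length s \<le> n" "\<And>w. length w \<le> n \<Longrightarrow> wrd w \<in> rad_span Lin M"
  shows "nclass ` wrd ` M \<subseteq> filt n" "finite (nclass ` wrd ` M)" "lin_span Q (nclass ` wrd ` M) = filt n"
    "card (nclass ` wrd ` M) \<le> card M"
proof -
  have sub: "wrd ` M \<subseteq> (deg_le n :: ('v, 'k) falg set)" using M(2) hdeg_wrd hdeg_deg_le by blast
  then show "nclass ` wrd ` M \<subseteq> filt n" by (auto simp: filt_eq)
  show "finite (nclass ` wrd ` M)" using M(1) by simp
  show "card (nclass ` wrd ` M) \<le> card M" using card_image_le M(1) by (metis finite_imageI le_trans)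
  have "fa.span (wrd ` M) \<subseteq> (deg_le n :: ('v, 'k) falg set)" by (rule fa.span_minimal[OF sub deg_le_subspace])
  moreover have "nclass p \<in> nclass ` fa.span (wrd ` M)" if "p \<in> deg_le n" for p
    using deg_le_rad_span[OF M(3) that] by (auto simp: image_iff nclass_eq_iff)
  ultimately show "lin_span Q (nclass ` wrd ` M) = filt n"
    unfolding lin_span_Q filt_eq by blast
qed

lemma lin_dim_filt_le:
  assumes "finite M" "\<And>s. s \<in> M \<Longrightarrow> length s \<le> n" "\<And>w. length w \<le> n \<Longrightarrow> wrd w \<in> rad_span Lin M"
  shows "lin_dim Q (filt n) \<le> card M"
proof -
  have "lin_dim Q (filt n) \<le> card (nclass ` wrd ` M)"
    unfolding lin_dim_def by (rule Least_le) (use filt_spanning[OF assms] in blast)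
  then show ?thesis using filt_spanning(4)[OF assms] by simp
qed

lemma lin_dim_filt_ge:
  assumes B: "spans Lin B" "finite B" and rich: "rich Lin r"
    and r: "\<And>i. \<exists>d\<le>l * Suc i. hdeg d (r i)" and n: "l * m * m \<le> n"
  shows "2 ^ m \<le> lin_dim Q (filt n)"
proof -
  \<comment> \<open>Some finite spanning set has to exist for the \<open>LEAST\<close> in
    \<open>lin_dim\<close> to be attained.\<close>
  obtain M where "finite M" "\<forall>s\<in>M. length s \<le> n" "\<forall>w. length w \<le> n \<longrightarrow> wrd w \<in> rad_span Lin M"
    using finite_spanned[OF B] by blast
  then have "\<exists>k. \<exists>B\<subseteq>filt n. finite B \<and> card B = k \<and> lin_span Q B = filt n"
    using filt_spanning[of M n] by blast
  then have "\<exists>B\<subseteq>filt n. finite B \<and> card B = lin_dim Q (filt n) \<and> lin_span Q B = filt n"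
    unfolding lin_dim_def by (rule LeastI_ex)
  then obtain S where S: "S \<subseteq> nclass ` deg_le n" "finite S" "card S = lin_dim Q (filt n)" "lin_span Q S = filt n"
    by (auto simp: filt_eq)
  obtain T where T: "T \<subseteq> deg_le n" "finite T" "S = nclass ` T" "card T = card S"
    using S(1,2) unfolding subset_image_inj by (metis card_image finite_image_iff)
  have "\<exists>s. s \<in> fa.span T \<and> subprod r 0 bs - s \<in> rad Lin" if bs: "length bs = m" for bs
  proof -
    obtain d where "d \<le> l * (0 + length bs) * length bs" "hdeg d (subprod r 0 bs)"
      using subprod_hdeg[of l r 0 bs] r by blast
    then have "subprod r 0 bs \<in> deg_le n" using bs n by (intro hdeg_deg_le[of d]) auto
    then have "nclass (subprod r 0 bs) \<in> nclass ` fa.span T" using S(4) T(3) lin_span_Q[of T] by (auto simp: filt_eq)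
    then show ?thesis by (auto simp: nclass_eq_iff)
  qed
  then obtain s where "\<And>bs. length bs = m \<Longrightarrow> s bs \<in> fa.span T \<and> subprod r 0 bs - s bs \<in> rad Lin" by metis
  from rich_card[OF rich T(2) this] show ?thesis using S(3) T(4) by simp
qed

lemma GKdim_finite:
  assumes "poly_spanned Lin"
  shows "GKdim Q (nichols_generators G \<Phi> V) < \<infinity>"
proof -
  obtain C d where Cd: "\<And>n. \<exists>M. finite M \<and> card M \<le> C * Suc n ^ d \<and> (\<forall>s\<in>M. length s \<le> n)
     \<and> (\<forall>w. length w \<le> n \<longrightarrow> wrd w \<in> rad_span Lin M)"
    using assms unfolding poly_spanned_def by blast
  have le: "lin_dim Q (filt n) \<le> C * Suc n ^ d" for n
  proof -
    obtain M where "finite M" "card M \<le> C * Suc n ^ d" "\<forall>s\<in>M. length s \<le> n" "\<forall>w. length w \<le> n \<longrightarrow> wrd w \<in> rad_span Lin M"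
      using Cd by blast
    then show ?thesis using lin_dim_filt_le[of M n] by fastforce
  qed
  have "log (real n) (real (lin_dim Q (filt n))) \<le> real (1 + 2 * d)" if n: "n \<ge> C + 2" for n
  proof (cases "lin_dim Q (filt n) = 0")
    case True
    then show ?thesis by (simp add: log_def)
  next
    case False
    \<comment> \<open>This and \<open>C \<le> n\<close> absorb the shift and the constant into
      powers of \<open>n\<close>.\<close>
    have "Suc n \<le> n\<^sup>2"
    proof -
      have "2 * n \<le> n * n" using n by (intro mult_right_mono) auto
      then show ?thesis unfolding power2_eq_square using n by linarith
    qed
    then have "C * Suc n ^ d \<le> n * (n\<^sup>2) ^ d" using n by (intro mult_mono power_mono) auto
    then have "lin_dim Q (filt n) \<le> n ^ (1 + 2 * d)" using le[of n] by (simp add: power_mult)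
    then have "real (lin_dim Q (filt n)) \<le> real n ^ (1 + 2 * d)" by (metis of_nat_le_iff of_nat_power)
    then have "log (real n) (real (lin_dim Q (filt n))) \<le> log (real n) (real n ^ (1 + 2 * d))"
      using n False by (intro log_mono) auto
    also have "\<dots> = real (1 + 2 * d)" using n by (subst log_nat_power) auto
    finally show ?thesis .
  qed
  then have "\<forall>\<^sub>F n in sequentially. ereal (log (real n) (real (lin_dim Q (filt n)))) \<le> ereal (real (1 + 2 * d))"
    by (auto simp: eventually_sequentially)
  then have "GKdim Q (nichols_generators G \<Phi> V) \<le> ereal (real (1 + 2 * d))"
    unfolding GKdim_def by (rule Limsup_bounded)
  then show ?thesis by auto
qed

text \<open>With \<open>n\<close> of the form \<open>c m^2\<close> the dimension is at least
  \<open>2^m\<close>, and \<open>log_n (2^m) = m ln 2 / ln (c m^2)\<close> is unbounded.\<close>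

lemma GKdim_infinite:
  assumes B: "spans Lin B" "finite B" and rich: "rich Lin r" and r: "\<And>i. \<exists>d\<le>l * Suc i. hdeg d (r i)"
  shows "GKdim Q (nichols_generators G \<Phi> V) = \<infinity>"
proof (rule ccontr)
  let ?f = "\<lambda>n. log (real n) (real (lin_dim Q (filt n)))"
  assume "GKdim Q (nichols_generators G \<Phi> V) \<noteq> \<infinity>"
  then have "limsup (\<lambda>n. ereal (?f n)) < \<infinity>" by (simp add: GKdim_def less_top)
  then obtain K where K: "limsup (\<lambda>n. ereal (?f n)) < ereal K" using less_PInf_Ex_of_nat by fastforce
  then have "\<forall>\<^sub>F n in sequentially. ereal (?f n) < ereal K" by (rule Limsup_lessD)
  then obtain n0 where n0: "\<And>n. n \<ge> n0 \<Longrightarrow> ?f n < K" by (auto simp: eventually_sequentially)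
  \<comment> \<open>\<open>Suc l\<close> in place of \<open>l\<close> keeps \<open>c\<close>
    positive and \<open>n\<close> growing even for \<open>l = 0\<close>.\<close>
  define c where "c = real (Suc l)"
  have c: "c > 0" by (simp add: c_def)
  have "(\<lambda>m. K * (ln c / real m + 2 * (ln (real m) / real m))) \<longlonglongrightarrow> K * (0 + 2 * 0)"
    by (intro tendsto_intros filterlim_compose[OF ln_x_over_x_tendsto_0 filterlim_real_sequentially])
  then have "\<forall>\<^sub>F m in sequentially. K * (ln c / real m + 2 * (ln (real m) / real m)) < ln 2"
    by (rule order_tendstoD) simp
  then obtain m0 where m0: "\<And>m. m \<ge> m0 \<Longrightarrow> K * (ln c / real m + 2 * (ln (real m) / real m)) < ln 2"
    by (auto simp: eventually_sequentially)
  define m where "m = Suc (Suc (max m0 n0))"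
  define n where "n = Suc l * m * m"
  have "1 * m \<le> Suc l * m * m" by (rule mult_le_mono1) (simp add: m_def)
  then have mn: "m \<le> n" by (simp add: n_def)
  have "n0 \<le> m" "2 \<le> m" by (simp_all add: m_def)
  then have n: "n \<ge> n0" "n > 1" using mn by linarith+
  have r': "\<exists>d\<le>Suc l * Suc i. hdeg d (r i)" for i using r[of i] by (meson le_trans le_add2 mult_Suc mult_le_mono1 le_SucI order_refl)
  have "2 ^ m \<le> lin_dim Q (filt n)"
    by (rule lin_dim_filt_ge[OF B rich r']) (simp add: n_def)
  then have "2 ^ m \<le> real (lin_dim Q (filt n))" by (metis of_nat_le_iff of_nat_numeral of_nat_power)
  then have "log (real n) (2 ^ m) \<le> ?f n" using n by (intro log_mono) auto
  moreover have "log (real n) (2 ^ m) = real m * ln 2 / ln (c * real m * real m)"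
  proof -
    have rn: "real n = c * real m * real m" by (simp add: n_def c_def algebra_simps)
    show ?thesis unfolding rn by (simp add: log_def ln_realpow)
  qed
  moreover have "K \<le> real m * ln 2 / ln (c * real m * real m)"
  proof -
    have m: "real m > 0" "m \<ge> m0" by (simp_all add: m_def)
    have "ln (c * real m * real m) = real m * (ln c / real m + 2 * (ln (real m) / real m))"
      using m c by (simp add: ln_mult field_simps)
    then have "K * ln (c * real m * real m) = real m * (K * (ln c / real m + 2 * (ln (real m) / real m)))" by simp
    also have "\<dots> \<le> real m * ln 2" using m0[OF m(2)] m(1) by (intro mult_left_mono) auto
    finally have "K * ln (c * real m * real m) \<le> real m * ln 2" .
    moreover have "c * real m * real m = real n" by (simp add: n_def c_def algebra_simps)
    moreover have "ln (real n) > 0" using n by simp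
    ultimately show ?thesis by (simp add: field_simps)
  qed
  ultimately show False using n0[OF n(1)] by linarith
qed

end

section \<open>Schur's lemma and the classification\<close>

locale linear_endo = vector_space scl + Vector_Spaces.linear scl scl T
  for scl :: "'k::field \<Rightarrow> 'v::ab_group_add \<Rightarrow> 'v" (infixr "*s" 75) and T :: "'v \<Rightarrow> 'v"
begin

definition peval :: "'k poly \<Rightarrow> 'v \<Rightarrow> 'v" where
  "peval p v = (\<Sum>i\<le>degree p. coeff p i *s (T ^^ i) v)"

lemma peval_superset: "degree p \<le> n \<Longrightarrow> peval p v = (\<Sum>i\<le>n. coeff p i *s (T ^^ i) v)"
  unfolding peval_def by (rule sum.mono_neutral_left) (auto simp: coeff_eq_0)

lemma peval_factor: "peval ([:- a, 1:] * r) v = T (peval r v) - a *s peval r v"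
proof -
  let ?n = "degree r"
  have deg: "degree ([:- a, 1:] * r) \<le> Suc ?n"
    by (rule order_trans[OF degree_mult_le]) simp
  have coeff: "coeff ([:- a, 1:] * r) i = - a * coeff r i + coeff (pCons 0 r) i" for i by simp
  have "peval ([:- a, 1:] * r) v = (\<Sum>i\<le>Suc ?n. (- a * coeff r i + coeff (pCons 0 r) i) *s (T ^^ i) v)"
    unfolding peval_superset[OF deg] coeff ..
  also have "\<dots> = (\<Sum>i\<le>Suc ?n. (- a * coeff r i) *s (T ^^ i) v) + (\<Sum>i\<le>Suc ?n. coeff (pCons 0 r) i *s (T ^^ i) v)"
    by (simp only: scale_left_distrib sum.distrib)
  also have "(\<Sum>i\<le>Suc ?n. (- a * coeff r i) *s (T ^^ i) v) = - (a *s peval r v)"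
  proof -
    have "(\<Sum>i\<le>Suc ?n. (- a * coeff r i) *s (T ^^ i) v) = (\<Sum>i\<le>?n. (- a * coeff r i) *s (T ^^ i) v)"
      by (simp add: coeff_eq_0)
    then show ?thesis by (simp add: peval_def scale_sum_right sum_negf)
  qed
  also have "(\<Sum>i\<le>Suc ?n. coeff (pCons 0 r) i *s (T ^^ i) v) = T (peval r v)"
    unfolding sum.atMost_Suc_shift by (simp add: peval_def sum scale)
  finally show ?thesis by simp
qed

end

text \<open>\<open>X^n - c\<close> annihilates \<open>v\<close>. Among the nonzero polynomials that
  do, one of least degree has a root \<open>a\<close>; the cofactor of \<open>X - a\<close> does not
  annihilate \<open>v\<close>, and it maps \<open>v\<close> to an eigenvector.\<close>

lemma eigenvector_of_power:
  fixes scl :: "'k::alg_closed_field \<Rightarrow> 'v::ab_group_add \<Rightarrow> 'v" (infixr "*s" 75)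
    and T :: "'v \<Rightarrow> 'v" and v :: 'v
  assumes "linear_endo scl T"
    and n: "n > 0" "\<And>v. (T ^^ n) v = c *s v" and v: "v \<noteq> 0"
  shows "\<exists>a w. w \<noteq> 0 \<and> T w = a *s w"
proof -
  interpret linear_endo scl T by fact
  let ?P = "\<lambda>d. \<exists>p. p \<noteq> 0 \<and> degree p = d \<and> peval p v = 0"
  have "?P (degree (monom 1 n - [:c:]))"
  proof (intro exI conjI)
    have d: "degree (monom 1 n - [:c:]) \<le> n"
      by (rule degree_diff_le) (simp_all add: degree_monom_le)
    have c: "coeff (monom 1 n - [:c:]) i = (if i = n then 1 else if i = 0 then - c else 0)" for i
      using n by (auto simp: coeff_pCons split: nat.splits)
    show "monom 1 n - [:c:] \<noteq> 0" using c[of n] by (metis coeff_0 zero_neq_one)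
    have "peval (monom 1 n - [:c:]) v = (\<Sum>i\<le>n. (if i = n then 1 else if i = 0 then - c else 0) *s (T ^^ i) v)"
      unfolding peval_superset[OF d] c ..
    also have "\<dots> = (\<Sum>i\<in>{0, n}. (if i = n then 1 else if i = 0 then - c else 0) *s (T ^^ i) v)"
      by (rule sum.mono_neutral_right) auto
    also have "\<dots> = 0" using n by simp
    finally show "peval (monom 1 n - [:c:]) v = 0" .
  qed simp
  then have "?P (LEAST d. ?P d)" by (rule LeastI)
  then obtain p where p: "p \<noteq> 0" "degree p = (LEAST d. ?P d)" "peval p v = 0" by blast
  have "degree p > 0"
  proof (rule ccontr)
    assume "\<not> degree p > 0"
    then obtain b where b: "p = [:b:]" using degree_eq_zeroE by blast
    then show False using p(1,3) v by (simp add: peval_def)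
  qed
  then obtain a where "poly p a = 0" using alg_closed_imp_poly_has_root by blast
  then obtain r where r: "p = [:- a, 1:] * r" by (metis poly_eq_0_iff_dvd dvdE)
  then have r0: "r \<noteq> 0" using p(1) by auto
  have "degree p = Suc (degree r)" unfolding r using r0 by (subst degree_mult_eq) auto
  then have "\<not> ?P (degree r)" using p(2) not_less_Least[of "degree r" ?P] by simp
  then have "peval r v \<noteq> 0" using r0 by blast
  moreover have "T (peval r v) = a *s (peval r v)"
    using peval_factor[of a r v] p(3) r by simp
  ultimately show ?thesis by blast
qed

lemma slice_comm:
  assumes "comm_group G" "normalized_3_cocycle G \<Phi>" "g \<in> carrier G" "e \<in> carrier G"
  shows "slice \<Phi> g g e = slice \<Phi> g e g"
  using assms by (simp add: slice_def normalized_3_cocycle_def)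

text \<open>Schur's lemma: the action of \<open>g\<close> commutes with all of \<open>G\<close> because
  \<open>\<Phi>\<^sub>g(g,e) = \<Phi>\<^sub>g(e,g)\<close>, and some power of it is a scalar.\<close>

lemma degree_acts_by_scalar:
  fixes G :: "('g, 'm) monoid_scheme" (structure)
    and \<Phi> :: "'g \<Rightarrow> 'g \<Rightarrow> 'g \<Rightarrow> 'k::alg_closed_field"
    and V :: "('k, 'g, 'v::ab_group_add) yd_module"
  assumes G: "comm_group G" "finite (carrier G)"
    and \<Phi>: "normalized_3_cocycle G \<Phi>" and yd: "twisted_yd_module G \<Phi> V" and simple: "yd_simple G V"
    and g: "g \<in> carrier G" "concentrated_in_degree V g"
  shows "\<exists>q. \<forall>v. act V g v = scal V q v"
proof -
  interpret comm_group G by (rule G)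
  interpret vs: vector_space "scal V" using yd by (simp add: twisted_yd_module_def)
  have cg: "comp V g = UNIV" using g by (simp add: concentrated_in_degree_def)
  have lin: "Vector_Spaces.linear (scal V) (scal V) (act V e)" if "e \<in> carrier G" for e
    using yd that by (simp add: twisted_yd_module_def)
  have proj: "act V e (act V f v) = scal V (slice \<Phi> g e f) (act V (e \<otimes> f) v)"
    if "e \<in> carrier G" "f \<in> carrier G" for e f v
    using yd that g cg by (simp add: twisted_yd_module_def)
  interpret T: Vector_Spaces.linear "scal V" "scal V" "act V g" by (rule lin[OF g(1)])
  have pow: "\<exists>c. \<forall>v. (act V g ^^ n) v = scal V c (act V (g [^] n) v)" for n :: nat
  proof (induction n)
    case 0
    have "act V \<one> v = v" for v using yd by (simp add: twisted_yd_module_def)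
    then show ?case by (intro exI[of _ 1]) simp
  next
    case (Suc n)
    then obtain c where c: "\<And>v. (act V g ^^ n) v = scal V c (act V (g [^] n) v)" by blast
    have "g \<otimes> g [^] n = g [^] Suc n" using g m_comm[of g "g [^] n"] by simp
    then show ?case using g by (intro exI[of _ "c * slice \<Phi> g g (g [^] n)"]) (simp add: c T.scale proj del: nat_pow_Suc)
  qed
  \<comment> \<open>A power of \<open>g\<close> is trivial because \<open>G\<close> is finite, so by
    \<open>pow\<close> a power of its action is a scalar.\<close>
  have "\<not> inj (\<lambda>n :: nat. g [^] n)"
    using finite_subset[of "range (\<lambda>n :: nat. g [^] n)" "carrier G"] G(2) g(1) finite_imageD infinite_UNIV_nat by blast
  then obtain m n :: nat where "m < n" "g [^] m = g [^] n" by (metis injI nat_neq_iff)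
  then have n: "n - m > 0" "g [^] (n - m) = \<one>" using pow_eq_div2[OF g(1)] by simp_all
  obtain c where c: "\<And>v. (act V g ^^ (n - m)) v = scal V c (act V (g [^] (n - m)) v)" using pow by blast
  have "act V \<one> v = v" for v using yd by (simp add: twisted_yd_module_def)
  then have c': "(act V g ^^ (n - m)) v = scal V c v" for v using c n(2) by simp
  obtain v :: 'v where "v \<noteq> 0" using simple by (auto simp: yd_simple_def)
  then obtain q w where w: "w \<noteq> 0" "act V g w = scal V q w"
    using eigenvector_of_power[OF linear_endo.intro[OF vs.vector_space_axioms lin[OF g(1)]] n(1) c'] by blast
  define U where "U = {v. act V g v = scal V q v}"
  have sub: "vs.subspace U"
    by (rule vs.subspaceI) (simp_all add: U_def T.add T.scale vs.scale_right_distrib mult.commute)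
  have "yd_subobject G V U"
    unfolding yd_subobject_def
  proof (intro conjI ballI)
    show "vs.subspace U" by (rule sub)
    have "(\<Union>h\<in>carrier G. U \<inter> comp V h) = U" using g cg by auto
    then show "U = vs.span (\<Union>h\<in>carrier G. U \<inter> comp V h)" using sub by (metis vs.span_eq_iff)
    fix e assume e: "e \<in> carrier G"
    interpret e: Vector_Spaces.linear "scal V" "scal V" "act V e" by (rule lin[OF e])
    show "act V e ` U \<subseteq> U"
    proof
      fix x assume "x \<in> act V e ` U"
      then obtain u where u: "x = act V e u" "act V g u = scal V q u" by (auto simp: U_def)
      have "act V g (act V e u) = act V e (act V g u)"
        using proj[OF g(1) e, of u] proj[OF e g(1), of u] slice_comm[OF G(1) \<Phi> g(1) e] m_comm[OF g(1) e] by simp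
      then show "x \<in> U" using u by (simp add: U_def e.scale)
    qed
  qed
  then have "U = {0} \<or> U = UNIV" using simple by (simp add: yd_simple_def)
  then have "U = UNIV" using w by (auto simp: U_def)
  then show ?thesis by (auto simp: U_def)
qed

section \<open>The criterion in terms of \<open>q\<close> and the dimension\<close>

context yd_line
begin

lemma coordinates:
  assumes B: "vs.independent B" "vs.span B = UNIV"
  defines "co \<equiv> \<lambda>b v. vs.representation B v b"
  shows "co b \<in> Lin" and "b \<in> B \<Longrightarrow> b' \<in> B \<Longrightarrow> co b b' = (if b' = b then 1 else 0)"
    and "finite B \<Longrightarrow> spans Lin B"
proof -
  have sp: "v \<in> vs.span B" for v using B by simp
  show "co b \<in> Lin"
    by (simp add: Lin_def co_def vs.representation_add[OF B(1) sp sp] vs.representation_scale[OF B(1) sp])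
  show "b \<in> B \<Longrightarrow> b' \<in> B \<Longrightarrow> co b b' = (if b' = b then 1 else 0)"
    using vs.representation_basis[OF B(1)] by (auto simp: co_def)
  assume fin: "finite B"
  show "spans Lin B"
    unfolding spans_def
  proof (intro allI exI ballI)
    fix v f assume f: "f \<in> Lin"
    have "f (0 + 0) = f 0 + f 0" using f unfolding Lin_def by blast
    then have f0: "f 0 = 0" by (metis add.right_neutral add_left_imp_eq)
    have fsum: "f (sum h A) = (\<Sum>b\<in>A. f (h b))" for h and A :: "'v set"
    proof (induction A rule: infinite_finite_induct)
      case (insert a A)
      then show ?case using f by (simp add: Lin_def)
    qed (use f0 in simp_all)
    have "v = (\<Sum>b\<in>B. scal V (co b v) b)"
      unfolding co_def using vs.sum_representation_eq[OF B(1) sp fin subset_refl] by simp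
    then have "f v = (\<Sum>b\<in>B. f (scal V (co b v) b))" using fsum by metis
    also have "\<dots> = (\<Sum>b\<in>B. co b v * f b)" using f by (simp add: Lin_def)
    finally show "f v = (\<Sum>b\<in>B. co b v * f b)" .
  qed
qed

lemma GKdim_classification:
  assumes dim: "yd_dim V \<ge> 2"
  shows "GKdim Q (nichols_generators G \<Phi> V) < \<infinity> \<longleftrightarrow> q\<^sup>2 = 1 \<or> (q ^ 3 = 1 \<and> q \<noteq> 1 \<and> yd_dim V = 2)"
proof -
  obtain B where B: "vs.independent B" "vs.span B = UNIV" "card B = yd_dim V"
    by (rule vs.basis_exists[of UNIV]) (auto simp: yd_dim_def)
  have fin: "finite B" using B(3) dim by (auto intro: card_ge_0_finite)
  note sp = coordinates(3)[OF B(1,2) fin]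
  define co where "co b v = vs.representation B v b" for b v
  have coL: "co b \<in> Lin" for b unfolding co_def by (rule coordinates(1)[OF B(1,2)])
  have co: "co b b' = (if b' = b then 1 else 0)" if "b \<in> B" "b' \<in> B" for b b'
    unfolding co_def by (rule coordinates(2)[OF B(1,2) that])
  consider (a) "q\<^sup>2 = 1" | (b) "q ^ 3 = 1" "q \<noteq> 1" "card B = 2" "q\<^sup>2 \<noteq> 1"
    | (c) "q\<^sup>2 \<noteq> 1" "q ^ 3 = 1 \<Longrightarrow> card B > 2"
  proof -
    have "card B = 2 \<or> card B > 2" using dim B(3) by linarith
    moreover have "q \<noteq> 1" if "q\<^sup>2 \<noteq> 1" using that by auto
    ultimately show thesis using that by blast
  qed
  then show ?thesis
  proof cases
    case a
    then show ?thesis using GKdim_finite[OF poly_spanned_swap[OF a sp fin]] by simp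
  next
    case b
    have "(q - 1) * (1 + q + q\<^sup>2) = 0"
      using b(1) by (simp add: algebra_simps power2_eq_square power3_eq_cube)
    then have z: "1 + q + q\<^sup>2 = 0" using b(2) by simp
    obtain x y where xy: "B = {x, y}" using b(3) by (auto simp: card_2_iff)
    show ?thesis using GKdim_finite[OF poly_spanned_cubic[OF z sp[unfolded xy]]] b B(3) by simp
  next
    case c
    obtain x where x: "x \<in> B" using B(3) dim by fastforce
    have "card (B - {x}) \<ge> 1" using x fin B(3) dim by simp
    then obtain y where y: "y \<in> B" "y \<noteq> x" by (metis card.empty Diff_iff all_not_in_conv insertCI not_one_le_zero)
    interpret two_letters q x y "co x" "co y" Lin
      by standard (use x y in \<open>simp_all add: coL co\<close>)
    have "\<exists>w fw. fw \<in> Lin \<and> fw w = 1 \<and> fw x = 0 \<and> fw y = 0 \<and> co x w = 0 \<and> co y w = 0" if "q ^ 3 = 1"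
    proof -
      have "card (B - {x, y}) > 0" using c(2)[OF that] x y fin by (simp add: card_Diff_subset)
      then obtain w where "w \<in> B" "w \<noteq> x" "w \<noteq> y" by (metis Diff_iff card_gt_0_iff ex_in_conv insert_iff)
      then show ?thesis using x y by (intro exI[of _ w] exI[of _ "co w"]) (auto simp: coL co)
    qed
    then obtain r l where "rich Lin r" "\<And>i. \<exists>d\<le>l * Suc i. hdeg d (r i)"
      using rich_exists[OF c(1)] by blast
    then have "GKdim Q (nichols_generators G \<Phi> V) = \<infinity>" using GKdim_infinite[OF sp fin] by blast
    then show ?thesis using c B(3) by auto
  qed
qed

end

theorem theorem1p1:
  fixes G :: "('g, 'm) monoid_scheme"
    and \<Phi> :: "'g \<Rightarrow> 'g \<Rightarrow> 'g \<Rightarrow> 'k::{alg_closed_field, field_char_0}"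
    and V :: "('k, 'g, 'v::ab_group_add) yd_module"
    and g :: 'g
  assumes "comm_group G" and "finite (carrier G)"
    and "normalized_3_cocycle G \<Phi>"
    and "twisted_yd_module G \<Phi> V"
    and "yd_simple G V"
    and "yd_dim V \<ge> 2"
    and "g \<in> carrier G" and "concentrated_in_degree V g"
  shows "GKdim (nichols_algebra G \<Phi> V) (nichols_generators G \<Phi> V) < \<infinity> \<longleftrightarrow>
      (\<forall>v. act V g v = v) \<or>
      (\<forall>v. act V g v = - v) \<or>
      (\<exists>\<zeta>. \<zeta> ^ 3 = 1 \<and> \<zeta> \<noteq> 1 \<and> (\<forall>v. act V g v = scal V \<zeta> v) \<and> yd_dim V = 2)"
proof -
  obtain q where q: "\<And>v. act V g v = scal V q v"
    using degree_acts_by_scalar[OF assms(1-5,7,8)] by blast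
  interpret yd_line q G \<Phi> V g
    by (rule yd_line.intro) (use assms q in simp_all)
  obtain v0 :: 'v where v0: "v0 \<noteq> 0" using assms(5) by (auto simp: yd_simple_def)
  have sc: "(\<forall>v. act V g v = scal V c v) \<longleftrightarrow> q = c" for c
    using q v0 vs.scale_cancel_right by metis
  have "(\<forall>v. act V g v = v) \<longleftrightarrow> q = 1" using sc[of 1] by simp
  moreover have "(\<forall>v. act V g v = - v) \<longleftrightarrow> q = -1" using sc[of "-1"] by simp
  moreover have "q\<^sup>2 = 1 \<longleftrightarrow> q = 1 \<or> q = -1" by (rule power2_eq_1_iff)
  ultimately show ?thesis using GKdim_classification[OF assms(6)] by (auto simp: sc)
qed

end
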